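(* Let $X_1,X_2,\dots$ be a short-memory linear process $X_i=\sum_{j=0}^\infty\psi_j\eta_{i-j}$, let $p>2$, and let $W$ be a Wiener process on $[0,1]$. Let $S_n(t)=\sum_{i=1}^{\lfloor nt\rfloor}X_i$, $t\in[0,1]$. Then $$n^{-1/2}S_n\xrightarrow{\mathscr D^*}\sigma_\eta A_\psi W\qquad\text{in }\mathcal W_p[0,1]\text{ as }n\to\infty .$$
   Context: Short-memory linear process: $(\eta_j)_{j\in\mathbb Z}$ are i.i.d. real random variables on a probability space $(\Omega,\mathcal A,\mathsf P)$ with mean zero and finite variance $\sigma_\eta^2=\mathsf E\eta_1^2\neq0$ ($\sigma_\eta>0$); $(\psi_j)_{j\ge0}$ are real numbers with $\sum_{j\ge0}|\psi_j|<\infty$ and $A_\psi:=\sum_{j\ge0}\psi_j\ne0$; and $X_i=\sum_{j=0}^\infty\psi_j\eta_{i-j}$ for $i\in\mathbb Z$. $p$-variation: $v_p(g)=\sup\{\sum_{i=1}^m|g(t_i)-g(t_{i-1})|^p:0=t_0<\dots<t_m=1,\ m\ge1\}$; $\mathcal W_p[0,1]$ is the (non-separable) Banach space of $g:[0,1]\to\mathbb R$ with $v_p(g)<\infty$, with norm $\|g\|_{[p]}=\sup_{t\in[0,1]}|g(t)|+v_p(g)^{1/p}$. Convergence in outer distribution: let $\mathbb E$ be a metric space, let $Z_n$ be (arbitrary) functions from probability spaces $(\Omega_n,\mathcal A_n,P_n)$ into $\mathbb E$, $n\ge0$, where $Z_0$ takes values in a separable subset of $\mathbb E$ and is measurable for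 the Borel sets on its range. Then $Z_n\xrightarrow{\mathscr D^*}Z_0$ means $\lim_{n\to\infty}E^*h(Z_n)=Eh(Z_0)$ for every bounded continuous $h:\mathbb E\to\mathbb R$, where $E^*T=\inf\{EU:U\text{ measurable},\ EU\text{ exists},\ U\ge T\}$ is the outer integral. As this definition requires, $W$ is understood as a version of the Wiener process taking values in a separable subset of $\mathcal W_p[0,1]$ and Borel measurable on its range. *)

theory Defs
  imports "HOL-Probability.Probability"
begin

section \<open>The space of functions of bounded \<open>p\<close>-variation on the unit interval\<close>

definition unit_partition :: "nat \<Rightarrow> (nat \<Rightarrow> real) \<Rightarrow> bool" where
  "unit_partition m t \<longleftrightarrow> m \<ge> 1 \<and> t 0 = 0 \<and> t m = 1 \<and> (\<forall>i<m. t i < t (Suc i))"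

definition p_variation :: "real \<Rightarrow> (real \<Rightarrow> real) \<Rightarrow> ennreal" where
  "p_variation p g =
     (SUP (m, t) \<in> {(m, t). unit_partition m t}.
        ennreal (\<Sum>i=1..m. \<bar>g (t i) - g (t (i - 1))\<bar> powr p))"

text \<open>
  A function \<open>[0,1] \<rightarrow> \<real>\<close> is represented by its extension to \<^typ>\<open>real\<close> that is
  \<^const>\<open>undefined\<close> outside \<open>{0..1}\<close>, so that equality in the carrier is equality on
  \<open>{0..1}\<close>.
\<close>

definition Wp :: "real \<Rightarrow> (real \<Rightarrow> real) set" where
  "Wp p = {g \<in> extensional {0..1}. p_variation p g < \<infinity>}"

text \<open>
  Both suprema are taken in \<^typ>\<open>ennreal\<close>; they are finite on the carrier, where the
  conversion to \<^typ>\<open>real\<close> is therefore harmless.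
\<close>

definition Wp_norm :: "real \<Rightarrow> (real \<Rightarrow> real) \<Rightarrow> real" where
  "Wp_norm p g =
     enn2real (SUP t\<in>{0..1}. ennreal \<bar>g t\<bar>) + enn2real (p_variation p g) powr (1 / p)"

definition Wp_dist :: "real \<Rightarrow> (real \<Rightarrow> real) \<Rightarrow> (real \<Rightarrow> real) \<Rightarrow> real" where
  "Wp_dist p f g = Wp_norm p (\<lambda>t. f t - g t)"

lemma powr_convex_nonneg:
  fixes x y l p :: real
  assumes "p \<ge> 1" "x \<ge> 0" "y \<ge> 0" "0 \<le> l" "l \<le> 1"
  shows "(l * x + (1 - l) * y) powr p \<le> l * x powr p + (1 - l) * y powr p"
proof -
  have scale: "(c * z) powr p \<le> c * z powr p" if "0 \<le> c" "c \<le> 1" "z \<ge> 0" for c z :: real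
  proof (cases "c = 0")
    case False
    then have "c powr p \<le> c powr 1"
      using that assms(1) by (intro powr_mono') auto
    then show ?thesis
      using that False by (simp add: powr_mult mult_right_mono)
  qed simp
  consider "x = 0" | "y = 0" | "x > 0" "y > 0"
    using assms by fastforce
  then show ?thesis
  proof cases
    case 1
    then show ?thesis using scale[of "1 - l" y] assms by simp
  next
    case 2
    then show ?thesis using scale[of l x] assms by simp
  next
    case 3
    then show ?thesis
      using convex_onD[OF powr_convex[OF assms(1)], of "1 - l" x y] assms by simp
  qed
qed

lemma minkowski_powr:
  fixes a b :: "'i \<Rightarrow> real"
  assumes "finite I" "p \<ge> 1" "A \<ge> 0" "B \<ge> 0"
    and a: "(\<Sum>i\<in>I. \<bar>a i\<bar> powr p) \<le> A powr p"
    and b: "(\<Sum>i\<in>I. \<bar>b i\<bar> powr p) \<le> B powr p"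
  shows "(\<Sum>i\<in>I. \<bar>a i + b i\<bar> powr p) \<le> (A + B) powr p"
proof -
  have null: "c i = 0" if "(\<Sum>i\<in>I. \<bar>c i\<bar> powr p) \<le> 0 powr p" "i \<in> I" for c :: "'i \<Rightarrow> real" and i
  proof -
    have "(\<Sum>i\<in>I. \<bar>c i\<bar> powr p) = 0"
      using that by (intro antisym sum_nonneg) auto
    then show ?thesis
      using that assms(1) by (simp add: sum_nonneg_eq_0_iff)
  qed
  consider "A = 0" | "B = 0" | "A > 0" "B > 0"
    using assms by fastforce
  then show ?thesis
  proof cases
    case 1
    then have "\<And>i. i \<in> I \<Longrightarrow> a i = 0" using null a by blast
    then show ?thesis using 1 b by simp
  next
    case 2
    then have "\<And>i. i \<in> I \<Longrightarrow> b i = 0" using null b by blast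
    then show ?thesis using 2 a by simp
  next
    case 3
    define l where "l = A / (A + B)"
    have l: "0 \<le> l" "l \<le> 1" "1 - l = B / (A + B)"
      using 3 by (auto simp: l_def field_simps)
    have pt: "\<bar>a i + b i\<bar> powr p
        \<le> (A + B) powr p * (l * (\<bar>a i\<bar> powr p / A powr p) + (1 - l) * (\<bar>b i\<bar> powr p / B powr p))"
      for i
    proof -
      have "\<bar>a i + b i\<bar> \<le> (A + B) * (l * (\<bar>a i\<bar> / A) + (1 - l) * (\<bar>b i\<bar> / B))"
      proof -
        have "(A + B) * (l * (\<bar>a i\<bar> / A) + (1 - l) * (\<bar>b i\<bar> / B))
            = ((A + B) * l) * (\<bar>a i\<bar> / A) + ((A + B) * (1 - l)) * (\<bar>b i\<bar> / B)"
          by (simp only: distrib_left mult.assoc)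
        also have "(A + B) * l = A"
          using 3 by (simp add: l_def)
        also have "(A + B) * (1 - l) = B"
          using 3 by (simp add: l(3))
        finally show ?thesis
          using 3 abs_triangle_ineq[of "a i" "b i"] by simp
      qed
      then have "\<bar>a i + b i\<bar> powr p
          \<le> ((A + B) * (l * (\<bar>a i\<bar> / A) + (1 - l) * (\<bar>b i\<bar> / B))) powr p"
        using assms(2) by (intro powr_mono2) auto
      also have "\<dots> = (A + B) powr p * (l * (\<bar>a i\<bar> / A) + (1 - l) * (\<bar>b i\<bar> / B)) powr p"
        using 3 l by (intro powr_mult)
      also have "\<dots> \<le> (A + B) powr p
          * (l * (\<bar>a i\<bar> / A) powr p + (1 - l) * (\<bar>b i\<bar> / B) powr p)"
        using 3 l assms(2) by (intro mult_left_mono powr_convex_nonneg) auto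
      also have "\<dots> = (A + B) powr p
          * (l * (\<bar>a i\<bar> powr p / A powr p) + (1 - l) * (\<bar>b i\<bar> powr p / B powr p))"
        using 3 by (simp add: powr_divide)
      finally show ?thesis .
    qed
    have "(\<Sum>i\<in>I. \<bar>a i + b i\<bar> powr p) \<le>
        (\<Sum>i\<in>I. (A + B) powr p * (l * (\<bar>a i\<bar> powr p / A powr p) + (1 - l) * (\<bar>b i\<bar> powr p / B powr p)))"
      by (rule sum_mono) (rule pt)
    also have "\<dots> = (A + B) powr p *
        (l * ((\<Sum>i\<in>I. \<bar>a i\<bar> powr p) / A powr p) + (1 - l) * ((\<Sum>i\<in>I. \<bar>b i\<bar> powr p) / B powr p))"
      unfolding sum_divide_distrib sum_distrib_left sum.distrib[symmetric] ..
    also have "\<dots> \<le> (A + B) powr p * (l * 1 + (1 - l) * 1)"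
      using 3 l a b by (intro mult_left_mono add_mono) auto
    finally show ?thesis by simp
  qed
qed

lemma unit_partition_01: "unit_partition 1 (\<lambda>i. real i)"
  by (simp add: unit_partition_def)

lemma p_variation_ge:
  assumes "unit_partition m t"
  shows "ennreal (\<Sum>i=1..m. \<bar>g (t i) - g (t (i - 1))\<bar> powr p) \<le> p_variation p g"
  unfolding p_variation_def
  by (rule SUP_upper2[of "(m, t)"]) (use assms in auto)

lemma p_variation_le:
  assumes "\<And>m t. unit_partition m t \<Longrightarrow>
      ennreal (\<Sum>i=1..m. \<bar>g (t i) - g (t (i - 1))\<bar> powr p) \<le> c"
  shows "p_variation p g \<le> c"
  unfolding p_variation_def by (rule SUP_least) (use assms in auto)

lemma p_variation_add:
  assumes "p \<ge> 1" "p_variation p f < \<infinity>" "p_variation p g < \<infinity>"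
  shows "p_variation p (\<lambda>t. f t + g t)
    \<le> ennreal ((enn2real (p_variation p f) powr (1 / p) + enn2real (p_variation p g) powr (1 / p)) powr p)"
proof (rule p_variation_le)
  fix m t assume t: "unit_partition m t"
  have le: "(\<Sum>i=1..m. \<bar>h (t i) - h (t (i - 1))\<bar> powr p) \<le> (enn2real (p_variation p h) powr (1 / p)) powr p"
    if fin: "p_variation p h < \<infinity>" for h
  proof -
    have "enn2real (ennreal (\<Sum>i=1..m. \<bar>h (t i) - h (t (i - 1))\<bar> powr p)) \<le> enn2real (p_variation p h)"
      using fin by (intro enn2real_mono p_variation_ge[OF t]) simp
    then show ?thesis
      using assms(1) by (simp add: powr_powr sum_nonneg)
  qed
  have "(\<Sum>i=1..m. \<bar>(f (t i) - f (t (i - 1))) + (g (t i) - g (t (i - 1)))\<bar> powr p)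
    \<le> (enn2real (p_variation p f) powr (1 / p) + enn2real (p_variation p g) powr (1 / p)) powr p"
    using assms le by (intro minkowski_powr) auto
  then show "ennreal (\<Sum>i=1..m. \<bar>(f (t i) + g (t i)) - (f (t (i - 1)) + g (t (i - 1)))\<bar> powr p)
    \<le> ennreal ((enn2real (p_variation p f) powr (1 / p) + enn2real (p_variation p g) powr (1 / p)) powr p)"
    by (intro ennreal_leI) (simp add: algebra_simps)
qed

lemma sup_abs_finite:
  assumes "p \<ge> 1" "p_variation p g < \<infinity>"
  shows "(SUP t\<in>{0..1}. ennreal \<bar>g t\<bar>) < \<infinity>"
proof -
  define V where "V = enn2real (p_variation p g)"
  have V: "p_variation p g = ennreal V"
    using assms(2) by (simp add: V_def)
  have V0: "V \<ge> 0"
    by (simp add: V_def)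
  have key: "\<bar>g s - g 0\<bar> powr p \<le> V" if s: "s \<in> {0..1}" for s
  proof -
    have "s = 0 \<or> s = 1 \<or> 0 < s \<and> s < 1"
      using s unfolding atLeastAtMost_iff by linarith
    then consider "s = 0" | "s = 1" | "0 < s" "s < 1"
      by blast
    then show ?thesis
    proof cases
      case 1
      then show ?thesis using V0 by simp
    next
      case 2
      then show ?thesis
        using p_variation_ge[OF unit_partition_01, of g p]
        unfolding V using V0 by simp
    next
      case 3
      define t where "t = (\<lambda>i::nat. if i = 0 then 0 else if i = 1 then s else 1)"
      have "unit_partition 2 t"
        using 3 by (auto simp: unit_partition_def t_def less_2_cases_iff)
      from p_variation_ge[OF this, of g p]
      have "\<bar>g s - g 0\<bar> powr p + \<bar>g 1 - g s\<bar> powr p \<le> V"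
        unfolding V using V0 by (simp add: t_def numeral_2_eq_2 flip: ennreal_plus)
      then show ?thesis
        by (smt (verit) powr_ge_zero)
    qed
  qed
  have "ennreal \<bar>g s\<bar> \<le> ennreal (\<bar>g 0\<bar> + V powr (1 / p))" if "s \<in> {0..1}" for s
  proof -
    have "(\<bar>g s - g 0\<bar> powr p) powr (1 / p) \<le> V powr (1 / p)"
      using key[OF that] assms(1) by (intro powr_mono2) auto
    then have "\<bar>g s - g 0\<bar> \<le> V powr (1 / p)"
      using assms(1) by (simp add: powr_powr)
    then show ?thesis by (intro ennreal_leI) auto
  qed
  then have "(SUP t\<in>{0..1}. ennreal \<bar>g t\<bar>) \<le> ennreal (\<bar>g 0\<bar> + V powr (1 / p))"
    by (intro SUP_least)
  then show ?thesis
    using ennreal_less_top le_less_trans by (metis infinity_ennreal_def)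
qed

lemma p_variation_minus_commute: "p_variation p (\<lambda>t. f t - g t) = p_variation p (\<lambda>t. g t - f t)"
proof -
  have "\<bar>(f u - g u) - (f v - g v)\<bar> = \<bar>(g u - f u) - (g v - f v)\<bar>" for u v by simp
  then show ?thesis unfolding p_variation_def by presburger
qed

lemma p_variation_uminus: "p_variation p (\<lambda>t. - f t) = p_variation p f"
  using p_variation_minus_commute[of p "\<lambda>_. 0" f] by simp

lemma p_variation_diff_finite:
  assumes "p \<ge> 1" "p_variation p f < \<infinity>" "p_variation p g < \<infinity>"
  shows "p_variation p (\<lambda>t. f t - g t) < \<infinity>"
  using p_variation_add[OF assms(1,2), of "\<lambda>t. - g t"] assms(3)
  by (simp add: p_variation_uminus) (meson ennreal_less_top le_less_trans)

lemma Wp_norm_triangle: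
  assumes "p \<ge> 1" "p_variation p f < \<infinity>" "p_variation p g < \<infinity>"
  shows "Wp_norm p (\<lambda>t. f t + g t) \<le> Wp_norm p f + Wp_norm p g"
proof -
  let ?S = "\<lambda>g. (SUP t\<in>{0..1}. ennreal \<bar>g t\<bar>)" and ?V = "\<lambda>g. enn2real (p_variation p g)"
  have fin: "?S f < \<infinity>" "?S g < \<infinity>" using assms sup_abs_finite by blast+
  have "?S (\<lambda>t. f t + g t) \<le> ?S f + ?S g"
  proof (rule SUP_least)
    fix t :: real assume t: "t \<in> {0..1}"
    have "ennreal \<bar>f t + g t\<bar> \<le> ennreal \<bar>f t\<bar> + ennreal \<bar>g t\<bar>"
      by (simp flip: ennreal_plus add: ennreal_leI)
    also have "\<dots> \<le> ?S f + ?S g"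
      using t by (intro add_mono SUP_upper)
    finally show "ennreal \<bar>f t + g t\<bar> \<le> ?S f + ?S g" .
  qed
  then have "enn2real (?S (\<lambda>t. f t + g t)) \<le> enn2real (?S f + ?S g)"
    using fin by (intro enn2real_mono) auto
  then have 1: "enn2real (?S (\<lambda>t. f t + g t)) \<le> enn2real (?S f) + enn2real (?S g)"
    using fin by (simp add: enn2real_plus)
  have "?V (\<lambda>t. f t + g t) \<le> (?V f powr (1 / p) + ?V g powr (1 / p)) powr p"
    using enn2real_mono[OF p_variation_add[OF assms]] by simp
  then have "?V (\<lambda>t. f t + g t) powr (1 / p)
      \<le> ((?V f powr (1 / p) + ?V g powr (1 / p)) powr p) powr (1 / p)"
    using assms(1) by (intro powr_mono2) auto
  then have "?V (\<lambda>t. f t + g t) powr (1 / p) \<le> ?V f powr (1 / p) + ?V g powr (1 / p)"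
    using assms(1) by (simp add: powr_powr)
  with 1 show ?thesis by (simp add: Wp_norm_def)
qed

lemma Metric_space_Wp:
  assumes "p \<ge> 1"
  shows "Metric_space (Wp p) (Wp_dist p)"
proof
  fix f g h
  show "0 \<le> Wp_dist p f g" by (simp add: Wp_dist_def Wp_norm_def)
  show "Wp_dist p f g = Wp_dist p g f"
    by (simp add: Wp_dist_def Wp_norm_def abs_minus_commute p_variation_minus_commute[of p f g])
  assume f: "f \<in> Wp p" and g: "g \<in> Wp p"
  have fg: "p_variation p (\<lambda>t. f t - g t) < \<infinity>"
    using f g by (intro p_variation_diff_finite[OF assms]) (auto simp: Wp_def)
  show "Wp_dist p f g = 0 \<longleftrightarrow> f = g"
  proof
    assume "Wp_dist p f g = 0"
    then have "enn2real (SUP t\<in>{0..1}. ennreal \<bar>f t - g t\<bar>) = 0"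
      unfolding Wp_dist_def Wp_norm_def by (smt (verit) enn2real_nonneg powr_ge_zero)
    then have *: "(SUP t\<in>{0..1}. ennreal \<bar>f t - g t\<bar>) = 0"
      using sup_abs_finite[OF assms fg] unfolding enn2real_eq_0_iff by (metis infinity_ennreal_def less_irrefl)
    have "f t = g t" if "t \<in> {0..1}" for t
    proof -
      have "ennreal \<bar>f t - g t\<bar> \<le> 0"
        using SUP_upper[OF that, of "\<lambda>t. ennreal \<bar>f t - g t\<bar>"] unfolding * .
      then show ?thesis by (simp add: ennreal_eq_0_iff)
    qed
    then show "f = g"
      using f g by (intro extensionalityI[of f "{0..1}" g]) (auto simp: Wp_def)
  next
    assume "f = g"
    moreover have "p_variation p (\<lambda>t. 0) \<le> 0"
      by (rule p_variation_le) simp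
    ultimately show "Wp_dist p f g = 0"
      by (simp add: Wp_dist_def Wp_norm_def)
  qed
  assume h: "h \<in> Wp p"
  have gh: "p_variation p (\<lambda>t. g t - h t) < \<infinity>"
    using g h by (intro p_variation_diff_finite[OF assms]) (auto simp: Wp_def)
  show "Wp_dist p f h \<le> Wp_dist p f g + Wp_dist p g h"
    using Wp_norm_triangle[OF assms fg gh] by (simp add: Wp_dist_def)
qed

section \<open>Outer integral and convergence in outer distribution\<close>

text \<open>
  \<^const>\<open>e2ennreal\<close> truncates negative values to \<open>0\<close>, so the two integrals are those of
  the positive and the negative part of \<open>U\<close>; the expectation exists, possibly with an
  infinite value, unless both are infinite.
\<close>

definition expectation_exists :: "'a measure \<Rightarrow> ('a \<Rightarrow> ereal) \<Rightarrow> bool" where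
  "expectation_exists P U \<longleftrightarrow> U \<in> borel_measurable P \<and>
     ((\<integral>\<^sup>+ \<omega>. e2ennreal (U \<omega>) \<partial>P) < \<infinity> \<or> (\<integral>\<^sup>+ \<omega>. e2ennreal (- U \<omega>) \<partial>P) < \<infinity>)"

definition ext_expectation :: "'a measure \<Rightarrow> ('a \<Rightarrow> ereal) \<Rightarrow> ereal" where
  "ext_expectation P U =
     enn2ereal (\<integral>\<^sup>+ \<omega>. e2ennreal (U \<omega>) \<partial>P) - enn2ereal (\<integral>\<^sup>+ \<omega>. e2ennreal (- U \<omega>) \<partial>P)"

definition outer_expectation :: "'a measure \<Rightarrow> ('a \<Rightarrow> ereal) \<Rightarrow> ereal" where
  "outer_expectation P T =
     Inf {ext_expectation P U | U. expectation_exists P U \<and> (\<forall>\<omega>\<in>space P. T \<omega> \<le> U \<omega>)}"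

context Metric_space
begin

definition separable_borel :: "'b measure \<Rightarrow> ('b \<Rightarrow> 'a) \<Rightarrow> bool" where
  "separable_borel P Z \<longleftrightarrow>
     (\<exists>S\<subseteq>M. separable_space (subtopology mtopology S) \<and> Z ` space P \<subseteq> S) \<and>
     Z \<in> measurable P (sigma (Z ` space P) {U. openin (subtopology mtopology (Z ` space P)) U})"

text \<open>No measurability is required of the approximating maps \<open>Z n\<close>.\<close>

definition converges_outer_distr ::
  "(nat \<Rightarrow> 'b measure) \<Rightarrow> (nat \<Rightarrow> 'b \<Rightarrow> 'a) \<Rightarrow> 'c measure \<Rightarrow> ('c \<Rightarrow> 'a) \<Rightarrow> bool" where
  "converges_outer_distr P Z P0 Z0 \<longleftrightarrow>
     (\<forall>n. prob_space (P n) \<and> Z n ` space (P n) \<subseteq> M) \<and>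
     prob_space P0 \<and> separable_borel P0 Z0 \<and>
     (\<forall>h. continuous_map mtopology euclideanreal h \<and> bounded (h ` M) \<longrightarrow>
        (\<lambda>n. outer_expectation (P n) (\<lambda>\<omega>. ereal (h (Z n \<omega>))))
          \<longlonglongrightarrow> ereal (\<integral>\<omega>. h (Z0 \<omega>) \<partial>P0))"

end

section \<open>Wiener process and linear processes\<close>

definition wiener_process_01 :: "'b measure \<Rightarrow> (real \<Rightarrow> 'b \<Rightarrow> real) \<Rightarrow> bool" where
  "wiener_process_01 N W \<longleftrightarrow>
     prob_space N \<and>
     (\<forall>t\<in>{0..1}. W t \<in> borel_measurable N) \<and>
     (AE \<omega> in N. W 0 \<omega> = 0) \<and>
     (\<forall>s t. 0 \<le> s \<and> s < t \<and> t \<le> 1 \<longrightarrow>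
        distributed N lborel (\<lambda>\<omega>. W t \<omega> - W s \<omega>) (normal_density 0 (sqrt (t - s)))) \<and>
     (\<forall>m t. unit_partition m t \<longrightarrow>
        prob_space.indep_vars N (\<lambda>_. borel) (\<lambda>i \<omega>. W (t (Suc i)) \<omega> - W (t i) \<omega>) {..<m}) \<and>
     (AE \<omega> in N. continuous_on {0..1} (\<lambda>t. W t \<omega>))"

text \<open>
  Under the usual moment and summability assumptions the series converges almost surely;
  on the exceptional null set \<^const>\<open>suminf\<close> has an unspecified value.
\<close>

definition linear_process :: "(nat \<Rightarrow> real) \<Rightarrow> (int \<Rightarrow> 'a \<Rightarrow> real) \<Rightarrow> int \<Rightarrow> 'a \<Rightarrow> real" where
  "linear_process \<psi> \<eta> i \<omega> = (\<Sum>j. \<psi> j * \<eta> (i - int j) \<omega>)"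

definition partial_sum_process :: "(int \<Rightarrow> 'a \<Rightarrow> real) \<Rightarrow> nat \<Rightarrow> real \<Rightarrow> 'a \<Rightarrow> real" where
  "partial_sum_process X n t \<omega> = (\<Sum>i=1..\<lfloor>real n * t\<rfloor>. X i \<omega>)"

end

theory Submission
  imports Defs
begin

text \<open>
  For a walk with independent centred increments, restart the path whenever it has moved by \<open>\<lambda>\<close> since
  the last restart. The number of restarts bounds the number of disjoint increments of size at least
  \<open>2\<lambda>\<close>, and its mean is at most \<open>n\<sigma>\<^sup>2 / \<lambda>\<^sup>2\<close>. Summing over dyadic \<open>\<lambda>\<close> gives Lepingle's bound
  \<open>E \<parallel>S\<^sub>n\<parallel>\<^sub>[\<^sub>q\<^sub>] \<le> C\<^sub>q \<sigma> n\<^sup>1\<^sup>/\<^sup>2\<close> for every \<open>q > 2\<close>, under second moments only. With \<open>2 < q < p\<close>, the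
  interpolation \<open>v\<^sub>p \<le> (2 sup |g|)\<^sup>p\<^sup>-\<^sup>q v\<^sub>q\<close> turns uniform smallness into smallness in \<open>\<W>\<^sub>p\<close>.
  This shows that replacing the innovations \<open>\<eta>\<^sub>i\<^sub>-\<^sub>j\<close> by \<open>\<eta>\<^sub>i\<close> costs nothing in the limit (for fixed \<open>j\<close>, and
  then in mean after summation against \<open>|\<psi>\<^sub>j|\<close>), that the walk is close to its restriction to a grid of mesh \<open>1/m\<close>
  (Ottaviani's inequality with the central limit theorem), and that the Wiener process is the limit
  of its own grid approximations. On a fixed grid, Skorohod coupling of the block sums gives convergence.
  The partial sum processes are continuous in finitely many random coordinates, so continuous functionals of them are
  measurable and outer expectations are expectations; an inf-convolution reduces continuous to Lipschitz functionals.
\<close>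

section \<open>Functions of finite p-variation\<close>

text \<open>The obstacle is that \<open>Wp p\<close> is not separable, so the usual route through
  tightness and Prokhorov's theorem is not at hand. Paths are instead compared on one probability
  space, and only vectors of \<open>m\<close> block sums are passed to the limit in law. Closeness
  of paths controls Lipschitz functionals only, which is what makes the inf-convolution necessary.
  The grid comparison is where second moments look too weak. Chebyshev's inequality bounds the
  probability that one block of length about \<open>n/m\<close> moves by \<open>x\<close> by a
  constant over \<open>m\<close>, and a union over \<open>m\<close> blocks gains nothing. The
  Gaussian limit has a fourth moment of order \<open>1/m^2\<close>, so for fixed \<open>m\<close>
  and large \<open>n\<close> the union costs only order \<open>1/m\<close>. Hence the order of
  limits: \<open>n\<close> first, then \<open>m\<close>. The exponent 2 enters through one geometric
  series: increments of relative size \<open>2^-k\<close> weigh \<open>2^(-kq)\<close> each and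
  number at most a constant times \<open>4^k\<close> in mean, which is summable exactly when
  \<open>q > 2\<close>.\<close>

lemma sum_powr_le_powr_sum:
  fixes a :: "'i \<Rightarrow> real"
  assumes "finite I" "p \<ge> 1" "\<And>i. i \<in> I \<Longrightarrow> a i \<ge> 0"
  shows "(\<Sum>i\<in>I. a i powr p) \<le> (\<Sum>i\<in>I. a i) powr p"
proof -
  have "(\<Sum>i\<in>I. a i powr p) = (\<Sum>i\<in>I. a i * a i powr (p - 1))"
    using assms by (intro sum.cong refl) (simp add: powr_mult_base)
  also have "... \<le> (\<Sum>i\<in>I. a i * (\<Sum>i\<in>I. a i) powr (p - 1))"
    using assms by (intro sum_mono mult_left_mono powr_mono2 member_le_sum) auto
  also have "... = (\<Sum>i\<in>I. a i) powr p"
    using assms by (simp add: powr_mult_base sum_nonneg flip: sum_distrib_right)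
  finally show ?thesis .
qed

lemma unit_partition_mono:
  assumes "unit_partition m t" "i \<le> j" "j \<le> m"
  shows "t i \<le> t j"
  using assms(2,3)
proof (induction j rule: dec_induct)
  case (step j)
  have "t j < t (Suc j)" using assms(1) step unfolding unit_partition_def by auto
  then show ?case using step by auto
qed simp

lemma unit_partition_in:
  assumes "unit_partition m t" "i \<le> m" shows "t i \<in> {0..1}"
  using unit_partition_mono[OF assms(1), of 0 i] unit_partition_mono[OF assms(1), of i m] assms
  by (auto simp: unit_partition_def)

section \<open>Elementary rules for the p-variation norm\<close>

lemma p_variation_cong:
  assumes "\<And>t. t \<in> {0..1} \<Longrightarrow> f t = g t"
  shows "p_variation p f = p_variation p g"
  unfolding p_variation_def
  by (intro SUP_cong refl) (auto intro!: arg_cong[where f=ennreal] sum.cong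
      simp: assms[OF unit_partition_in])

lemma Wp_norm_cong:
  assumes "\<And>t. t \<in> {0..1} \<Longrightarrow> f t = g t"
  shows "Wp_norm p f = Wp_norm p g"
proof -
  have "(SUP t\<in>{0..1}. ennreal \<bar>f t\<bar>) = (SUP t\<in>{0..1}. ennreal \<bar>g t\<bar>)"
    by (intro SUP_cong refl) (simp only: assms)
  then show ?thesis
    unfolding Wp_norm_def using p_variation_cong[of f g p] assms by simp
qed

lemma Wp_norm_nonneg: "Wp_norm p g \<ge> 0"
  by (simp add: Wp_norm_def)

lemma increment_sum_reindex:
  "(\<Sum>i=1..m. \<bar>g (t i) - g (t (i - 1))\<bar> powr p) =
   (\<Sum>i<m. \<bar>g (t (Suc i)) - g (t i)\<bar> powr p)" for g :: "real \<Rightarrow> real" and t :: "nat \<Rightarrow> real"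
  by (simp add: sum.atLeast1_atMost_eq)

lemma p_variation_le_lessThan:
  assumes "\<And>m t. unit_partition m t \<Longrightarrow>
      (\<Sum>i<m. \<bar>g (t (Suc i)) - g (t i)\<bar> powr p) \<le> c"
  shows "p_variation p g \<le> ennreal c"
  by (rule p_variation_le) (use assms in \<open>simp only: increment_sum_reindex ennreal_leI\<close>)

lemma p_variation_scale:
  assumes "p \<ge> 1"
  shows "p_variation p (\<lambda>t. c * g t) = ennreal (\<bar>c\<bar> powr p) * p_variation p g"
proof -
  have "(\<Sum>i=1..m. \<bar>c * g (t i) - c * g (t (i - 1))\<bar> powr p) =
      \<bar>c\<bar> powr p * (\<Sum>i=1..m. \<bar>g (t i) - g (t (i - 1))\<bar> powr p)" for m and t :: "nat \<Rightarrow> real"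
    by (simp add: sum_distrib_left abs_mult powr_mult flip: right_diff_distrib)
  then show ?thesis
    unfolding p_variation_def
    by (subst SUP_mult_left_ennreal) (auto intro!: SUP_cong simp: ennreal_mult sum_nonneg)
qed

lemma Wp_norm_scale:
  assumes "p \<ge> 1"
  shows "Wp_norm p (\<lambda>t. c * g t) = \<bar>c\<bar> * Wp_norm p g"
proof -
  have "(SUP t\<in>{0..1}. ennreal \<bar>c * g t\<bar>) = ennreal \<bar>c\<bar> * (SUP t\<in>{0..1}. ennreal \<bar>g t\<bar>)"
    by (subst SUP_mult_left_ennreal) (auto intro!: SUP_cong simp: ennreal_mult abs_mult)
  then show ?thesis
    using assms by (simp add: Wp_norm_def p_variation_scale enn2real_mult powr_mult powr_powr distrib_left)
qed

lemma Wp_norm_le: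
  assumes "\<And>t. t \<in> {0..1} \<Longrightarrow> \<bar>g t\<bar> \<le> s" "p_variation p g \<le> ennreal v" "0 \<le> s" "0 \<le> v" "p \<ge> 1"
  shows "Wp_norm p g \<le> s + v powr (1 / p)"
proof -
  have "(SUP t\<in>{0..1}. ennreal \<bar>g t\<bar>) \<le> ennreal s"
    using assms by (intro SUP_least ennreal_leI)
  then have "enn2real (SUP t\<in>{0..1}. ennreal \<bar>g t\<bar>) \<le> s"
    using assms by (simp add: enn2real_leI)
  moreover have "enn2real (p_variation p g) \<le> v"
    using assms by (simp add: enn2real_leI)
  ultimately show ?thesis
    unfolding Wp_norm_def using assms by (intro add_mono powr_mono2) auto
qed

lemma p_variation_le_Wp_norm:
  assumes "p_variation p g < \<infinity>" "p \<ge> 1"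
  shows "p_variation p g \<le> ennreal (Wp_norm p g powr p)"
proof -
  have "enn2real (p_variation p g) = (enn2real (p_variation p g) powr (1/p)) powr p"
    using assms by (simp add: powr_powr)
  also have "... \<le> Wp_norm p g powr p"
    unfolding Wp_norm_def using assms by (intro powr_mono2) auto
  finally show ?thesis using assms(1)
    by (metis ennreal_enn2real ennreal_leI infinity_ennreal_def)
qed

text \<open>Repeated points contribute zero increments, so weakly increasing partitions may be used.\<close>

lemma p_variation_ge_weak:
  assumes "u 0 = 0" "u m = 1" "\<And>i. i < m \<Longrightarrow> u i \<le> u (Suc i)"
  shows "ennreal (\<Sum>i<m. \<bar>g (u (Suc i)) - g (u i)\<bar> powr p) \<le> p_variation p g"
proof -
  have "\<exists>m' t. t 0 = (0::real) \<and> t m' = u m \<and> (\<forall>i<m'. t i < t (Suc i)) \<and>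
     (\<Sum>i<m. \<bar>g (u (Suc i)) - g (u i)\<bar> powr p) = (\<Sum>i<m'. \<bar>g (t (Suc i)) - g (t i)\<bar> powr p)"
    using assms(1,3)
  proof (induction m)
    case 0
    then show ?case by (intro exI[of _ 0] exI[of _ u]) auto
  next
    case (Suc m)
    then obtain m' t where t: "t 0 = (0::real)" "t m' = u m" "\<forall>i<m'. t i < t (Suc i)"
      "(\<Sum>i<m. \<bar>g (u (Suc i)) - g (u i)\<bar> powr p) = (\<Sum>i<m'. \<bar>g (t (Suc i)) - g (t i)\<bar> powr p)"
      by auto
    show ?case
    proof (cases "u m = u (Suc m)")
      case True
      then show ?thesis using t by (intro exI[of _ m'] exI[of _ t]) auto
    next
      case False
      define t' where "t' = t(Suc m' := u (Suc m))"
      have "u m < u (Suc m)" using False Suc.prems(2)[of m] by auto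
      then show ?thesis
        using t by (intro exI[of _ "Suc m'"] exI[of _ t']) (auto simp: t'_def less_Suc_eq)
    qed
  qed
  then obtain m' t where t: "t 0 = (0::real)" "t m' = 1" "\<forall>i<m'. t i < t (Suc i)"
      and eq: "(\<Sum>i<m. \<bar>g (u (Suc i)) - g (u i)\<bar> powr p) = (\<Sum>i<m'. \<bar>g (t (Suc i)) - g (t i)\<bar> powr p)"
    using assms(2) by auto
  have "m' \<noteq> 0" using t by (metis zero_neq_one)
  then have "unit_partition m' t" using t by (auto simp: unit_partition_def)
  from p_variation_ge[OF this, of g p] show ?thesis by (simp only: eq increment_sum_reindex)
qed

text \<open>The points 0, \<open>s\<close>, 1 form a weak partition, one of whose two increments is
  \<open>g s - g 0\<close>; weakness covers \<open>s = 0\<close> and \<open>s = 1\<close>.\<close>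

lemma abs_le_p_variation:
  assumes "p \<ge> 1" "p_variation p g \<le> ennreal v" "v \<ge> 0" "s \<in> {0..1}"
  shows "\<bar>g s - g 0\<bar> \<le> v powr (1 / p)"
proof -
  define u where "u i = (if i = 0 then 0 else if i = 1 then s else 1)" for i :: nat
  have "ennreal (\<Sum>i<2. \<bar>g (u (Suc i)) - g (u i)\<bar> powr p) \<le> ennreal v"
    using assms(4) by (intro order_trans[OF p_variation_ge_weak assms(2)]) (auto simp: u_def)
  then have "(\<Sum>i<2. \<bar>g (u (Suc i)) - g (u i)\<bar> powr p) \<le> v"
    using assms(3) by (simp add: ennreal_le_iff)
  then have "\<bar>g s - g 0\<bar> powr p \<le> v"
    by (simp add: u_def numeral_2_eq_2) (smt (verit) powr_ge_zero)
  then have "(\<bar>g s - g 0\<bar> powr p) powr (1/p) \<le> v powr (1/p)"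
    using assms by (intro powr_mono2) auto
  then show ?thesis using assms by (simp add: powr_powr)
qed

lemma Wp_norm_le_p_variation:
  assumes "g 0 = 0" "p_variation p g \<le> ennreal v" "0 \<le> v" "p \<ge> 1"
  shows "Wp_norm p g \<le> 2 * v powr (1 / p)"
  using Wp_norm_le[of g "v powr (1/p)" p v] abs_le_p_variation[of p g v] assms by simp

lemma abs_le_Wp_norm:
  assumes "p_variation p g < \<infinity>" "p \<ge> 1" "t \<in> {0..1}"
  shows "\<bar>g t\<bar> \<le> Wp_norm p g"
proof -
  let ?S = "SUP t\<in>{0..1}. ennreal \<bar>g t\<bar>"
  have "ennreal \<bar>g t\<bar> \<le> ?S" using assms(3) by (rule SUP_upper)
  then have "enn2real (ennreal \<bar>g t\<bar>) \<le> enn2real ?S"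
    using sup_abs_finite[OF assms(2,1)] by (intro enn2real_mono) auto
  then show ?thesis by (simp add: Wp_norm_def add_increasing2)
qed

section \<open>Interpolation between variation exponents\<close>

lemma p_variation_interpolate:
  assumes "1 \<le> q" "q \<le> p" "\<And>t. t \<in> {0..1} \<Longrightarrow> \<bar>g t\<bar> \<le> s"
  shows "p_variation p g \<le> ennreal ((2 * s) powr (p - q)) * p_variation q g"
proof (rule p_variation_le)
  fix m t assume t: "unit_partition m t"
  have "\<bar>g (t (Suc i)) - g (t i)\<bar> powr p
      \<le> (2 * s) powr (p-q) * \<bar>g (t (Suc i)) - g (t i)\<bar> powr q" if "i < m" for i
  proof -
    have "\<bar>g (t (Suc i)) - g (t i)\<bar> \<le> 2 * s"
      using assms(3)[OF unit_partition_in[OF t, of i]] assms(3)[OF unit_partition_in[OF t, of "Suc i"]] that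
      by auto
    then have "\<bar>g (t (Suc i)) - g (t i)\<bar> powr (p - q) \<le> (2 * s) powr (p-q)"
      using assms by (intro powr_mono2) auto
    then have "\<bar>g (t (Suc i)) - g (t i)\<bar> powr (p - q) * \<bar>g (t (Suc i)) - g (t i)\<bar> powr q
        \<le> (2 * s) powr (p-q) * \<bar>g (t (Suc i)) - g (t i)\<bar> powr q"
      by (intro mult_right_mono) auto
    then show ?thesis by (simp flip: powr_add)
  qed
  then have "(\<Sum>i=1..m. \<bar>g (t i) - g (t (i - 1))\<bar> powr p)
      \<le> (2 * s) powr (p-q) * (\<Sum>i=1..m. \<bar>g (t i) - g (t (i - 1))\<bar> powr q)"
    unfolding increment_sum_reindex by (auto simp: sum_distrib_left intro!: sum_mono)
  then have "ennreal (\<Sum>i=1..m. \<bar>g (t i) - g (t (i - 1))\<bar> powr p)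
      \<le> ennreal ((2 * s) powr (p-q)) * ennreal (\<Sum>i=1..m. \<bar>g (t i) - g (t (i - 1))\<bar> powr q)"
    by (simp flip: ennreal_mult'' add: sum_nonneg ennreal_leI)
  also have "... \<le> ennreal ((2 * s) powr (p-q)) * p_variation q g"
    by (intro mult_left_mono p_variation_ge t) auto
  finally show "ennreal (\<Sum>i=1..m. \<bar>g (t i) - g (t (i - 1))\<bar> powr p)
    \<le> ennreal ((2 * s) powr (p-q)) * p_variation q g" .
qed

text \<open>Young's form of the interpolation inequality. The sup bound and the
  \<open>q\<close>-norm enter additively and \<open>L\<close> depends on neither \<open>g\<close>
  nor \<open>s\<close>, so the inequality survives taking expectations when \<open>s\<close> is
  itself random; a large \<open>K\<close> makes a merely bounded \<open>q\<close>-norm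
  harmless.\<close>

lemma Wp_norm_interpolate:
  assumes "1 \<le> q" "q < p" "K > 0"
  shows "\<exists>L\<ge>0. \<forall>g s. (\<forall>t\<in>{0..1}. \<bar>g t\<bar> \<le> s) \<longrightarrow> p_variation q g < \<infinity> \<longrightarrow>
    p_variation p g < \<infinity> \<and> Wp_norm p g \<le> L * s + Wp_norm q g / K"
proof -
  define \<theta> where "\<theta> = q / p"
  have \<theta>: "0 < \<theta>" "\<theta> < 1" using assms by (auto simp: \<theta>_def)
  \<comment> \<open>Tuned so that the factors \<open>inverse k powr (1 - \<theta>)\<close> and
    \<open>K powr \<theta>\<close> cancel below.\<close>
  define k where "k = K powr (\<theta> / (1 - \<theta>))"
  have k: "k > 0" using assms by (simp add: k_def)
  have "p_variation p g < \<infinity> \<and> Wp_norm p g \<le> (1 + 2 * k) * s + Wp_norm q g / K"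
    if s: "\<forall>t\<in>{0..1}. \<bar>g t\<bar> \<le> s" and fin: "p_variation q g < \<infinity>" for g s
  proof -
    define v where "v = enn2real (p_variation q g)"
    have v: "p_variation q g = ennreal v" "v \<ge> 0" using fin by (auto simp: v_def)
    have s0: "s \<ge> 0" using s by (auto dest!: bspec[of _ _ 0])
    have le: "p_variation p g \<le> ennreal ((2 * s) powr (p - q) * v)"
      using p_variation_interpolate[of q p g s] assms s v by (simp add: ennreal_mult)
    then have fin': "p_variation p g < \<infinity>" by (simp add: order_le_less_trans)
    define b where "b = v powr (1/q)"
    have b: "b \<ge> 0" "b \<le> Wp_norm q g" by (auto simp: b_def Wp_norm_def v_def)
    \<comment> \<open>One number majorises both factors of the geometric mean: \<open>2 * s\<close>
      is at most \<open>R / k\<close> and \<open>b\<close> is at most \<open>R * K\<close>. The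
      exponents of \<open>R\<close> then add up to 1.\<close>
    define R where "R = max (2 * s * k) (b / K)"
    have R: "R \<ge> 0" "2 * s \<le> R * inverse k" "b \<le> R * K"
    proof -
      have "2 * s * k \<le> R" "b / K \<le> R" by (auto simp: R_def)
      then show "2 * s \<le> R * inverse k" "b \<le> R * K" using k assms by (auto simp: field_simps)
      show "R \<ge> 0" using b assms by (auto simp: R_def le_max_iff_disj)
    qed
    have "Wp_norm p g \<le> s + ((2 * s) powr (p - q) * v) powr (1/p)"
      using s s0 v le assms by (intro Wp_norm_le) auto
    also have "((2 * s) powr (p - q) * v) powr (1/p) = (2 * s) powr (1 - \<theta>) * b powr \<theta>"
      using assms v by (simp add: powr_mult powr_powr b_def \<theta>_def diff_divide_distrib)
    also have "... \<le> (R * inverse k) powr (1 - \<theta>) * (R * K) powr \<theta>"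
      using R b \<theta> s0 by (intro mult_mono[OF powr_mono2 powr_mono2]) auto
    also have "... = R powr (1 - \<theta>) * R powr \<theta> * (inverse k powr (1 - \<theta>) * K powr \<theta>)"
      by (simp add: powr_mult)
    also have "inverse k powr (1 - \<theta>) * K powr \<theta> = 1"
    proof -
      have "inverse k powr (1 - \<theta>) = K powr (- (\<theta> / (1 - \<theta>)) * (1 - \<theta>))"
        unfolding k_def powr_powr[symmetric] by (simp only: powr_minus)
      also have "- (\<theta> / (1 - \<theta>)) * (1 - \<theta>) = - \<theta>" using \<theta> by simp
      finally show ?thesis using assms by (simp add: powr_minus)
    qed
    also have "R powr (1 - \<theta>) * R powr \<theta> = R"
      using R \<theta> by (simp flip: powr_add)
    also have "R \<le> 2 * s * k + Wp_norm q g / K"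
      using b s0 k assms by (auto simp: R_def field_simps intro: order_trans)
    finally show ?thesis using fin' by (simp add: algebra_simps)
  qed
  then show ?thesis using k by (intro exI[of _ "1 + 2*k"]) auto
qed

section \<open>Sampling on a grid and pointwise limits\<close>

abbreviation grid_point :: "nat \<Rightarrow> real \<Rightarrow> real" where
  "grid_point m t \<equiv> real (nat \<lfloor>real m * t\<rfloor>) / real m"

text \<open>A monotone time change fixing 0 and 1 carries partitions to weak partitions, so it
  cannot raise the variation.\<close>

lemma p_variation_subsample:
  assumes "m \<ge> 1"
  shows "p_variation q (\<lambda>t. g (grid_point m t)) \<le> p_variation q g"
proof (rule p_variation_le)
  fix k t assume t: "unit_partition k t"
  define u where "u i = real (nat \<lfloor>real m * t i\<rfloor>) / real m" for i
  have "ennreal (\<Sum>i<k. \<bar>g (u (Suc i)) - g (u i)\<bar> powr q) \<le> p_variation q g"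
  proof (rule p_variation_ge_weak)
    show "u 0 = 0" "u k = 1" using t assms by (auto simp: u_def unit_partition_def)
    fix i assume "i < k"
    then have "t i \<le> t (Suc i)" using unit_partition_mono[OF t] by auto
    then show "u i \<le> u (Suc i)"
      unfolding u_def by (intro divide_right_mono of_nat_mono nat_mono floor_mono mult_left_mono) auto
  qed
  then show "ennreal (\<Sum>i = 1..k. \<bar>g (real (nat \<lfloor>real m * t i\<rfloor>) / real m)
      - g (real (nat \<lfloor>real m * t (i - 1)\<rfloor>) / real m)\<bar> powr q) \<le> p_variation q g"
    unfolding increment_sum_reindex[where g="\<lambda>t. g (grid_point m t)"]
    by (simp add: u_def)
qed

lemma Wp_norm_mono:
  assumes "\<And>t. t \<in> {0..1} \<Longrightarrow> \<exists>s\<in>{0..1}. \<bar>g t\<bar> \<le> \<bar>f s\<bar>"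
    and "p_variation p g \<le> p_variation p f" "p_variation p f < \<infinity>" "p \<ge> 1"
  shows "Wp_norm p g \<le> Wp_norm p f"
proof -
  have "(SUP t\<in>{0..1}. ennreal \<bar>g t\<bar>) \<le> (SUP t\<in>{0..1}. ennreal \<bar>f t\<bar>)"
    by (intro SUP_mono) (use assms(1) ennreal_leI in blast)
  then show ?thesis
    unfolding Wp_norm_def using assms sup_abs_finite[of p f]
    by (intro add_mono powr_mono2 enn2real_mono) auto
qed

lemma Wp_norm_subsample:
  assumes "m \<ge> 1" "p \<ge> 1" "p_variation p g < \<infinity>"
  shows "Wp_norm p (\<lambda>t. g (grid_point m t)) \<le> Wp_norm p g"
proof (rule Wp_norm_mono)
  fix t :: real assume t: "t \<in> {0..1}"
  have "\<lfloor>real m * t\<rfloor> \<le> \<lfloor>real m * 1\<rfloor>"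
    using t by (intro floor_mono mult_left_mono) auto
  then have "grid_point m t \<in> {0..1}"
    using assms t by (auto simp: divide_le_eq)
  then show "\<exists>s\<in>{0..1}. \<bar>g (grid_point m t)\<bar> \<le> \<bar>g s\<bar>" by blast
qed (use assms p_variation_subsample in auto)

text \<open>The sum over a fixed partition reads finitely many values of the function, so it passes
  to the pointwise limit. The bound is asked only infinitely often because it will come from a
  finite lower limit.\<close>

lemma p_variation_lsc:
  assumes "\<And>t. t \<in> {0..1} \<Longrightarrow> (\<lambda>r. g r t) \<longlonglongrightarrow> g' t"
    and "\<exists>\<^sub>F r in sequentially. p_variation p (g r) \<le> ennreal c" "p > 0" "c \<ge> 0"
  shows "p_variation p g' \<le> ennreal c"
proof (rule p_variation_le_lessThan)
  fix m t assume t: "unit_partition m t"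
  let ?S = "\<lambda>g. \<Sum>i<m. \<bar>g (t (Suc i)) - g (t i)\<bar> powr p"
  have lim: "(\<lambda>r. ?S (g r)) \<longlonglongrightarrow> ?S g'"
    using assms unit_partition_in[OF t]
    by (intro tendsto_sum tendsto_powr' tendsto_rabs tendsto_diff) auto
  show "?S g' \<le> c"
  proof (rule ccontr)
    assume "\<not> ?S g' \<le> c"
    then have "\<forall>\<^sub>F r in sequentially. ?S (g r) > c"
      using order_tendstoD(1)[OF lim] by simp
    then have "\<forall>\<^sub>F r in sequentially. p_variation p (g r) \<le> ennreal c \<longrightarrow>
        p_variation p (g r) \<le> ennreal c \<and> ?S (g r) > c"
      by (rule eventually_mono) auto
    from frequently_ex[OF frequently_rev_mp[OF assms(2) this]]
    obtain r where r: "p_variation p (g r) \<le> ennreal c" "?S (g r) > c" by blast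
    have "ennreal (?S (g r)) \<le> ennreal c"
      using p_variation_ge[OF t, of "g r" p] r(1) unfolding increment_sum_reindex by (rule order_trans)
    then show False using r assms by (simp add: ennreal_le_iff)
  qed
qed

section \<open>Step functions\<close>

text \<open>The normalised partial sum process, its coarsening to a grid and the grid samples of
  \<open>W\<close> (up to the value at 0) all have this shape. It is linear in \<open>x\<close> and
  sees only the first \<open>n\<close> entries, so statements about paths become statements about
  finitely many real coordinates.\<close>

definition step_path :: "nat \<Rightarrow> (nat \<Rightarrow> real) \<Rightarrow> real \<Rightarrow> real" where
  "step_path n x = (\<lambda>t\<in>{0..1}. \<Sum>i<nat \<lfloor>real n * t\<rfloor>. x i)"

lemma nat_floor_le:
  assumes "t \<in> {0..1}" shows "nat \<lfloor>real n * t\<rfloor> \<le> n"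
proof -
  have "real n * t \<le> real n" using assms by (simp add: mult_left_le)
  then have "\<lfloor>real n * t\<rfloor> \<le> int n" by (simp add: floor_le_iff)
  then show ?thesis by simp
qed

lemma step_path_0: "step_path n x 0 = 0" by (simp add: step_path_def)

lemma step_path_cong:
  assumes "\<And>i. i < n \<Longrightarrow> x i = y i" shows "step_path n x = step_path n y"
  unfolding step_path_def
  by (intro restrict_ext sum.cong refl assms) (use nat_floor_le order_less_le_trans in blast)

lemma step_path_diff:
  "t \<in> {0..1} \<Longrightarrow> step_path n x t - step_path n y t = step_path n (\<lambda>i. x i - y i) t"
  by (simp add: step_path_def sum_subtractf)

lemma step_path_add:
  "t \<in> {0..1} \<Longrightarrow> step_path n x t + step_path n y t = step_path n (\<lambda>i. x i + y i) t"
  by (simp add: step_path_def sum.distrib)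

lemma step_path_scale:
  "t \<in> {0..1} \<Longrightarrow> c * step_path n x t = step_path n (\<lambda>i. c * x i) t"
  by (simp add: step_path_def sum_distrib_left)

lemma partial_sums_diff:
  fixes x :: "nat \<Rightarrow> real"
  assumes "a \<le> b" shows "(\<Sum>i<b. x i) - (\<Sum>i<a. x i) = (\<Sum>i=a..<b. x i)"
  using sum_diff_nat_ivl[of 0 a b x] assms by (simp add: atLeast0LessThan)

text \<open>Translates a partition of the interval into a weakly increasing sequence of indices,
  after which only sums of consecutive entries remain. The same indices serve every
  \<open>x\<close>.\<close>

lemma step_path_partition:
  assumes "unit_partition m t"
  shows "\<exists>k. k 0 = 0 \<and> k m = n \<and> (\<forall>i j. i \<le> j \<longrightarrow> j \<le> m \<longrightarrow> k i \<le> k j) \<and>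
    (\<forall>i\<le>m. k i \<le> n) \<and> (\<forall>x. \<forall>i\<le>m. step_path n x (t i) = (\<Sum>j<k i. x j))"
proof (intro exI conjI allI impI)
  let ?k = "\<lambda>i. nat \<lfloor>real n * t i\<rfloor>"
  show "?k 0 = 0" "?k m = n" using assms by (auto simp: unit_partition_def)
  show "?k i \<le> ?k j" if "i \<le> j" "j \<le> m" for i j
    using unit_partition_mono[OF assms that] by (intro nat_mono floor_mono mult_left_mono) auto
  show "?k i \<le> n" if "i \<le> m" for i
    using unit_partition_in[OF assms that] by (rule nat_floor_le)
  show "step_path n x (t i) = (\<Sum>j<?k i. x j)" if "i \<le> m" for x i
    using unit_partition_in[OF assms that] by (simp add: step_path_def)
qed

text \<open>A crude bound through the total variation. It yields membership in \<open>Wp p\<close>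
  and continuity in the coordinates; its growth in \<open>n\<close> is too fast for the limit
  theorem.\<close>

lemma p_variation_step_path:
  assumes "p \<ge> 1"
  shows "p_variation p (step_path n x) \<le> ennreal ((\<Sum>i<n. \<bar>x i\<bar>) powr p)"
proof (rule p_variation_le_lessThan)
  fix m t assume t: "unit_partition m t"
  from step_path_partition[OF t, where n=n]
  obtain k where k: "k 0 = 0" "k m = n" "\<And>i j. i \<le> j \<Longrightarrow> j \<le> m \<Longrightarrow> k i \<le> k j"
      "\<And>i. i \<le> m \<Longrightarrow> k i \<le> n" "\<And>x i. i \<le> m \<Longrightarrow> step_path n x (t i) = (\<Sum>j<k i. x j)"
    by (elim exE conjE) simp
  have "(\<Sum>i<m. \<bar>step_path n x (t (Suc i)) - step_path n x (t i)\<bar> powr p)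
      \<le> (\<Sum>i<m. \<bar>step_path n x (t (Suc i)) - step_path n x (t i)\<bar>) powr p"
    using assms by (intro sum_powr_le_powr_sum) auto
  also have "... \<le> (\<Sum>i<m. (\<Sum>j<k (Suc i). \<bar>x j\<bar>) - (\<Sum>j<k i. \<bar>x j\<bar>)) powr p"
    using assms k(3) by (intro powr_mono2 sum_mono) (auto simp: k(5) partial_sums_diff intro!: sum_nonneg sum_abs)
  also have "... = (\<Sum>i<n. \<bar>x i\<bar>) powr p"
    by (subst sum_lessThan_telescope) (simp add: k)
  finally show "(\<Sum>i<m. \<bar>step_path n x (t (Suc i)) - step_path n x (t i)\<bar> powr p) \<le> (\<Sum>i<n. \<bar>x i\<bar>) powr p" .
qed

lemma step_path_fin: "p \<ge> 1 \<Longrightarrow> p_variation p (step_path n x) < \<infinity>"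
  by (rule order_le_less_trans[OF p_variation_step_path]) auto

lemma step_path_in_Wp: "p \<ge> 1 \<Longrightarrow> step_path n x \<in> Wp p"
  using step_path_fin by (auto simp: Wp_def step_path_def)

abbreviation step_norm :: "real \<Rightarrow> nat \<Rightarrow> (nat \<Rightarrow> real) \<Rightarrow> real" where
  "step_norm p n x \<equiv> Wp_norm p (step_path n x)"

lemma Wp_norm_step_path_le:
  assumes "p \<ge> 1" shows "step_norm p n x \<le> 2 * (\<Sum>i<n. \<bar>x i\<bar>)"
  using Wp_norm_le_p_variation[OF _ p_variation_step_path[OF assms], of n x] assms
  by (simp add: step_path_0 powr_powr sum_nonneg)

lemma Wp_dist_step_path:
  "Wp_dist p (step_path n x) (step_path n y) = step_norm p n (\<lambda>i. x i - y i)"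
  unfolding Wp_dist_def by (intro Wp_norm_cong step_path_diff)

lemma Wp_norm_step_path_add:
  assumes "p \<ge> 1"
  shows "step_norm p n (\<lambda>i. x i + y i) \<le> step_norm p n x + step_norm p n y"
proof -
  have "step_norm p n (\<lambda>i. x i + y i) = Wp_norm p (\<lambda>t. step_path n x t + step_path n y t)"
    by (rule Wp_norm_cong) (simp only: step_path_add)
  then show ?thesis
    using Wp_norm_triangle[OF assms step_path_fin step_path_fin, of n x n y] assms by simp
qed

lemma Wp_norm_step_path_scale:
  assumes "p \<ge> 1"
  shows "step_norm p n (\<lambda>i. c * x i) = \<bar>c\<bar> * step_norm p n x"
proof -
  have "step_norm p n (\<lambda>i. c * x i) = Wp_norm p (\<lambda>t. c * step_path n x t)"
    by (rule Wp_norm_cong) (simp only: step_path_scale)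
  then show ?thesis using Wp_norm_scale[OF assms] by simp
qed

lemma Wp_norm_step_path_diff:
  assumes "p \<ge> 1"
  shows "step_norm p n (\<lambda>i. x i - y i) \<le> step_norm p n x + step_norm p n y"
  using Wp_norm_step_path_add[OF assms, of n x "\<lambda>i. -1 * y i"]
  unfolding Wp_norm_step_path_scale[OF assms] by simp

section \<open>Counting large oscillations\<close>

text \<open>The displacement since the last restart, recorded after a possible restart at the
  current step. It therefore stays below \<open>l\<close>, and an overshoot is discarded rather than
  carried over.\<close>

primrec reset_gap :: "real \<Rightarrow> (nat \<Rightarrow> real) \<Rightarrow> nat \<Rightarrow> real" where
  "reset_gap l x 0 = 0"
| "reset_gap l x (Suc j) = (if l \<le> \<bar>reset_gap l x j + x j\<bar> then 0 else reset_gap l x j + x j)"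

primrec reset_count :: "real \<Rightarrow> (nat \<Rightarrow> real) \<Rightarrow> nat \<Rightarrow> nat" where
  "reset_count l x 0 = 0"
| "reset_count l x (Suc j) = reset_count l x j + (if l \<le> \<bar>reset_gap l x j + x j\<bar> then 1 else 0)"

lemma abs_reset_gap: "l > 0 \<Longrightarrow> \<bar>reset_gap l x j\<bar> < l"
  by (induction j) auto

lemma reset_count_mono: "i \<le> j \<Longrightarrow> reset_count l x i \<le> reset_count l x j"
  by (induction j rule: dec_induct) auto

lemma reset_count_le: "reset_count l x j \<le> j"
  by (induction j) auto

lemma reset_gap_cong: "(\<And>i. i < j \<Longrightarrow> x i = y i) \<Longrightarrow> reset_gap l x j = reset_gap l y j"
  by (induction j) auto

text \<open>As long as no restart occurs, which is what equal counts express, the displacement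
  follows the walk exactly.\<close>

lemma sum_eq_reset_gap_diff:
  assumes "a \<le> b" "reset_count l x a = reset_count l x b"
  shows "(\<Sum>i<b. x i) - (\<Sum>i<a. x i) = reset_gap l x b - reset_gap l x a"
  using assms
proof (induction b rule: dec_induct)
  case (step b)
  have "reset_count l x a \<le> reset_count l x b" "reset_count l x b \<le> reset_count l x (Suc b)"
    using step by (intro reset_count_mono; simp)+
  then have eq: "reset_count l x a = reset_count l x b" "reset_count l x (Suc b) = reset_count l x b"
    using step.prems by linarith+
  from eq(2) have "\<not> l \<le> \<bar>reset_gap l x b + x b\<bar>" by (auto split: if_splits)
  then show ?case using step.IH[OF eq(1)] by simp
qed simp

text \<open>Without a restart, an increment is a difference of two displacements smaller than
  \<open>l\<close>, hence smaller than \<open>2 * l\<close>. Each large increment thus contains a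
  restart of its own.\<close>

lemma card_oscillations_le_reset_count:
  assumes "l > 0" "\<And>i. i < m \<Longrightarrow> k i \<le> k (Suc i)"
  shows "card {i\<in>{..<m}. 2 * l \<le> \<bar>(\<Sum>j<k (Suc i). x j) - (\<Sum>j<k i. x j)\<bar>} \<le> reset_count l x (k m)"
  using assms(2)
proof (induction m)
  case (Suc m)
  let ?P = "\<lambda>i. 2 * l \<le> \<bar>(\<Sum>j<k (Suc i). x j) - (\<Sum>j<k i. x j)\<bar>"
  have le: "reset_count l x (k m) \<le> reset_count l x (k (Suc m))"
    using Suc.prems by (intro reset_count_mono) auto
  have IH: "card {i\<in>{..<m}. ?P i} \<le> reset_count l x (k m)" using Suc by auto
  show ?case
  proof (cases "?P m")
    case True
    have "reset_count l x (k m) \<noteq> reset_count l x (k (Suc m))"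
    proof
      assume "reset_count l x (k m) = reset_count l x (k (Suc m))"
      from sum_eq_reset_gap_diff[OF _ this] Suc.prems True
      show False using abs_reset_gap[OF assms(1), of x "k m"] abs_reset_gap[OF assms(1), of x "k (Suc m)"]
        by auto
    qed
    moreover have "{i\<in>{..<Suc m}. ?P i} = insert m {i\<in>{..<m}. ?P i}" using True by (auto simp: less_Suc_eq)
    ultimately show ?thesis using le IH by simp
  next
    case False
    then have "{i\<in>{..<Suc m}. ?P i} = {i\<in>{..<m}. ?P i}" by (auto simp: less_Suc_eq)
    then show ?thesis using le IH by simp
  qed
qed simp

section \<open>Summation over dyadic scales\<close>

lemma dyadic_bracket:
  assumes "y \<ge> (1::real)" shows "\<exists>k. 2 ^ k \<le> y \<and> y < 2 ^ Suc k"
proof -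
  define n where "n = (LEAST n. y < 2 ^ n)"
  have ex: "\<exists>n. y < 2 ^ n" using real_arch_pow[of 2 y] by auto
  have n: "y < 2 ^ n" unfolding n_def by (rule LeastI_ex[OF ex])
  then have "n \<noteq> 0" using assms by (intro notI) auto
  then obtain k where k: "n = Suc k" using not0_implies_Suc by blast
  have "\<not> y < 2 ^ k" using not_less_Least[of k "\<lambda>n. y < 2 ^ n"] k unfolding n_def by auto
  then show ?thesis using n k by (intro exI[of _ k]) auto
qed

lemma ennreal_le_suminf: "f k \<le> (\<Sum>k. f k :: ennreal)"
  using sum_le_suminf[of f "{k}"] by simp

lemma ennreal_sum_le_weighted_counts:
  assumes "finite I" "\<And>i. i \<in> I \<Longrightarrow> 0 \<le> u i"
    and u: "\<And>i. i \<in> I \<Longrightarrow> \<exists>k. ennreal (u i) \<le> a k * of_bool (\<tau> k \<le> (y i :: real))"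
    and c: "\<And>k. card (I \<inter> {i. \<tau> k \<le> y i}) \<le> c k"
  shows "ennreal (\<Sum>i\<in>I. u i) \<le> (\<Sum>k. a k * ennreal (real (c k)))"
proof -
  have "ennreal (u i) \<le> (\<Sum>k. a k * of_bool (\<tau> k \<le> y i))" if "i \<in> I" for i
    using u[OF that] ennreal_le_suminf[of "\<lambda>k. a k * of_bool (\<tau> k \<le> y i)"] by (meson order_trans)
  then have "(\<Sum>i\<in>I. ennreal (u i)) \<le> (\<Sum>i\<in>I. \<Sum>k. a k * of_bool (\<tau> k \<le> y i))"
    by (rule sum_mono)
  also have "... = (\<Sum>k. \<Sum>i\<in>I. a k * of_bool (\<tau> k \<le> y i))"
    by (rule suminf_sum[symmetric]) auto
  also have "... \<le> (\<Sum>k. a k * ennreal (real (c k)))"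
  proof (intro suminf_le summableI)
    fix k
    have "ennreal (real (card (I \<inter> {i. \<tau> k \<le> y i}))) \<le> ennreal (real (c k))"
      by (intro ennreal_leI of_nat_mono c)
    then show "(\<Sum>i\<in>I. a k * of_bool (\<tau> k \<le> y i)) \<le> a k * ennreal (real (c k))"
      unfolding sum_distrib_left[symmetric]
      by (intro mult_left_mono) (simp_all add: sum_of_bool_eq assms(1) flip: ennreal_of_nat_eq_real_of_nat)
  qed
  finally show ?thesis using assms(2) by (simp add: sum_ennreal)
qed

text \<open>
  The two series collect the increments below and above the scale \<open>s\<close>; above \<open>s\<close>, the
  \<open>\<ell>\<^sup>q\<close> norm is bounded by the \<open>\<ell>\<^sup>1\<close> norm.
\<close>

lemma Wp_norm_step_path_le_reset_counts:
  assumes "q \<ge> 1" "s > 0"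
  shows "ennreal (step_norm q n x) \<le> ennreal (2 * s) * (1
     + (\<Sum>k. ennreal ((1 / 2 ^ k) powr q) * ennreal (real (reset_count (s / 2 ^ (k + 2)) x n)))
     + (\<Sum>k. ennreal (2 ^ Suc k) * ennreal (real (reset_count (s * 2 ^ k / 2) x n))))"
    (is "_ \<le> ennreal (2 * s) * (1 + ?A + ?B)")
proof (cases "1 + ?A + ?B = \<infinity>")
  case True
  show ?thesis unfolding True using assms by (simp add: ennreal_mult_top)
next
  case False
  define c where "c = enn2real (1 + ?A + ?B)"
  have c: "1 + ?A + ?B = ennreal c" using False by (simp add: c_def less_top)
  have c0: "c \<ge> 0" by (simp add: c_def)
  have "p_variation q (step_path n x) \<le> ennreal ((s * c) powr q)"
  proof (rule p_variation_le_lessThan)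
    fix m t assume t: "unit_partition m t"
    from step_path_partition[OF t, where n=n]
    obtain k where k: "k 0 = 0" "k m = n" "\<And>i j. i \<le> j \<Longrightarrow> j \<le> m \<Longrightarrow> k i \<le> k j"
        "\<And>i. i \<le> m \<Longrightarrow> k i \<le> n" "\<And>x i. i \<le> m \<Longrightarrow> step_path n x (t i) = (\<Sum>j<k i. x j)"
      by (elim exE conjE) simp
    define y where "y i = \<bar>(\<Sum>j<k (Suc i). x j) - (\<Sum>j<k i. x j)\<bar> / s" for i
    have y0: "y i \<ge> 0" for i using assms by (simp add: y_def)
    have card_le: "card {i\<in>{..<m}. 2 * l \<le> y i * s} \<le> reset_count l x n" if "l > 0" for l
      using card_oscillations_le_reset_count[OF that, of m k x] k assms by (simp add: y_def)
    define I where "I = {i\<in>{..<m}. y i < 1}"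
    define J where "J = {i\<in>{..<m}. \<not> y i < 1}"
    have IJ: "finite I" "finite J" "I \<inter> J = {}" "{..<m} = I \<union> J" by (auto simp: I_def J_def)
    have small: "ennreal (\<Sum>i\<in>I. y i powr q) \<le> ?A"
    proof (rule ennreal_sum_le_weighted_counts[where \<tau>="\<lambda>k. 1 / 2 ^ Suc k" and y=y])
      fix i assume "i \<in> I"
      show "\<exists>k. ennreal (y i powr q) \<le> ennreal ((1 / 2 ^ k) powr q) * of_bool (1 / 2 ^ Suc k \<le> y i)"
      proof (cases "y i = 0")
        case False
        then have yi: "0 < y i" "y i < 1" using \<open>i \<in> I\<close> y0[of i] by (auto simp: I_def)
        then have "1 \<le> 1 / y i" by simp
        then obtain k where "2 ^ k \<le> 1 / y i" "1 / y i < 2 ^ Suc k" using dyadic_bracket by blast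
        then have k: "y i \<le> 1 / 2 ^ k" "1 / 2 ^ Suc k \<le> y i" using yi by (auto simp: field_simps)
        then show ?thesis using yi assms by (intro exI[of _ k]) (auto intro!: ennreal_leI powr_mono2)
      qed simp
    next
      fix k
      \<comment> \<open>Here \<open>2 * (s / 2 ^ (k + 2))\<close> is \<open>s / 2 ^ Suc k\<close>:
        the factor 2 lost in counting oscillations by restarts accounts for \<open>k + 2\<close> in
        place of \<open>k + 1\<close>.\<close>
      have "card (I \<inter> {i. 1 / 2 ^ Suc k \<le> y i}) \<le> card {i\<in>{..<m}. 2 * (s / 2 ^ (k + 2)) \<le> y i * s}"
        using assms by (intro card_mono) (auto simp: I_def field_simps)
      also have "... \<le> reset_count (s / 2 ^ (k + 2)) x n" using assms by (intro card_le) auto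
      finally show "card (I \<inter> {i. 1 / 2 ^ Suc k \<le> y i}) \<le> reset_count (s / 2 ^ (k + 2)) x n" .
    qed (use IJ in auto)
    have large: "ennreal (\<Sum>i\<in>J. y i) \<le> ?B"
    proof (rule ennreal_sum_le_weighted_counts[where \<tau>="\<lambda>k. 2 ^ k" and y=y])
      fix i assume "i \<in> J"
      then have "1 \<le> y i" by (auto simp: J_def)
      then obtain k where "2 ^ k \<le> y i" "y i < 2 ^ Suc k" using dyadic_bracket by blast
      then show "\<exists>k. ennreal (y i) \<le> ennreal (2 ^ Suc k) * of_bool (2 ^ k \<le> y i)"
        by (intro exI[of _ k]) (auto intro!: ennreal_leI simp del: power_Suc)
    next
      fix k
      have "card (J \<inter> {i. 2 ^ k \<le> y i}) \<le> card {i\<in>{..<m}. 2 * (s * 2 ^ k / 2) \<le> y i * s}"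
        using assms by (intro card_mono) (auto simp: J_def field_simps)
      also have "... \<le> reset_count (s * 2 ^ k / 2) x n" using assms by (intro card_le) auto
      finally show "card (J \<inter> {i. 2 ^ k \<le> y i}) \<le> reset_count (s * 2 ^ k / 2) x n" .
    qed (use IJ y0 in auto)
    define a b where "a = (\<Sum>i\<in>I. y i powr q)" and "b = (\<Sum>i\<in>J. y i)"
    have ab: "a \<ge> 0" "b \<ge> 0" using y0 by (auto simp: a_def b_def intro!: sum_nonneg)
    have "ennreal (1 + a + b) \<le> ennreal c"
      unfolding c[symmetric] using ab small large by (simp add: a_def b_def add_mono)
    then have abc: "1 + a + b \<le> c" using c0 by (simp add: ennreal_le_iff)
    have "(\<Sum>i<m. y i powr q) = a + (\<Sum>i\<in>J. y i powr q)"
      unfolding a_def IJ(4) by (rule sum.union_disjoint) (use IJ in auto)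
    \<comment> \<open>The summand 1 in the claimed bound pays for this step: a base of at least 1
      gives \<open>a \<le> (1 + a) powr q\<close>. Thus the root of \<open>a\<close> is traded for
      \<open>a\<close> itself, whose mean is a sum of mean restart counts.\<close>
    also have "... \<le> (1 + a) powr q + b powr q"
    proof (intro add_mono)
      show "(\<Sum>i\<in>J. y i powr q) \<le> b powr q"
        unfolding b_def using assms IJ y0 by (intro sum_powr_le_powr_sum) auto
      have "a \<le> (1 + a) powr 1" using ab by simp
      also have "... \<le> (1 + a) powr q" using ab assms by (intro powr_mono) auto
      finally show "a \<le> (1 + a) powr q" .
    qed
    \<comment> \<open>Written as a sum over two booleans so that \<open>sum_powr_le_powr_sum\<close>
      applies.\<close>
    also have "... = (\<Sum>i\<in>{False, True}. (if i then 1 + a else b) powr q)" by simp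
    also have "... \<le> (\<Sum>i\<in>{False, True}. if i then 1 + a else b) powr q"
      using ab assms by (intro sum_powr_le_powr_sum) auto
    also have "... \<le> c powr q" using ab abc assms by (intro powr_mono2) auto
    finally have y: "(\<Sum>i<m. y i powr q) \<le> c powr q" .
    have "(\<Sum>i<m. \<bar>step_path n x (t (Suc i)) - step_path n x (t i)\<bar> powr q) = (\<Sum>i<m. (s * y i) powr q)"
      using assms k by (intro sum.cong) (auto simp: y_def)
    also have "... = s powr q * (\<Sum>i<m. y i powr q)"
      using assms y0 by (simp add: powr_mult sum_distrib_left)
    also have "... \<le> s powr q * c powr q" using y by (intro mult_left_mono) auto
    finally show "(\<Sum>i<m. \<bar>step_path n x (t (Suc i)) - step_path n x (t i)\<bar> powr q) \<le> (s * c) powr q"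
      using assms c0 by (simp add: powr_mult)
  qed
  from Wp_norm_le_p_variation[of "step_path n x", OF step_path_0 this] assms c0
  have "step_norm q n x \<le> 2 * s * c" by (simp add: powr_powr)
  then show ?thesis unfolding c using assms c0 by (simp add: ennreal_leI flip: ennreal_mult)
qed

section \<open>The p-variation of sums of independent random variables\<close>

lemma measurable_reset:
  assumes "\<And>i. i < n \<Longrightarrow> \<xi> i \<in> borel_measurable M" "j \<le> n"
  shows "(\<lambda>w. reset_gap l (\<lambda>i. \<xi> i w) j) \<in> borel_measurable M"
    "(\<lambda>w. real (reset_count l (\<lambda>i. \<xi> i w) j)) \<in> borel_measurable M"
proof -
  have gap: "j \<le> n \<Longrightarrow> (\<lambda>w. reset_gap l (\<lambda>i. \<xi> i w) j) \<in> borel_measurable M" for j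
  proof (induction j)
    case (Suc j)
    have [measurable]: "(\<lambda>w. reset_gap l (\<lambda>i. \<xi> i w) j) \<in> borel_measurable M" "\<xi> j \<in> borel_measurable M"
      using Suc assms by auto
    show ?case unfolding reset_gap.simps by measurable
  qed simp
  show "(\<lambda>w. reset_gap l (\<lambda>i. \<xi> i w) j) \<in> borel_measurable M" using gap assms by simp
  show "(\<lambda>w. real (reset_count l (\<lambda>i. \<xi> i w) j)) \<in> borel_measurable M" using assms(2)
  proof (induction j)
    case (Suc j)
    have [measurable]: "(\<lambda>w. reset_gap l (\<lambda>i. \<xi> i w) j) \<in> borel_measurable M" "\<xi> j \<in> borel_measurable M"
       "(\<lambda>w. real (reset_count l (\<lambda>i. \<xi> i w) j)) \<in> borel_measurable M"
      using Suc assms gap by auto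
    show ?case unfolding reset_count.simps of_nat_add by measurable
  qed simp
qed

section \<open>Mean number of restarts\<close>

context prob_space
begin

text \<open>Invariance under \<open>restrict\<close> says that \<open>f\<close> depends on the past
  and \<open>g\<close> on the future coordinates only; it lets both be applied to the whole
  sequence.\<close>

lemma indep_past_future:
  fixes \<xi> :: "nat \<Rightarrow> 'a \<Rightarrow> real"
  assumes indep: "indep_vars (\<lambda>_. borel) \<xi> {..<n}" and j: "j \<le> n"
    and f: "f \<in> borel_measurable (PiM {..<j} (\<lambda>_. borel))" "\<And>x. f (restrict x {..<j}) = f x"
    and g: "g \<in> borel_measurable (PiM {j..<n} (\<lambda>_. borel))" "\<And>x. g (restrict x {j..<n}) = g x"
  shows "indep_var borel (\<lambda>w. f (\<lambda>i. \<xi> i w)) borel (\<lambda>w. g (\<lambda>i. \<xi> i w))"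
proof -
  have "indep_var (PiM {..<j} (\<lambda>_. borel)) (\<lambda>w. restrict (\<lambda>i. \<xi> i w) {..<j})
     (PiM {j..<n} (\<lambda>_. borel)) (\<lambda>w. restrict (\<lambda>i. \<xi> i w) {j..<n})"
    using j by (intro indep_var_restrict[OF indep]) auto
  from indep_var_compose[OF this f(1) g(1)] show ?thesis by (simp add: comp_def f(2) g(2))
qed

text \<open>An energy balance. A restart erases a squared displacement of at least
  \<open>l\<^sup>2\<close> and adds exactly \<open>l\<^sup>2\<close> through the count, so step
  \<open>j\<close> raises the total by at most \<open>2 * D * \<xi> j + (\<xi> j)\<^sup>2\<close>,
  with \<open>D\<close> the displacement before it. The cross term has mean zero, since
  \<open>D\<close> is bounded and depends on the past.\<close>

lemma expectation_reset_count_le: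
  fixes \<xi> :: "nat \<Rightarrow> 'a \<Rightarrow> real"
  assumes indep: "indep_vars (\<lambda>_. borel) \<xi> {..<n}"
    and sq: "\<And>i. i < n \<Longrightarrow> integrable M (\<lambda>w. (\<xi> i w)\<^sup>2)"
    and mean: "\<And>i. i < n \<Longrightarrow> expectation (\<xi> i) = 0"
    and var: "\<And>i. i < n \<Longrightarrow> expectation (\<lambda>w. (\<xi> i w)\<^sup>2) \<le> v"
    and l: "l > 0" and j: "j \<le> n"
  shows "expectation (\<lambda>w. (reset_gap l (\<lambda>i. \<xi> i w) j)\<^sup>2)
    + l\<^sup>2 * expectation (\<lambda>w. real (reset_count l (\<lambda>i. \<xi> i w) j)) \<le> real j * v"
  using j
proof (induction j)
  case (Suc j)
  let ?D = "\<lambda>w. reset_gap l (\<lambda>i. \<xi> i w)" and ?N = "\<lambda>w. reset_count l (\<lambda>i. \<xi> i w)"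
  have meas: "\<And>i. i < n \<Longrightarrow> \<xi> i \<in> borel_measurable M" using indep by (auto simp: indep_vars_def)
  have D_int: "integrable M (\<lambda>w. ?D w i)" "integrable M (\<lambda>w. (?D w i)\<^sup>2)"
    and N_int: "integrable M (\<lambda>w. real (?N w i))" if "i \<le> n" for i
  proof -
    note [measurable] = measurable_reset[of n \<xi>, OF meas that]
    show "integrable M (\<lambda>w. ?D w i)"
      by (rule integrable_const_bound[of _ l]) (use abs_reset_gap[OF l] in \<open>auto intro!: less_imp_le\<close>)
    have "(?D w i)\<^sup>2 \<le> l\<^sup>2" for w
      using abs_reset_gap[OF l, of "\<lambda>i. \<xi> i w" i] l by (simp add: abs_le_square_iff[symmetric])
    then show "integrable M (\<lambda>w. (?D w i)\<^sup>2)"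
      by (intro integrable_const_bound[of _ "l\<^sup>2"]) auto
    show "integrable M (\<lambda>w. real (?N w i))"
      by (intro integrable_const_bound[of _ "real i"]) (auto simp: reset_count_le)
  qed
  have jn: "j < n" "j \<le> n" using Suc.prems by simp_all
  have xi_int: "integrable M (\<xi> j)"
    by (rule square_integrable_imp_integrable[OF meas[OF jn(1)] sq[OF jn(1)]])
  have ind: "indep_var borel (\<lambda>w. ?D w j) borel (\<xi> j)"
  proof (rule indep_past_future[OF indep, where j=j and g="\<lambda>x. x j"])
    show "(\<lambda>x. reset_gap l x j) \<in> borel_measurable (PiM {..<j} (\<lambda>_. borel))"
      by (rule measurable_reset(1)[where n=j and \<xi>="\<lambda>i x. x i"]) auto
    show "reset_gap l (restrict x {..<j}) j = reset_gap l x j" for x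
      by (rule reset_gap_cong) simp
    show "(\<lambda>x. x j) \<in> borel_measurable (PiM {j..<n} (\<lambda>_. borel))"
      using jn by (intro measurable_component_singleton) auto
  qed (use jn in auto)
  have prod: "expectation (\<lambda>w. ?D w j * \<xi> j w) = 0" "integrable M (\<lambda>w. ?D w j * \<xi> j w)"
    using indep_var_lebesgue_integral[OF ind D_int(1)[OF jn(2)] xi_int]
      indep_var_integrable[OF ind D_int(1)[OF jn(2)] xi_int] mean[OF jn(1)] by simp_all
  have "expectation (\<lambda>w. (?D w (Suc j))\<^sup>2) + l\<^sup>2 * expectation (\<lambda>w. real (?N w (Suc j)))
      = expectation (\<lambda>w. (?D w (Suc j))\<^sup>2 + l\<^sup>2 * real (?N w (Suc j)))"
    using D_int(2)[OF Suc.prems] N_int[OF Suc.prems] by simp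
  also have "... \<le> expectation (\<lambda>w. (?D w j)\<^sup>2 + l\<^sup>2 * real (?N w j) + 2 * (?D w j * \<xi> j w) + (\<xi> j w)\<^sup>2)"
  proof (rule integral_mono)
    show "integrable M (\<lambda>w. (?D w (Suc j))\<^sup>2 + l\<^sup>2 * real (?N w (Suc j)))"
      using D_int(2)[OF Suc.prems] N_int[OF Suc.prems] by (intro Bochner_Integration.integrable_add integrable_mult_right)
    show "integrable M (\<lambda>w. (?D w j)\<^sup>2 + l\<^sup>2 * real (?N w j) + 2 * (?D w j * \<xi> j w) + (\<xi> j w)\<^sup>2)"
      by (intro Bochner_Integration.integrable_add integrable_mult_right D_int(2)[OF jn(2)] N_int[OF jn(2)] prod sq[OF jn(1)])
    fix w
    have "l \<le> \<bar>?D w j + \<xi> j w\<bar> \<Longrightarrow> l\<^sup>2 \<le> (?D w j + \<xi> j w)\<^sup>2"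
      using l by (simp add: abs_le_square_iff[symmetric])
    then show "(?D w (Suc j))\<^sup>2 + l\<^sup>2 * real (?N w (Suc j))
        \<le> (?D w j)\<^sup>2 + l\<^sup>2 * real (?N w j) + 2 * (?D w j * \<xi> j w) + (\<xi> j w)\<^sup>2"
      by (auto simp: power2_sum algebra_simps)
  qed
  also have "... = expectation (\<lambda>w. (?D w j)\<^sup>2) + l\<^sup>2 * expectation (\<lambda>w. real (?N w j)) + expectation (\<lambda>w. (\<xi> j w)\<^sup>2)"
    using D_int(2)[OF jn(2)] N_int[OF jn(2)] prod sq[OF jn(1)] by simp
  also have "... \<le> real j * v + v" by (rule add_mono[OF Suc.IH[OF jn(2)] var[OF jn(1)]])
  finally show ?case by (simp add: algebra_simps)
qed simp

lemma nn_integral_reset_count_le: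
  fixes \<xi> :: "nat \<Rightarrow> 'a \<Rightarrow> real"
  assumes indep: "indep_vars (\<lambda>_. borel) \<xi> {..<n}"
    and sq: "\<And>i. i < n \<Longrightarrow> integrable M (\<lambda>w. (\<xi> i w)\<^sup>2)"
    and mean: "\<And>i. i < n \<Longrightarrow> expectation (\<xi> i) = 0"
    and var: "\<And>i. i < n \<Longrightarrow> expectation (\<lambda>w. (\<xi> i w)\<^sup>2) \<le> v"
    and l: "l > 0"
  shows "(\<integral>\<^sup>+ w. ennreal (real (reset_count l (\<lambda>i. \<xi> i w) n)) \<partial>M) \<le> ennreal (real n * v / l\<^sup>2)"
proof -
  have meas: "\<And>i. i < n \<Longrightarrow> \<xi> i \<in> borel_measurable M" using indep by (auto simp: indep_vars_def)
  note [measurable] = measurable_reset[of n \<xi>, OF meas order_refl]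
  have "integrable M (\<lambda>w. real (reset_count l (\<lambda>i. \<xi> i w) n))"
    by (intro integrable_const_bound[of _ "real n"]) (auto simp: reset_count_le)
  then have "(\<integral>\<^sup>+ w. ennreal (real (reset_count l (\<lambda>i. \<xi> i w) n)) \<partial>M)
     = ennreal (expectation (\<lambda>w. real (reset_count l (\<lambda>i. \<xi> i w) n)))"
    by (intro nn_integral_eq_integral) auto
  also have "... \<le> ennreal (real n * v / l\<^sup>2)"
  proof (rule ennreal_leI)
    have "l\<^sup>2 * expectation (\<lambda>w. real (reset_count l (\<lambda>i. \<xi> i w) n))
       \<le> expectation (\<lambda>w. (reset_gap l (\<lambda>i. \<xi> i w) n)\<^sup>2) + l\<^sup>2 * expectation (\<lambda>w. real (reset_count l (\<lambda>i. \<xi> i w) n))"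
      by (simp add: integral_nonneg_AE)
    also have "... \<le> real n * v"
      by (rule expectation_reset_count_le[OF indep sq mean var l]) auto
    finally show "expectation (\<lambda>w. real (reset_count l (\<lambda>i. \<xi> i w) n)) \<le> real n * v / l\<^sup>2"
      using l by (simp add: field_simps)
  qed
  finally show ?thesis .
qed

end

text \<open>The factor 2 is the passage from the variation to the full norm, 17 is 1 plus the mean
  contribution 16 of the scales above \<open>s\<close>, and the quotient sums the geometric series
  of the scales below \<open>s\<close>, whose ratio is less than 1 exactly when
  \<open>q > 2\<close>.\<close>

definition lepingle_const :: "real \<Rightarrow> real" where
  "lepingle_const q = 2 * (17 + 16 / (1 - 2 powr (2 - q)))"

lemma lepingle_const_pos: "q > 2 \<Longrightarrow> lepingle_const q > 0"
  using powr_less_mono[of "2-q" 0 2] by (simp add: lepingle_const_def add_pos_nonneg)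

text \<open>With \<open>s\<^sup>2 = n * v\<close>, the restarts at level \<open>l\<close> number at
  most \<open>(s / l)\<^sup>2\<close> in mean, so at this scale both dyadic series have means
  bounded independently of \<open>n\<close>.\<close>

lemma (in prob_space) nn_integral_Wp_norm_step_path_le:
  fixes \<xi> :: "nat \<Rightarrow> 'a \<Rightarrow> real"
  assumes indep: "indep_vars (\<lambda>_. borel) \<xi> {..<n}"
    and sq: "\<And>i. i < n \<Longrightarrow> integrable M (\<lambda>w. (\<xi> i w)\<^sup>2)"
    and mean: "\<And>i. i < n \<Longrightarrow> expectation (\<xi> i) = 0"
    and var: "\<And>i. i < n \<Longrightarrow> expectation (\<lambda>w. (\<xi> i w)\<^sup>2) \<le> v"
    and v: "v > 0" and q: "q > 2"
  shows "(\<integral>\<^sup>+ w. ennreal (step_norm q n (\<lambda>i. \<xi> i w)) \<partial>M) \<le> ennreal (lepingle_const q * sqrt (real n * v))"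
proof (cases "n = 0")
  case True
  have "step_norm q 0 x \<le> 0" for x using Wp_norm_step_path_le[of q 0 x] q by simp
  then have "step_norm q 0 x = 0" for x using Wp_norm_nonneg antisym by blast
  then show ?thesis using True by simp
next
  case False
  define s where "s = sqrt (real n * v)"
  have s: "s > 0" "real n * v = s\<^sup>2" using False v by (auto simp: s_def)
  have meas: "\<And>i. i < n \<Longrightarrow> \<xi> i \<in> borel_measurable M" using indep by (auto simp: indep_vars_def)
  note [measurable] = measurable_reset[of n \<xi>, OF meas order_refl]
  let ?N = "\<lambda>l w. ennreal (real (reset_count l (\<lambda>i. \<xi> i w) n))"
  define r where "r = (2::real) powr (2 - q)"
  have r: "0 < r" "r < 1" using q powr_less_mono[of "2-q" 0 2] by (auto simp: r_def)
  have N: "(\<integral>\<^sup>+ w. ?N l w \<partial>M) \<le> ennreal (s\<^sup>2 / l\<^sup>2)" if "l > 0" for l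
    using nn_integral_reset_count_le[OF indep sq mean var that] s by simp
  have A: "(\<integral>\<^sup>+ w. (\<Sum>k. ennreal ((1 / 2 ^ k) powr q) * ?N (s / 2 ^ (k + 2)) w) \<partial>M) \<le> ennreal (16 / (1 - r))"
  proof -
    have "(\<integral>\<^sup>+ w. (\<Sum>k. ennreal ((1 / 2 ^ k) powr q) * ?N (s / 2 ^ (k + 2)) w) \<partial>M)
       = (\<Sum>k. ennreal ((1 / 2 ^ k) powr q) * (\<integral>\<^sup>+ w. ?N (s / 2 ^ (k + 2)) w \<partial>M))"
      by (subst nn_integral_suminf) (auto simp: nn_integral_cmult)
    also have "... \<le> (\<Sum>k. ennreal (16 * r ^ k))"
    proof (intro suminf_le summableI)
      fix k
      have "ennreal ((1 / 2 ^ k) powr q) * (\<integral>\<^sup>+ w. ?N (s / 2 ^ (k + 2)) w \<partial>M)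
         \<le> ennreal ((1 / 2 ^ k) powr q) * ennreal (s\<^sup>2 / (s / 2 ^ (k + 2))\<^sup>2)"
        using s by (intro mult_left_mono N) auto
      \<comment> \<open>The mean count grows like \<open>16 * 4 ^ k\<close>; the weight
        \<open>2 ^ (-k q)\<close> compensates it because \<open>q > 2\<close>.\<close>
      also have "... = ennreal ((1 / 2 ^ k) powr q * (16 * 4 ^ k))"
        using s by (simp add: power_divide power_mult_distrib ennreal_mult' power2_eq_square flip: power_mult power_mult_distrib)
      also have "(1 / 2 ^ k) powr q * (16 * 4 ^ k) = 16 * r ^ k"
      proof -
        have "(1 / 2 ^ k) powr q = (2 powr (- q)) ^ k"
          by (simp add: powr_divide powr_minus field_simps flip: powr_realpow) (simp add: powr_powr mult.commute powr_realpow[symmetric])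
        moreover have "r = 2 powr (-q) * 4" by (simp add: r_def powr_diff powr_minus field_simps)
        ultimately show ?thesis by (simp add: power_mult_distrib)
      qed
      finally show "ennreal ((1 / 2 ^ k) powr q) * (\<integral>\<^sup>+ w. ?N (s / 2 ^ (k + 2)) w \<partial>M) \<le> ennreal (16 * r ^ k)" .
    qed
    also have "... = ennreal (16 * (1 / (1 - r)))"
      using r by (intro suminf_ennreal_eq sums_mult geometric_sums) auto
    finally show ?thesis by simp
  qed
  have B: "(\<integral>\<^sup>+ w. (\<Sum>k. ennreal (2 ^ Suc k) * ?N (s * 2 ^ k / 2) w) \<partial>M) \<le> ennreal 16"
  proof -
    have "(\<integral>\<^sup>+ w. (\<Sum>k. ennreal (2 ^ Suc k) * ?N (s * 2 ^ k / 2) w) \<partial>M)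
       = (\<Sum>k. ennreal (2 ^ Suc k) * (\<integral>\<^sup>+ w. ?N (s * 2 ^ k / 2) w \<partial>M))"
      by (subst nn_integral_suminf) (auto simp: nn_integral_cmult)
    also have "... \<le> (\<Sum>k. ennreal (8 * (1 / 2) ^ k))"
    proof (intro suminf_le summableI)
      fix k
      have "ennreal (2 ^ Suc k) * (\<integral>\<^sup>+ w. ?N (s * 2 ^ k / 2) w \<partial>M)
         \<le> ennreal (2 ^ Suc k) * ennreal (s\<^sup>2 / (s * 2 ^ k / 2)\<^sup>2)"
        using s by (intro mult_left_mono N) auto
      \<comment> \<open>Above \<open>s\<close> the mean count falls like \<open>4 / 4 ^ k\<close>,
        which beats the weight \<open>2 ^ Suc k\<close>.\<close>
      also have "... = ennreal (2 ^ Suc k * (s\<^sup>2 / (s * 2 ^ k / 2)\<^sup>2))"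
        by (rule ennreal_mult[symmetric]) auto
      also have "2 ^ Suc k * (s\<^sup>2 / (s * 2 ^ k / 2)\<^sup>2) = 8 * (1 / 2) ^ k"
        using s by (simp add: power2_eq_square field_simps)
      finally show "ennreal (2 ^ Suc k) * (\<integral>\<^sup>+ w. ?N (s * 2 ^ k / 2) w \<partial>M) \<le> ennreal (8 * (1 / 2) ^ k)" .
    qed
    also have "... = ennreal (8 * (1 / (1 - 1 / 2)))"
      by (intro suminf_ennreal_eq sums_mult geometric_sums) auto
    finally show ?thesis by simp
  qed
  have "(\<integral>\<^sup>+ w. ennreal (step_norm q n (\<lambda>i. \<xi> i w)) \<partial>M)
    \<le> (\<integral>\<^sup>+ w. ennreal (2 * s) * (1 + (\<Sum>k. ennreal ((1 / 2 ^ k) powr q) * ?N (s / 2 ^ (k + 2)) w)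
       + (\<Sum>k. ennreal (2 ^ Suc k) * ?N (s * 2 ^ k / 2) w)) \<partial>M)"
    using q s by (intro nn_integral_mono Wp_norm_step_path_le_reset_counts) auto
  also have "... = ennreal (2 * s) * (1 + (\<integral>\<^sup>+ w. (\<Sum>k. ennreal ((1 / 2 ^ k) powr q) * ?N (s / 2 ^ (k + 2)) w) \<partial>M)
       + (\<integral>\<^sup>+ w. (\<Sum>k. ennreal (2 ^ Suc k) * ?N (s * 2 ^ k / 2) w) \<partial>M))"
    by (simp add: nn_integral_cmult nn_integral_add emeasure_space_1)
  also have "... \<le> ennreal (2 * s) * (1 + ennreal (16 / (1 - r)) + ennreal 16)"
    by (intro mult_left_mono add_mono A B order_refl) auto
  also have "1 + ennreal (16 / (1 - r)) + ennreal 16 = ennreal (1 + 16 / (1 - r) + 16)"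
    using r by (subst ennreal_plus; simp)
  also have "ennreal (2 * s) * ennreal (1 + 16 / (1 - r) + 16) = ennreal (lepingle_const q * s)"
    using s r by (subst ennreal_mult'[symmetric]) (auto simp: lepingle_const_def r_def algebra_simps)
  finally show ?thesis by (simp add: s_def)
qed

section \<open>Continuous functionals of step functions\<close>

text \<open>The product topology controls each coordinate, hence the finite sum. In this way norm
  estimates on paths turn into Borel measurability in the coordinates.\<close>

lemma continuous_on_finite_coordinates:
  fixes F :: "(nat \<Rightarrow> real) \<Rightarrow> real"
  assumes "\<And>x e. e > 0 \<Longrightarrow> \<exists>d>0. \<forall>y. (\<Sum>i<n. \<bar>x i - y i\<bar>) < d \<longrightarrow> \<bar>F x - F y\<bar> < e"
  shows "continuous_on UNIV F"
proof (intro continuous_at_imp_continuous_on ballI)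
  fix x :: "nat \<Rightarrow> real"
  have co: "continuous_on UNIV (\<lambda>y :: nat \<Rightarrow> real. \<Sum>i<n. \<bar>x i - y i\<bar>)"
    by (intro continuous_intros) auto
  show "isCont F x"
    unfolding isCont_def
  proof (rule tendstoI)
    fix e :: real assume "e > 0"
    from assms[OF this, of x] obtain d where d: "d > 0" "\<And>y. (\<Sum>i<n. \<bar>x i - y i\<bar>) < d \<Longrightarrow> \<bar>F x - F y\<bar> < e"
      by blast
    have "isCont (\<lambda>y. \<Sum>i<n. \<bar>x i - y i\<bar>) x"
      using co continuous_on_eq_continuous_at[OF open_UNIV] by blast
    then have "((\<lambda>y. \<Sum>i<n. \<bar>x i - y i\<bar>) \<longlongrightarrow> (\<Sum>i<n. \<bar>x i - x i\<bar>)) (at x)"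
      by (simp only: isCont_def)
    then have "\<forall>\<^sub>F y in at x. (\<Sum>i<n. \<bar>x i - y i\<bar>) < d"
      using d(1) by (intro order_tendstoD(2)) auto
    then show "\<forall>\<^sub>F y in at x. dist (F y) (F x) < e"
      by (rule eventually_mono) (use d(2) in \<open>simp add: dist_real_def abs_minus_commute\<close>)
  qed
qed

lemma measurable_continuous_coordinates:
  fixes F :: "(nat \<Rightarrow> real) \<Rightarrow> real"
  assumes "continuous_on UNIV F" "\<And>i. \<xi> i \<in> borel_measurable M"
  shows "(\<lambda>w. F (\<lambda>i. \<xi> i w)) \<in> borel_measurable M"
  by (rule measurable_compose[OF measurable_coordinatewise_then_product borel_measurable_continuous_onI])
     (use assms in auto)

lemma measurable_step_path_functional:
  assumes "continuous_on UNIV (\<lambda>x. h (step_path n x) :: real)" "\<And>i. i < n \<Longrightarrow> \<xi> i \<in> borel_measurable M"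
  shows "(\<lambda>w. h (step_path n (\<lambda>i. \<xi> i w))) \<in> borel_measurable M"
proof -
  \<comment> \<open>Coordinates from \<open>n\<close> on are not assumed measurable; they are
    replaced by 0, which \<open>step_path n\<close> does not see.\<close>
  have "(\<lambda>w. h (step_path n (\<lambda>i. (if i < n then \<xi> i else (\<lambda>_. 0)) w))) \<in> borel_measurable M"
    by (rule measurable_continuous_coordinates[OF assms(1)]) (use assms(2) in auto)
  also have "(\<lambda>w. h (step_path n (\<lambda>i. (if i < n then \<xi> i else (\<lambda>_. 0)) w))) = (\<lambda>w. h (step_path n (\<lambda>i. \<xi> i w)))"
    by (intro ext arg_cong[where f=h] step_path_cong) simp
  finally show ?thesis .
qed

lemma continuous_on_Wp_norm_step_path:
  assumes "p \<ge> 1"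
  shows "continuous_on UNIV (\<lambda>x. step_norm p n x)"
proof (rule continuous_on_finite_coordinates)
  fix x :: "nat \<Rightarrow> real" and e :: real assume "e > 0"
  have "\<bar>step_norm p n x - step_norm p n y\<bar> \<le> 2 * (\<Sum>i<n. \<bar>x i - y i\<bar>)" for y
  proof -
    have "step_norm p n x \<le> step_norm p n y + step_norm p n (\<lambda>i. x i - y i)" for x y
      using Wp_norm_step_path_add[OF assms, of n y "\<lambda>i. x i - y i"] by simp
    from this[of x y] this[of y x] Wp_norm_step_path_le[OF assms, of n "\<lambda>i. x i - y i"]
      Wp_norm_step_path_le[OF assms, of n "\<lambda>i. y i - x i"]
    show ?thesis by (simp add: abs_minus_commute)
  qed
  note le = this
  show "\<exists>d>0. \<forall>y. (\<Sum>i<n. \<bar>x i - y i\<bar>) < d \<longrightarrow> \<bar>step_norm p n x - step_norm p n y\<bar> < e"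
  proof (intro exI conjI allI impI)
    show "e / 2 > 0" using \<open>e > 0\<close> by simp
    show "\<bar>step_norm p n x - step_norm p n y\<bar> < e"
      if "(\<Sum>i<n. \<bar>x i - y i\<bar>) < e / 2" for y
      using le[of y] that by linarith
  qed
qed

lemma measurable_Wp_norm_step_path:
  assumes "p \<ge> 1" "\<And>i. i < n \<Longrightarrow> \<xi> i \<in> borel_measurable M"
  shows "(\<lambda>w. step_norm p n (\<lambda>i. \<xi> i w)) \<in> borel_measurable M"
  by (rule measurable_step_path_functional[OF continuous_on_Wp_norm_step_path]) (use assms in auto)

lemma (in prob_space) integrable_Wp_norm_step_path:
  assumes "p \<ge> 1" "\<And>i. i < n \<Longrightarrow> integrable M (\<xi> i)"
  shows "integrable M (\<lambda>w. step_norm p n (\<lambda>i. \<xi> i w))"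
proof (rule Bochner_Integration.integrable_bound)
  show "integrable M (\<lambda>w. 2 * (\<Sum>i<n. \<bar>\<xi> i w\<bar>))"
    using assms by (intro integrable_mult_right Bochner_Integration.integrable_sum integrable_abs) auto
  show "(\<lambda>w. step_norm p n (\<lambda>i. \<xi> i w)) \<in> borel_measurable M"
    using assms by (intro measurable_Wp_norm_step_path borel_measurable_integrable)
  show "AE w in M. norm (step_norm p n (\<lambda>i. \<xi> i w)) \<le> norm (2 * (\<Sum>i<n. \<bar>\<xi> i w\<bar>))"
    using Wp_norm_step_path_le[OF assms(1)] by (intro AE_I2) (simp add: Wp_norm_nonneg sum_nonneg)
qed

text \<open>Each \<open>f i\<close> is treated as a block of one index; injectivity makes the blocks
  disjoint.\<close>

lemma (in prob_space) indep_vars_reindex_inj: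
  assumes "indep_vars (\<lambda>_. N) X UNIV" "inj_on f I"
  shows "indep_vars (\<lambda>_. N) (\<lambda>i. X (f i)) I"
proof -
  have "indep_vars (\<lambda>i. PiM {f i} (\<lambda>_. N)) (\<lambda>i w. restrict (\<lambda>j. X j w) {f i}) I"
    using assms(2) by (intro indep_vars_restrict[OF assms(1)]) (auto simp: disjoint_family_on_def inj_on_def)
  from indep_vars_compose2[OF this, of "\<lambda>i x. x (f i)" "\<lambda>_. N"] show ?thesis by simp
qed

section \<open>Reduction of the linear process to its innovations\<close>

text \<open>\<open>has_bochner_integral\<close> asserts integrability along with the value. For the
  mean this matters: the integral of a non-integrable function also defaults to 0.\<close>

locale iid_noise = prob_space +
  fixes \<eta> :: "int \<Rightarrow> 'a \<Rightarrow> real" and \<sigma> :: real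
  assumes indep: "indep_vars (\<lambda>_. borel) \<eta> UNIV"
    and ident: "distr M borel (\<eta> j) = distr M borel (\<eta> 1)"
    and mean1: "has_bochner_integral M (\<eta> 1) 0"
    and var1: "has_bochner_integral M (\<lambda>w. (\<eta> 1 w)\<^sup>2) (\<sigma>\<^sup>2)"
    and sigma_pos: "\<sigma> > 0"
begin

lemma eta_measurable [measurable]: "\<eta> j \<in> borel_measurable M"
  using indep by (auto simp: indep_vars_def)

lemma integral_transfer:
  fixes f :: "real \<Rightarrow> real"
  assumes [measurable]: "f \<in> borel_measurable borel"
  shows "integrable M (\<lambda>w. f (\<eta> j w)) \<longleftrightarrow> integrable M (\<lambda>w. f (\<eta> 1 w))"
    and "expectation (\<lambda>w. f (\<eta> j w)) = expectation (\<lambda>w. f (\<eta> 1 w))"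
proof -
  show "integrable M (\<lambda>w. f (\<eta> j w)) \<longleftrightarrow> integrable M (\<lambda>w. f (\<eta> 1 w))"
    using integrable_distr_eq[of "\<eta> j" M borel f] integrable_distr_eq[of "\<eta> 1" M borel f] ident[of j] by simp
  show "expectation (\<lambda>w. f (\<eta> j w)) = expectation (\<lambda>w. f (\<eta> 1 w))"
    using integral_distr[of "\<eta> j" M borel f] integral_distr[of "\<eta> 1" M borel f] ident[of j] by simp
qed

lemma integrable_eta [simp]: "integrable M (\<eta> j)" and expectation_eta [simp]: "expectation (\<eta> j) = 0"
  using integral_transfer[of "\<lambda>x. x" j] mean1 by (auto simp: has_bochner_integral_iff)

lemma integrable_eta_sq [simp]: "integrable M (\<lambda>w. (\<eta> j w)\<^sup>2)" and expectation_eta_sq [simp]: "expectation (\<lambda>w. (\<eta> j w)\<^sup>2) = \<sigma>\<^sup>2"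
  using integral_transfer[of "\<lambda>x. x\<^sup>2" j] var1 by (auto simp: has_bochner_integral_iff)

lemma expectation_Wp_norm_noise_le:
  assumes "q > 2" "inj_on f {..<n}"
  shows "expectation (\<lambda>w. step_norm q n (\<lambda>i. \<eta> (f i) w)) \<le> lepingle_const q * \<sigma> * sqrt (real n)"
proof -
  have "ennreal (expectation (\<lambda>w. step_norm q n (\<lambda>i. \<eta> (f i) w)))
     = (\<integral>\<^sup>+ w. ennreal (step_norm q n (\<lambda>i. \<eta> (f i) w)) \<partial>M)"
    using assms by (intro nn_integral_eq_integral[symmetric] integrable_Wp_norm_step_path)
      (auto simp: Wp_norm_nonneg)
  also have "... \<le> ennreal (lepingle_const q * sqrt (real n * \<sigma>\<^sup>2))"
    using assms sigma_pos
    by (intro nn_integral_Wp_norm_step_path_le indep_vars_reindex_inj[OF indep]) auto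
  finally show ?thesis
    using sigma_pos lepingle_const_pos[OF assms(1)] by (simp add: ennreal_le_iff real_sqrt_mult algebra_simps)
qed

section \<open>Replacing shifted innovations by unshifted ones\<close>

definition tail2 :: "real \<Rightarrow> real" where
  "tail2 a = expectation (\<lambda>w. if \<bar>\<eta> 1 w\<bar> > a then (\<eta> 1 w)\<^sup>2 else 0)"

lemma integrable_tail2: "integrable M (\<lambda>w. if \<bar>\<eta> j w\<bar> > a then (\<eta> j w)\<^sup>2 else 0)"
  by (rule Bochner_Integration.integrable_bound[OF integrable_eta_sq[of j]]) auto

lemma expectation_tail2: "expectation (\<lambda>w. if \<bar>\<eta> j w\<bar> > a then (\<eta> j w)\<^sup>2 else 0) = tail2 a"
  unfolding tail2_def by (rule integral_transfer(2)[of "\<lambda>x. if \<bar>x\<bar> > a then x\<^sup>2 else 0"]) measurable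

text \<open>Stands in for a higher moment: through it, the largest of about \<open>n\<close>
  innovations is negligible against the square root of \<open>n\<close>.\<close>

lemma tail2_tendsto: "(\<lambda>n. tail2 (\<delta> * sqrt (real n))) \<longlonglongrightarrow> 0" if "\<delta> > 0"
proof -
  have "(\<lambda>n. tail2 (\<delta> * sqrt (real n))) \<longlonglongrightarrow> expectation (\<lambda>w. 0)"
    unfolding tail2_def
  proof (rule integral_dominated_convergence[where w="\<lambda>w. (\<eta> 1 w)\<^sup>2"])
    have lim: "filterlim (\<lambda>n. \<delta> * sqrt (real n)) at_top sequentially"
      by (intro filterlim_tendsto_pos_mult_at_top[OF tendsto_const that]
          filterlim_compose[OF sqrt_at_top filterlim_real_sequentially])
    show "AE w in M. (\<lambda>n. if \<delta> * sqrt (real n) < \<bar>\<eta> 1 w\<bar> then (\<eta> 1 w)\<^sup>2 else 0) \<longlonglongrightarrow> 0"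
    proof (intro AE_I2 tendsto_eventually)
      fix w
      from lim have "\<forall>\<^sub>F n in sequentially. \<bar>\<eta> 1 w\<bar> \<le> \<delta> * sqrt (real n)"
        by (simp add: filterlim_at_top)
      then show "\<forall>\<^sub>F n in sequentially. (if \<delta> * sqrt (real n) < \<bar>\<eta> 1 w\<bar> then (\<eta> 1 w)\<^sup>2 else 0) = 0"
        by (rule eventually_mono) auto
    qed
  qed auto
  then show ?thesis by simp
qed

text \<open>All common terms cancel, so a shift by \<open>j\<close> leaves \<open>j\<close> terms at
  each end however long the sum is.\<close>

lemma shifted_partial_sums:
  fixes f :: "int \<Rightarrow> real"
  shows "(\<Sum>i<k. f (int i + 1 - int j) - f (int i + 1)) = (\<Sum>l<j. f (int l + 1 - int j) - f (int (k + l) + 1 - int j))"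
proof (induction k)
  case (Suc k)
  have "f (int k + 1 - int j) - f (int k + 1) = (\<Sum>l<j. f (int (k + l) + 1 - int j) - f (int (k + Suc l) + 1 - int j))"
    using sum_lessThan_telescope'[of "\<lambda>l. f (int (k + l) + 1 - int j)" j] by simp
  then show ?case using Suc by (simp flip: sum.distrib add: algebra_simps)
qed simp

definition shift_norm :: "real \<Rightarrow> nat \<Rightarrow> nat \<Rightarrow> 'a \<Rightarrow> real" where
  "shift_norm p n j w = step_norm p n (\<lambda>i. \<eta> (int i + 1 - int j) w - \<eta> (int i + 1) w)"

lemma shift_norm_nonneg: "shift_norm p n j w \<ge> 0"
  by (simp add: shift_norm_def Wp_norm_nonneg)

lemma integrable_shift_norm: "p \<ge> 1 \<Longrightarrow> integrable M (shift_norm p n j)"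
  unfolding shift_norm_def by (intro integrable_Wp_norm_step_path) auto

lemma expectation_shift_norm_le:
  assumes "q > 2"
  shows "expectation (shift_norm q n j) \<le> 2 * lepingle_const q * \<sigma> * sqrt (real n)"
proof -
  have "expectation (shift_norm q n j) \<le> expectation (\<lambda>w. step_norm q n (\<lambda>i. \<eta> (int i + 1 - int j) w)
     + step_norm q n (\<lambda>i. \<eta> (int i + 1) w))"
    unfolding shift_norm_def using assms
    by (intro integral_mono Bochner_Integration.integrable_add integrable_Wp_norm_step_path Wp_norm_step_path_diff) auto
  also have "... = expectation (\<lambda>w. step_norm q n (\<lambda>i. \<eta> (int i + 1 - int j) w))
     + expectation (\<lambda>w. step_norm q n (\<lambda>i. \<eta> (int i + 1) w))"
    using assms by (intro Bochner_Integration.integral_add integrable_Wp_norm_step_path) auto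
  also have "... \<le> lepingle_const q * \<sigma> * sqrt (real n) + lepingle_const q * \<sigma> * sqrt (real n)"
    using assms by (intro add_mono expectation_Wp_norm_noise_le) (auto simp: inj_on_def)
  finally show ?thesis by (simp add: algebra_simps)
qed

text \<open>The boundary terms are bounded by the largest innovation in the window
  \<open>1 - j..n\<close>, and this in turn by an expression linear in truncated squares, since
  \<open>\<bar>x\<bar> \<le> a\<close> or \<open>\<bar>x\<bar> \<le> x\<^sup>2 / a\<close>. The mean
  of the latter is explicit.\<close>

lemma abs_step_path_shift_le:
  assumes "a > 0" "t \<in> {0..1}"
  shows "\<bar>step_path n (\<lambda>i. \<eta> (int i + 1 - int j) w - \<eta> (int i + 1) w) t\<bar>
    \<le> 2 * real j * (a + (\<Sum>k=1 - int j..int n. if \<bar>\<eta> k w\<bar> > a then (\<eta> k w)\<^sup>2 else 0) / a)"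
proof -
  define B where "B = a + (\<Sum>k=1 - int j..int n. if \<bar>\<eta> k w\<bar> > a then (\<eta> k w)\<^sup>2 else 0) / a"
  have B: "\<bar>\<eta> k w\<bar> \<le> B" if "k \<in> {1 - int j..int n}" for k
  proof (cases "\<bar>\<eta> k w\<bar> > a")
    case True
    have "\<bar>\<eta> k w\<bar> * a \<le> \<bar>\<eta> k w\<bar> * \<bar>\<eta> k w\<bar>" using True by (intro mult_left_mono) auto
    also have "... = (if \<bar>\<eta> k w\<bar> > a then (\<eta> k w)\<^sup>2 else 0)" using True by (simp add: power2_eq_square)
    also have "... \<le> (\<Sum>k=1 - int j..int n. if \<bar>\<eta> k w\<bar> > a then (\<eta> k w)\<^sup>2 else 0)"
      by (rule member_le_sum[OF that]) auto
    finally show ?thesis using assms by (simp add: B_def field_simps add_increasing)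
  next
    case False
    then show ?thesis using assms by (simp add: B_def add_increasing2 sum_nonneg)
  qed
  let ?k = "nat \<lfloor>real n * t\<rfloor>"
  have k: "?k \<le> n" using assms(2) by (rule nat_floor_le)
  have "\<bar>step_path n (\<lambda>i. \<eta> (int i + 1 - int j) w - \<eta> (int i + 1) w) t\<bar>
      = \<bar>\<Sum>l<j. \<eta> (int l + 1 - int j) w - \<eta> (int (?k + l) + 1 - int j) w\<bar>"
    using assms(2) shifted_partial_sums[of "\<lambda>i. \<eta> i w" j ?k] by (simp add: step_path_def)
  also have "... \<le> (\<Sum>l<j. \<bar>\<eta> (int l + 1 - int j) w - \<eta> (int (?k + l) + 1 - int j) w\<bar>)"
    by (rule sum_abs)
  also have "... \<le> (\<Sum>l<j. 2 * B)"
  proof (rule sum_mono)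
    fix l assume "l \<in> {..<j}"
    then have "\<bar>\<eta> (int l + 1 - int j) w\<bar> \<le> B" "\<bar>\<eta> (int (?k + l) + 1 - int j) w\<bar> \<le> B"
      using k by (intro B; auto)+
    then show "\<bar>\<eta> (int l + 1 - int j) w - \<eta> (int (?k + l) + 1 - int j) w\<bar> \<le> 2 * B" by linarith
  qed
  finally show ?thesis by (simp add: B_def algebra_simps)
qed

text \<open>In \<open>q\<close>-norm the shift is known to cost at most order square root of
  \<open>n\<close>, which is not small enough; in sup norm it costs less by
  \<open>tail2_tendsto\<close>. Interpolation with a large \<open>K\<close> combines the
  two.\<close>

lemma shift_norm_negligible:
  assumes "p > 2"
  shows "(\<lambda>n. expectation (shift_norm p n j) / sqrt (real n)) \<longlonglongrightarrow> 0"
proof (rule LIMSEQ_I)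
  fix e :: real assume e: "e > 0"
  define q where "q = (2 + p) / 2"
  have q: "q > 2" "q < p" "q \<ge> 1" using assms by (auto simp: q_def)
  define C where "C = 2 * lepingle_const q * \<sigma>"
  have C: "C > 0" using lepingle_const_pos[OF q(1)] sigma_pos by (simp add: C_def)
  \<comment> \<open>\<open>K\<close> and the truncation level \<open>\<delta>\<close> are chosen so
    that the \<open>q\<close>-norm and the part of the sup bound linear in \<open>\<delta>\<close>
    contribute at most \<open>e / 4\<close> each; what remains carries the factor \<open>T n\<close>
    and tends to 0.\<close>
  define K where "K = 4 * C / e"
  have K: "K > 0" using C e by (simp add: K_def)
  from Wp_norm_interpolate[OF q(3,2) K] obtain L where L: "L \<ge> 0"
    "\<And>g s. (\<forall>t\<in>{0..1}. \<bar>g t\<bar> \<le> s) \<Longrightarrow> p_variation q g < \<infinity> \<Longrightarrow> Wp_norm p g \<le> L * s + Wp_norm q g / K"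
    by blast
  define \<delta> where "\<delta> = e / (4 * (2 * L * real j + 1))"
  have den: "2 * L * real j + 1 > 0" using L by (simp add: add_nonneg_pos)
  have \<delta>: "\<delta> > 0" using e den by (simp add: \<delta>_def)
  have L\<delta>: "2 * L * real j * \<delta> \<le> e / 4" using den e L by (simp add: \<delta>_def field_simps)
  define T where "T n = tail2 (\<delta> * sqrt (real n))" for n
  have bound: "expectation (shift_norm p n j) / sqrt (real n)
      \<le> 2 * L * real j * (\<delta> + (1 + real j / real n) * T n / \<delta>) + e / 4" if "n > 0" for n
  proof -
    define a where "a = \<delta> * sqrt (real n)"
    have a: "a > 0" using \<delta> that by (simp add: a_def)
    let ?S = "\<lambda>w. \<Sum>k=1 - int j..int n. if \<bar>\<eta> k w\<bar> > a then (\<eta> k w)\<^sup>2 else 0"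
    have S_int: "integrable M ?S" by (intro Bochner_Integration.integrable_sum integrable_tail2)
    have S_exp: "expectation ?S = real (n + j) * tail2 a"
    proof -
      have "expectation ?S = (\<Sum>k=1 - int j..int n. tail2 a)"
        by (subst Bochner_Integration.integral_sum) (simp_all only: integrable_tail2 expectation_tail2)
      then show ?thesis by simp
    qed
    have "expectation (shift_norm p n j) \<le> expectation (\<lambda>w. L * (2 * real j * (a + ?S w / a)) + shift_norm q n j w / K)"
    proof (rule integral_mono)
      show "integrable M (shift_norm p n j)" using assms by (intro integrable_shift_norm) auto
      show "integrable M (\<lambda>w. L * (2 * real j * (a + ?S w / a)) + shift_norm q n j w / K)"
        using S_int integrable_shift_norm[OF q(3)] by simp
      show "shift_norm p n j w \<le> L * (2 * real j * (a + ?S w / a)) + shift_norm q n j w / K" for w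
        unfolding shift_norm_def using step_path_fin[OF q(3)] abs_step_path_shift_le[OF a]
        by (intro L(2)) auto
    qed
    also have "... = L * (2 * real j * (a + expectation ?S / a)) + expectation (shift_norm q n j) / K"
      using S_int integrable_shift_norm[OF q(3)] by (simp add: prob_space)
    also have "... \<le> L * (2 * real j * (a + expectation ?S / a)) + C * sqrt (real n) / K"
      using expectation_shift_norm_le[OF q(1), of n j] K by (intro add_left_mono divide_right_mono) (auto simp: C_def)
    also have "... = sqrt (real n) * (2 * L * real j * (\<delta> + (1 + real j / real n) * T n / \<delta>) + e / 4)"
    proof -
      have "expectation ?S / a = sqrt (real n) * ((1 + real j / real n) * T n / \<delta>)"
      proof -
        have "real (n + j) = real n * (1 + real j / real n)" using that by (simp add: field_simps)
        then have "expectation ?S / a = (real n * (1 + real j / real n)) * T n / (\<delta> * sqrt (real n))"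
          unfolding S_exp unfolding T_def a_def by simp
        also have "... = (real n / sqrt (real n)) * ((1 + real j / real n) * T n / \<delta>)" by (simp add: mult_ac)
        also have "real n / sqrt (real n) = sqrt (real n)" by (simp add: real_div_sqrt)
        finally show ?thesis .
      qed
      moreover have "C * sqrt (real n) / K = sqrt (real n) * (e / 4)"
        using C e by (simp add: K_def)
      ultimately show ?thesis by (simp add: a_def algebra_simps)
    qed
    finally show ?thesis using that by (simp add: field_simps)
  qed
  have "(\<lambda>n. 2 * L * real j * (\<delta> + (1 + real j / real n) * T n / \<delta>) + e / 4)
      \<longlonglongrightarrow> 2 * L * real j * (\<delta> + (1 + 0) * 0 / \<delta>) + e / 4"
    unfolding T_def using \<delta>
    by (intro tendsto_intros tail2_tendsto lim_const_over_n) auto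
  then have "\<forall>\<^sub>F n in sequentially. 2 * L * real j * (\<delta> + (1 + real j / real n) * T n / \<delta>) + e / 4 < e"
    by (rule order_tendstoD(2)) (use L\<delta> e in auto)
  then have "\<forall>\<^sub>F n in sequentially. norm (expectation (shift_norm p n j) / sqrt (real n) - 0) < e"
    using eventually_gt_at_top[of 0]
  proof eventually_elim
    case (elim n)
    have "expectation (shift_norm p n j) \<ge> 0"
      by (rule integral_nonneg_AE) (simp add: shift_norm_nonneg)
    then show ?case using bound[of n] elim by simp
  qed
  then show "\<exists>no. \<forall>n\<ge>no. norm (expectation (shift_norm p n j) / sqrt (real n) - 0) < e"
    by (simp add: eventually_sequentially)
qed

section \<open>Convergence of the defining series and passage to the limit\<close>

lemma linear_process_sums:
  assumes "summable (\<lambda>j. \<bar>\<psi> j\<bar>)"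
  shows "AE w in M. \<forall>i. (\<lambda>j. \<psi> j * \<eta> (i - int j) w) sums linear_process \<psi> \<eta> i w"
proof (subst AE_all_countable, intro allI)
  fix i
  \<comment> \<open>All first absolute moments equal \<open>c\<close>, so the series of absolute
    values has finite mean and is finite almost surely. The exceptional sets for the various
    \<open>i\<close> are countably many.\<close>
  define c where "c = expectation (\<lambda>w. \<bar>\<eta> 1 w\<bar>)"
  have c: "(\<integral>\<^sup>+ w. ennreal \<bar>\<eta> j w\<bar> \<partial>M) = ennreal c" for j
    using integral_transfer(2)[of "\<lambda>x. \<bar>x\<bar>" j] by (subst nn_integral_eq_integral) (auto simp: c_def)
  have "(\<integral>\<^sup>+ w. (\<Sum>j. ennreal \<bar>\<psi> j * \<eta> (i - int j) w\<bar>) \<partial>M) = (\<Sum>j. ennreal (\<bar>\<psi> j\<bar> * c))"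
    by (subst nn_integral_suminf) (auto simp: abs_mult ennreal_mult' nn_integral_cmult c)
  also have "... = ennreal (\<Sum>j. \<bar>\<psi> j\<bar> * c)"
    using assms by (intro suminf_ennreal2 summable_mult2) (auto simp: c_def)
  also have "... < \<infinity>" by simp
  finally have "AE w in M. (\<Sum>j. ennreal \<bar>\<psi> j * \<eta> (i - int j) w\<bar>) \<noteq> \<infinity>"
    by (intro nn_integral_PInf_AE) auto
  then show "AE w in M. (\<lambda>j. \<psi> j * \<eta> (i - int j) w) sums linear_process \<psi> \<eta> i w"
  proof (eventually_elim, unfold linear_process_def, intro summable_sums)
    fix w assume "(\<Sum>j. ennreal \<bar>\<psi> j * \<eta> (i - int j) w\<bar>) \<noteq> \<infinity>"
    then have "summable (\<lambda>j. \<bar>\<psi> j * \<eta> (i - int j) w\<bar>)"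
      by (intro summable_suminf_not_top) auto
    then show "summable (\<lambda>j. \<psi> j * \<eta> (i - int j) w)" by (rule summable_rabs_cancel)
  qed
qed

lemma measurable_linear_process [measurable]: "linear_process \<psi> \<eta> i \<in> borel_measurable M"
  unfolding linear_process_def by measurable

text \<open>Up to the index shift, the difference is the series of
  \<open>\<psi> j * (\<eta> (i - j) - \<eta> i)\<close>, so its mean norm is at most the sum of the
  mean shift norms weighted by \<open>\<bar>\<psi> j\<bar>\<close>. After normalisation each of
  these vanishes as \<open>n\<close> grows, and Lepingle's bound holds uniformly in
  \<open>j\<close>.\<close>

lemma linear_process_approx:
  assumes "summable (\<lambda>j. \<bar>\<psi> j\<bar>)" "p > 2"
  defines "A \<equiv> \<Sum>j. \<psi> j"
  shows "\<exists>b. b \<longlonglongrightarrow> 0 \<and> (\<forall>n>0. (\<integral>\<^sup>+ w. ennreal (step_norm p n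
    (\<lambda>i. real n powr (-1/2) * (linear_process \<psi> \<eta> (int i + 1) w - A * \<eta> (int i + 1) w))) \<partial>M) \<le> ennreal (b n))"
proof (intro exI conjI allI impI)
  have p: "p \<ge> 1" using assms by simp
  define b where "b n = (\<Sum>j. \<bar>\<psi> j\<bar> * (expectation (shift_norm p n j) / sqrt (real n)))" for n
  define C where "C = 2 * lepingle_const p * \<sigma>"
  have e0: "expectation (shift_norm p n j) \<ge> 0" for n j
    by (rule integral_nonneg_AE) (simp add: shift_norm_def Wp_norm_nonneg)
  have eC: "expectation (shift_norm p n j) / sqrt (real n) \<le> C" for n j
  proof (cases "n = 0")
    \<comment> \<open>Division by \<open>sqrt 0\<close> yields 0 here.\<close>
    case True
    then show ?thesis using lepingle_const_pos[OF assms(2)] sigma_pos by (simp add: C_def)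
  next
    case False
    then show ?thesis using expectation_shift_norm_le[OF assms(2), of n j] by (simp add: C_def field_simps)
  qed
  have le: "norm (\<bar>\<psi> j\<bar> * (expectation (shift_norm p n j) / sqrt (real n))) \<le> \<bar>\<psi> j\<bar> * C" for n j
    using mult_left_mono[OF eC[of n j], of "\<bar>\<psi> j\<bar>"] e0[of n j] by (simp add: abs_mult)
  have sC: "summable (\<lambda>j. \<bar>\<psi> j\<bar> * C)" using assms(1) by (rule summable_mult2)
  have sb: "summable (\<lambda>j. \<bar>\<psi> j\<bar> * (expectation (shift_norm p n j) / sqrt (real n)))" for n
    by (rule summable_comparison_test'[OF sC]) (use le in auto)
  have "(\<lambda>n. \<bar>\<psi> j\<bar> * (expectation (shift_norm p n j) / sqrt (real n))) \<longlonglongrightarrow> \<bar>\<psi> j\<bar> * 0" for j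
    by (intro tendsto_mult tendsto_const shift_norm_negligible assms)
  \<comment> \<open>Tannery's theorem is dominated convergence for series; the majorant is
    \<open>\<bar>\<psi> j\<bar> * C\<close>.\<close>
  then have "(\<lambda>n. b n) \<longlonglongrightarrow> (\<Sum>j. \<bar>\<psi> j\<bar> * 0)"
    unfolding b_def
    by (rule tannerys_theorem[OF _ _ sC sequentially_bot, THEN conjunct2, THEN conjunct2])
      (intro always_eventually allI, simp only: split_beta le)
  then show "b \<longlonglongrightarrow> 0" by simp
  fix n :: nat assume n: "n > 0"
  \<comment> \<open>The triangle inequality is available for the finite truncations
    \<open>y J\<close> only. Their bound does not depend on \<open>J\<close>, and Fatou's lemma
    carries it over to the limit \<open>z\<close>.\<close>
  define y where "y J w i = (\<Sum>j<J. \<psi> j * (\<eta> (int i + 1 - int j) w - \<eta> (int i + 1) w))" for J w i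
  define z where "z w i = linear_process \<psi> \<eta> (int i + 1) w - A * \<eta> (int i + 1) w" for w i
  have yN: "step_norm p n (y J w) \<le> (\<Sum>j<J. \<bar>\<psi> j\<bar> * shift_norm p n j w)" for J w
  proof (induction J)
    case 0
    show ?case using Wp_norm_step_path_le[OF p, of n "\<lambda>_. 0"] by (simp add: y_def)
  next
    case (Suc J)
    have "step_norm p n (y (Suc J) w) \<le> step_norm p n (y J w) + \<bar>\<psi> J\<bar> * shift_norm p n J w"
      unfolding y_def shift_norm_def sum.lessThan_Suc Wp_norm_step_path_scale[OF p, symmetric]
      by (rule Wp_norm_step_path_add[OF p])
    then show ?case using Suc by simp
  qed
  have yI: "(\<integral>\<^sup>+ w. ennreal (step_norm p n (y J w)) \<partial>M) \<le> ennreal (sqrt (real n) * b n)" for J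
  proof -
    have "(\<integral>\<^sup>+ w. ennreal (step_norm p n (y J w)) \<partial>M)
        \<le> (\<integral>\<^sup>+ w. ennreal (\<Sum>j<J. \<bar>\<psi> j\<bar> * shift_norm p n j w) \<partial>M)"
      by (intro nn_integral_mono ennreal_leI yN)
    also have "... = ennreal (\<Sum>j<J. \<bar>\<psi> j\<bar> * expectation (shift_norm p n j))"
      using integrable_shift_norm[OF p]
      by (subst nn_integral_eq_integral) (auto intro!: sum_nonneg simp: shift_norm_nonneg)
    also have "(\<Sum>j<J. \<bar>\<psi> j\<bar> * expectation (shift_norm p n j))
        = sqrt (real n) * (\<Sum>j<J. \<bar>\<psi> j\<bar> * (expectation (shift_norm p n j) / sqrt (real n)))"
      using n by (simp add: sum_distrib_left)
    also have "ennreal ... \<le> ennreal (sqrt (real n) * b n)"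
      unfolding b_def using e0 by (intro ennreal_leI mult_left_mono sum_le_suminf[OF sb]) auto
    finally show ?thesis .
  qed
  have [measurable]: "(\<lambda>w. step_norm p n (y J w)) \<in> borel_measurable M" for J
  proof -
    have "(\<lambda>w. y J w i) \<in> borel_measurable M" for i unfolding y_def by measurable
    from measurable_Wp_norm_step_path[OF p, of n "\<lambda>i w. y J w i", OF this] show ?thesis by simp
  qed
  have lim: "AE w in M. (\<lambda>J. step_norm p n (y J w)) \<longlonglongrightarrow> step_norm p n (z w)"
    using linear_process_sums[OF assms(1)]
  proof eventually_elim
    fix w assume s: "\<forall>i. (\<lambda>j. \<psi> j * \<eta> (i - int j) w) sums linear_process \<psi> \<eta> i w"
    have A: "\<psi> sums A" unfolding A_def using summable_rabs_cancel[OF assms(1)] by (rule summable_sums)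
    have lim: "(\<lambda>J. y J w i) \<longlonglongrightarrow> z w i" for i
      using sums_diff[OF s[rule_format, of "int i + 1"] sums_mult2[OF A, of "\<eta> (int i + 1) w"]]
      unfolding sums_def y_def z_def by (simp add: right_diff_distrib)
    have "(\<lambda>J. 2 * (\<Sum>i<n. \<bar>y J w i - z w i\<bar>)) \<longlonglongrightarrow> 2 * (\<Sum>i<n. \<bar>z w i - z w i\<bar>)"
      by (intro tendsto_intros lim)
    then have "(\<lambda>J. 2 * (\<Sum>i<n. \<bar>y J w i - z w i\<bar>)) \<longlonglongrightarrow> 0" by simp
    then have "(\<lambda>J. step_norm p n (y J w) - step_norm p n (z w)) \<longlonglongrightarrow> 0"
    proof (rule Lim_null_comparison[rotated], intro always_eventually allI)
      fix J
      have "step_norm p n u \<le> step_norm p n v + 2 * (\<Sum>i<n. \<bar>u i - v i\<bar>)" for u v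
        using Wp_norm_step_path_add[OF p, of n v "\<lambda>i. u i - v i"] Wp_norm_step_path_le[OF p, of n "\<lambda>i. u i - v i"]
        by simp
      from this[of "y J w" "z w"] this[of "z w" "y J w"]
      show "norm (step_norm p n (y J w) - step_norm p n (z w)) \<le> 2 * (\<Sum>i<n. \<bar>y J w i - z w i\<bar>)"
        by (simp add: abs_minus_commute)
    qed
    then show "(\<lambda>J. step_norm p n (y J w)) \<longlonglongrightarrow> step_norm p n (z w)"
      by (simp add: LIM_zero_iff)
  qed
  have "(\<integral>\<^sup>+ w. ennreal (step_norm p n (z w)) \<partial>M)
     = (\<integral>\<^sup>+ w. liminf (\<lambda>J. ennreal (step_norm p n (y J w))) \<partial>M)"
    using lim by (intro nn_integral_cong_AE, eventually_elim) (auto intro!: lim_imp_Liminf[symmetric] tendsto_ennrealI)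
  also have "... \<le> liminf (\<lambda>J. \<integral>\<^sup>+ w. ennreal (step_norm p n (y J w)) \<partial>M)"
    by (rule nn_integral_liminf) auto
  also have "... \<le> ennreal (sqrt (real n) * b n)"
    using yI by (intro Liminf_le) (auto intro!: always_eventually)
  finally have zI: "(\<integral>\<^sup>+ w. ennreal (step_norm p n (z w)) \<partial>M) \<le> ennreal (sqrt (real n) * b n)" .
  have [measurable]: "(\<lambda>w. step_norm p n (z w)) \<in> borel_measurable M"
  proof -
    have "(\<lambda>w. z w i) \<in> borel_measurable M" for i unfolding z_def by measurable
    from measurable_Wp_norm_step_path[OF p, of n "\<lambda>i w. z w i", OF this] show ?thesis by simp
  qed
  have rn: "real n powr (-1/2) = 1 / sqrt (real n)"
    using n by (simp add: powr_half_sqrt[symmetric] powr_minus_divide)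
  have "(\<integral>\<^sup>+ w. ennreal (step_norm p n (\<lambda>i. real n powr (-1/2) * z w i)) \<partial>M)
     = ennreal (1 / sqrt (real n)) * (\<integral>\<^sup>+ w. ennreal (step_norm p n (z w)) \<partial>M)"
    unfolding Wp_norm_step_path_scale[OF p] rn
    by (subst nn_integral_cmult[symmetric]) (auto simp: ennreal_mult Wp_norm_nonneg simp flip: ennreal_mult)
  also have "... \<le> ennreal (1 / sqrt (real n)) * ennreal (sqrt (real n) * b n)"
    by (intro mult_left_mono zI) auto
  also have "... = ennreal (b n)" using n by (subst ennreal_mult'[symmetric]) auto
  finally show "(\<integral>\<^sup>+ w. ennreal (step_norm p n
    (\<lambda>i. real n powr (-1/2) * (linear_process \<psi> \<eta> (int i + 1) w - A * \<eta> (int i + 1) w))) \<partial>M) \<le> ennreal (b n)"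
    by (simp only: z_def)
qed

end

section \<open>Block sums\<close>

text \<open>Integer division places the block ends at the number of summands that
  \<open>step_path n\<close> uses at time \<open>k / m\<close>. For \<open>m \<ge> 1\<close> the
  first \<open>m\<close> blocks partition \<open>{..<n}\<close> even if \<open>m\<close> does not
  divide \<open>n\<close>.\<close>

definition block_sums :: "nat \<Rightarrow> nat \<Rightarrow> (nat \<Rightarrow> real) \<Rightarrow> nat \<Rightarrow> real" where
  "block_sums m n x k = (\<Sum>i = n * k div m..<n * Suc k div m. x i)"

lemma block_bounds: "n * k div m \<le> n * Suc k div m" for n k m :: nat
  by (intro div_le_mono) simp

lemma sum_block_sums: "(\<Sum>k<j. block_sums m n x k) = (\<Sum>i<n * j div m. x i)"
proof (induction j)
  case (Suc j)
  then show ?case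
    using partial_sums_diff[OF block_bounds[of n j m], of x] by (simp add: block_sums_def)
qed simp

lemma nat_floor_grid: "nat \<lfloor>real n * (real j / real m)\<rfloor> = n * j div m"
  using floor_divide_of_nat_eq[of "n * j" m, where 'a=real] by simp

lemma step_path_block_sums:
  assumes "m \<ge> 1" "t \<in> {0..1}"
  shows "step_path m (block_sums m n x) t = step_path n x (grid_point m t)"
proof -
  define k where "k = nat \<lfloor>real m * t\<rfloor>"
  have "k \<le> m" unfolding k_def using assms(2) by (rule nat_floor_le)
  then have "real k / real m \<in> {0..1}" using assms(1) by simp
  then have "step_path n x (real k / real m) = (\<Sum>i<n * k div m. x i)"
    unfolding step_path_def nat_floor_grid[symmetric] by simp
  moreover have "step_path m (block_sums m n x) t = (\<Sum>i<n * k div m. x i)"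
    using assms(2) by (simp add: step_path_def k_def sum_block_sums)
  ultimately show ?thesis by (simp only: k_def)
qed

lemma Wp_norm_block_sums_le:
  assumes "m \<ge> 1" "q \<ge> 1"
  shows "step_norm q m (block_sums m n x) \<le> step_norm q n x"
proof -
  have "step_norm q m (block_sums m n x) = Wp_norm q (\<lambda>t. step_path n x (grid_point m t))"
    by (rule Wp_norm_cong) (rule step_path_block_sums[OF assms(1)])
  then show ?thesis using Wp_norm_subsample[OF assms step_path_fin[OF assms(2)]] by simp
qed

text \<open>The coarse path stays at the value of the fine path at the left end of the current
  block, so the difference is a sum over an initial part of one block.\<close>

lemma abs_step_path_minus_block_sums_le:
  assumes "m \<ge> 1" "s \<ge> 0" "t \<in> {0..1}"
    and osc: "\<And>k j. k < m \<Longrightarrow> n * k div m \<le> j \<Longrightarrow> j \<le> n * Suc k div m \<Longrightarrow> \<bar>\<Sum>i = n * k div m..<j. x i\<bar> \<le> s"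
  shows "\<bar>step_path n x t - step_path m (block_sums m n x) t\<bar> \<le> s"
proof -
  define k where "k = nat \<lfloor>real m * t\<rfloor>"
  define j where "j = nat \<lfloor>real n * t\<rfloor>"
  have km: "k \<le> m" unfolding k_def using assms(3) by (rule nat_floor_le)
  have k_le: "real k \<le> real m * t" using assms by (simp add: k_def)
  have k_gt: "real m * t < real (Suc k)" using assms unfolding k_def by linarith
  have "real n * (real k / real m) \<le> real n * t"
    using assms k_le by (intro mult_left_mono) (auto simp: field_simps)
  then have j1: "n * k div m \<le> j"
    unfolding j_def nat_floor_grid[symmetric] by (intro nat_mono floor_mono)
  have "real n * t \<le> real n * (real (Suc k) / real m)"
    using assms k_gt by (intro mult_left_mono) (auto simp: field_simps)
  then have j2: "j \<le> n * Suc k div m"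
    unfolding j_def nat_floor_grid[symmetric] by (intro nat_mono floor_mono)
  have eq: "step_path n x t - step_path m (block_sums m n x) t = (\<Sum>i = n * k div m..<j. x i)"
    using assms(3) partial_sums_diff[OF j1, of x] by (simp add: step_path_def sum_block_sums k_def j_def)
  show ?thesis
  proof (cases "k = m")
    \<comment> \<open>Only \<open>t = 1\<close> leads here. There is no block with index
      \<open>m\<close>, but the sum from \<open>n\<close> to \<open>j \<le> n\<close> is
      empty.\<close>
    case True
    then have "n * k div m = n" using assms by simp
    moreover have "j \<le> n" unfolding j_def using assms(3) by (rule nat_floor_le)
    ultimately show ?thesis using assms unfolding eq by simp
  next
    case False
    then show ?thesis unfolding eq using km j1 j2 by (intro osc) auto
  qed
qed

section \<open>Ottaviani's inequality\<close>

text \<open>At the first time \<open>j\<close> at which the walk exceeds \<open>2 * x\<close>, the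
  rest of the walk stays within \<open>x\<close> with probability at least 1/2, independently of the
  past, and then the endpoint still exceeds \<open>x\<close>. Summation over the disjoint events
  gives the factor 2.\<close>

lemma (in prob_space) ottaviani:
  fixes \<xi> :: "nat \<Rightarrow> 'a \<Rightarrow> real"
  assumes indep: "indep_vars (\<lambda>_. borel) \<xi> {..<n}"
    and small: "\<And>j. j \<le> n \<Longrightarrow> prob {w\<in>space M. x < \<bar>\<Sum>i=j..<n. \<xi> i w\<bar>} \<le> 1 / 2"
  shows "prob {w\<in>space M. \<exists>j\<le>n. 2 * x < \<bar>\<Sum>i<j. \<xi> i w\<bar>} \<le> 2 * prob {w\<in>space M. x < \<bar>\<Sum>i<n. \<xi> i w\<bar>}"
proof -
  have meas: "\<And>i. i < n \<Longrightarrow> \<xi> i \<in> borel_measurable M" using indep by (auto simp: indep_vars_def)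
  have S_meas: "(\<lambda>w. \<Sum>i\<in>I. \<xi> i w) \<in> borel_measurable M" if "I \<subseteq> {..<n}" for I
    using that by (intro borel_measurable_sum meas) auto
  define first where "first j y \<longleftrightarrow> 2 * x < \<bar>\<Sum>i<j. y i\<bar> \<and> (\<forall>i\<in>{..<j}. \<bar>\<Sum>l<i. y l\<bar> \<le> 2 * x)" for j :: nat and y :: "nat \<Rightarrow> real"
  define A where "A j = {w\<in>space M. first j (\<lambda>i. \<xi> i w)}" for j
  define B where "B j = {w\<in>space M. \<bar>\<Sum>i=j..<n. \<xi> i w\<bar> \<le> x}" for j
  have A_sets: "A j \<in> sets M" if "j \<le> n" for j
  proof -
    have [measurable]: "(\<lambda>w. \<Sum>i<l. \<xi> i w) \<in> borel_measurable M" if "l \<le> j" for l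
      using that \<open>j \<le> n\<close> by (intro S_meas) auto
    have "Measurable.pred M (\<lambda>w. \<forall>i\<in>{..<j}. \<bar>\<Sum>l<i. \<xi> l w\<bar> \<le> 2 * x)"
    proof (rule pred_intros_finite)
      fix i assume "i \<in> {..<j}"
      then have [measurable]: "(\<lambda>w. \<Sum>l<i. \<xi> l w) \<in> borel_measurable M"
        using \<open>j \<le> n\<close> by (intro S_meas) auto
      show "Measurable.pred M (\<lambda>w. \<bar>\<Sum>l<i. \<xi> l w\<bar> \<le> 2 * x)" by measurable
    qed simp
    then have [measurable]: "{w\<in>space M. \<forall>i\<in>{..<j}. \<bar>\<Sum>l<i. \<xi> l w\<bar> \<le> 2 * x} \<in> sets M" by (simp add: pred_def)
    have "A j = {w\<in>space M. 2 * x < \<bar>\<Sum>i<j. \<xi> i w\<bar>} \<inter> {w\<in>space M. \<forall>i\<in>{..<j}. \<bar>\<Sum>l<i. \<xi> l w\<bar> \<le> 2 * x}"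
      by (auto simp: A_def first_def)
    also have "... \<in> sets M" by measurable
    finally show ?thesis .
  qed
  have B_sets: "B j \<in> sets M" for j
  proof -
    have [measurable]: "(\<lambda>w. \<Sum>i=j..<n. \<xi> i w) \<in> borel_measurable M" by (intro S_meas) auto
    show ?thesis unfolding B_def by measurable
  qed
  have disj: "disjoint_family_on A {..n}"
    unfolding disjoint_family_on_def A_def first_def
    by (auto, metis linorder_neqE_nat not_le lessThan_iff)
  have AB: "prob (A j \<inter> B j) = prob (A j) * prob (B j)" if j: "j \<le> n" for j
  proof -
    have comp: "(\<lambda>y. \<Sum>i\<in>I. y i :: real) \<in> borel_measurable (PiM J (\<lambda>_. borel))" if "I \<subseteq> J" for I J :: "nat set"
      by (rule borel_measurable_sum[where f="\<lambda>i y. y i"])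
        (use that in \<open>auto intro!: measurable_component_singleton\<close>)
    \<comment> \<open>The event \<open>A j\<close> enters as a real-valued indicator of the past;
      the sets \<open>{1}\<close> and \<open>{-x..x}\<close> recover the two events from the
      independent pair.\<close>
    have "indep_var borel (\<lambda>w. (\<lambda>y. if first j y then 1 else 0 :: real) (\<lambda>i. \<xi> i w))
        borel (\<lambda>w. (\<lambda>y. \<Sum>i=j..<n. y i) (\<lambda>i. \<xi> i w))"
    proof (rule indep_past_future[OF indep j])
      have "Measurable.pred (PiM {..<j} (\<lambda>_. borel)) (first j)"
        unfolding first_def
      proof (intro pred_intros_logic pred_intros_finite finite_lessThan)
        show "Measurable.pred (PiM {..<j} (\<lambda>_. borel)) (\<lambda>y. 2 * x < \<bar>\<Sum>i<j. y i\<bar>)"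
          using comp[of "{..<j}" "{..<j}", OF order_refl] by measurable
        show "Measurable.pred (PiM {..<j} (\<lambda>_. borel)) (\<lambda>y. \<bar>\<Sum>l<i. y l\<bar> \<le> 2 * x)" if "i \<in> {..<j}" for i
        proof -
          have "{..<i} \<subseteq> {..<j}" using that by auto
          from comp[OF this] show ?thesis by measurable
        qed
      qed
      then show "(\<lambda>y. if first j y then 1 else 0 :: real) \<in> borel_measurable (PiM {..<j} (\<lambda>_. borel))"
        by measurable
      show "(if first j (restrict y {..<j}) then 1 else 0) = (if first j y then 1 else 0 :: real)" for y
        by (simp add: first_def)
      show "(\<lambda>y. \<Sum>i=j..<n. y i :: real) \<in> borel_measurable (PiM {j..<n} (\<lambda>_. borel))" by (rule comp) simp
    qed simp
    from indep_varD[OF this, of "{1}" "{-x..x}"]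
    have "prob ((\<lambda>w. (if first j (\<lambda>i. \<xi> i w) then 1 else 0 :: real, \<Sum>i=j..<n. \<xi> i w)) -` ({1} \<times> {-x..x}) \<inter> space M)
      = prob ((\<lambda>w. if first j (\<lambda>i. \<xi> i w) then 1 else 0 :: real) -` {1} \<inter> space M)
        * prob ((\<lambda>w. \<Sum>i=j..<n. \<xi> i w) -` {-x..x} \<inter> space M)"
      by simp
    moreover have "(\<lambda>w. (if first j (\<lambda>i. \<xi> i w) then 1 else 0 :: real, \<Sum>i=j..<n. \<xi> i w)) -` ({1} \<times> {-x..x}) \<inter> space M = A j \<inter> B j"
      "(\<lambda>w. if first j (\<lambda>i. \<xi> i w) then 1 else 0 :: real) -` {1} \<inter> space M = A j"
      "(\<lambda>w. \<Sum>i=j..<n. \<xi> i w) -` {-x..x} \<inter> space M = B j"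
      by (auto simp: A_def B_def abs_le_iff split: if_splits)
    ultimately show ?thesis by simp
  qed
  have Bhalf: "prob (B j) \<ge> 1 / 2" if "j \<le> n" for j
  proof -
    have "{w\<in>space M. x < \<bar>\<Sum>i=j..<n. \<xi> i w\<bar>} = space M - B j" by (auto simp: B_def)
    then show ?thesis using small[OF that] prob_compl[OF B_sets[of j]] by simp
  qed
  have "{w\<in>space M. \<exists>j\<le>n. 2 * x < \<bar>\<Sum>i<j. \<xi> i w\<bar>} \<subseteq> (\<Union>j\<in>{..n}. A j)"
  proof safe
    fix w j assume "w \<in> space M" "j \<le> n" "2 * x < \<bar>\<Sum>i<j. \<xi> i w\<bar>"
    define j0 where "j0 = (LEAST j. 2 * x < \<bar>\<Sum>i<j. \<xi> i w\<bar>)"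
    have "2 * x < \<bar>\<Sum>i<j0. \<xi> i w\<bar>" unfolding j0_def by (rule LeastI) fact
    moreover have "j0 \<le> j" unfolding j0_def by (rule Least_le) fact
    moreover have "\<bar>\<Sum>l<i. \<xi> l w\<bar> \<le> 2 * x" if "i < j0" for i
      using not_less_Least[OF that[unfolded j0_def]] by simp
    ultimately have "w \<in> A j0" "j0 \<le> n"
      using \<open>w \<in> space M\<close> \<open>j \<le> n\<close> by (auto simp: A_def first_def)
    then show "w \<in> (\<Union>j\<in>{..n}. A j)" by blast
  qed
  then have "prob {w\<in>space M. \<exists>j\<le>n. 2 * x < \<bar>\<Sum>i<j. \<xi> i w\<bar>} \<le> prob (\<Union>j\<in>{..n}. A j)"
    by (rule finite_measure_mono) (use A_sets in auto)
  also have "... = (\<Sum>j\<in>{..n}. prob (A j))"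
    using A_sets disj by (intro finite_measure_finite_Union) auto
  also have "... \<le> (\<Sum>j\<in>{..n}. 2 * prob (A j \<inter> B j))"
  proof (rule sum_mono)
    fix j assume "j \<in> {..n}"
    then show "prob (A j) \<le> 2 * prob (A j \<inter> B j)"
      using AB[of j] mult_left_mono[OF Bhalf[of j], of "prob (A j)"] by simp
  qed
  also have "... = 2 * prob (\<Union>j\<in>{..n}. A j \<inter> B j)"
  proof -
    have "disjoint_family_on (\<lambda>j. A j \<inter> B j) {..n}"
      using disj unfolding disjoint_family_on_def by blast
    then have "prob (\<Union>j\<in>{..n}. A j \<inter> B j) = (\<Sum>j\<in>{..n}. prob (A j \<inter> B j))"
      using A_sets B_sets by (intro finite_measure_finite_Union) auto
    then show ?thesis by (simp add: sum_distrib_left)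
  qed
  also have "... \<le> 2 * prob {w\<in>space M. x < \<bar>\<Sum>i<n. \<xi> i w\<bar>}"
  proof (intro mult_left_mono finite_measure_mono)
    have [measurable]: "(\<lambda>w. \<Sum>i<n. \<xi> i w) \<in> borel_measurable M" by (intro S_meas) auto
    show "{w\<in>space M. x < \<bar>\<Sum>i<n. \<xi> i w\<bar>} \<in> sets M" by measurable
    show "(\<Union>j\<in>{..n}. A j \<inter> B j) \<subseteq> {w\<in>space M. x < \<bar>\<Sum>i<n. \<xi> i w\<bar>}"
    proof safe
      fix w j assume j: "j \<le> n" "w \<in> A j" "w \<in> B j"
      then show "w \<in> space M" by (simp add: A_def)
      have "(\<Sum>i<n. \<xi> i w) - (\<Sum>i<j. \<xi> i w) = (\<Sum>i=j..<n. \<xi> i w)" by (rule partial_sums_diff[OF j(1)])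
      then show "x < \<bar>\<Sum>i<n. \<xi> i w\<bar>" using j by (auto simp: A_def B_def first_def)
    qed
  qed auto
  finally show ?thesis .
qed

section \<open>Convergence of block sums\<close>

lemma tendsto_continuous_coordinates:
  fixes F :: "(nat \<Rightarrow> real) \<Rightarrow> real"
  assumes "continuous_on UNIV F" "\<And>i. (\<lambda>n. x n i) \<longlonglongrightarrow> y i"
  shows "(\<lambda>n. F (x n)) \<longlonglongrightarrow> F y"
proof -
  have "limitin (product_topology (\<lambda>_. euclidean) UNIV) x y sequentially"
    unfolding limitin_componentwise using assms(2) by simp
  then have "x \<longlonglongrightarrow> y" by (simp add: euclidean_product_topology)
  then show ?thesis
    using assms(1) by (intro continuous_on_tendsto_compose[of UNIV F]) auto
qed

text \<open>Under independence the joint law is the product of the marginals, so equal marginals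
  suffice, even on different probability spaces.\<close>

lemma expectation_eq_of_indep:
  fixes F :: "(nat \<Rightarrow> real) \<Rightarrow> real"
  assumes "prob_space M" "prob_space M'" "m \<ge> 1"
    and X: "prob_space.indep_vars M (\<lambda>_. borel) X {..<m}"
    and Y: "prob_space.indep_vars M' (\<lambda>_. borel) Y {..<m}"
    and eq: "\<And>k. k < m \<Longrightarrow> distr M borel (X k) = distr M' borel (Y k)"
    and F: "continuous_on UNIV F" "\<And>x y. (\<And>i. i < m \<Longrightarrow> x i = y i) \<Longrightarrow> F x = F y"
  shows "(\<integral>w. F (\<lambda>k. X k w) \<partial>M) = (\<integral>w. F (\<lambda>k. Y k w) \<partial>M')"
proof -
  let ?P = "PiM {..<m} (\<lambda>_. borel :: real measure)"
  \<comment> \<open>Elements of the finite product are \<open>undefined\<close> from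
    \<open>m\<close> on. \<open>G\<close> puts 0 there, which makes every coordinate measurable and
    does not change \<open>F\<close>.\<close>
  define G where "G x = F (\<lambda>i. if i < m then x i else 0)" for x
  have G: "G \<in> borel_measurable ?P"
    unfolding G_def
  proof (rule measurable_continuous_coordinates[OF F(1)])
    show "(\<lambda>x. if i < m then x i else 0) \<in> borel_measurable ?P" for i
      by (cases "i < m") auto
  qed
  have key: "(\<integral>w. F (\<lambda>k. X k w) \<partial>M) = integral\<^sup>L (PiM {..<m} (\<lambda>k. distr M borel (X k))) G"
    if "prob_space M" "prob_space.indep_vars M (\<lambda>_. borel) X {..<m}" for M :: "'c measure" and X
  proof -
    interpret prob_space M by fact
    have rv: "\<And>i. i \<in> {..<m} \<Longrightarrow> X i \<in> borel_measurable M" using that(2) by (auto simp: indep_vars_def)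
    have "0 \<in> {..<m}" using assms(3) by simp
    then have ne: "{..<m} \<noteq> {}" by blast
    have "distr M ?P (\<lambda>w. \<lambda>i\<in>{..<m}. X i w) = PiM {..<m} (\<lambda>k. distr M borel (X k))"
      using indep_vars_iff_distr_eq_PiM'[OF ne rv] that(2) by simp
    moreover have "integral\<^sup>L (distr M ?P (\<lambda>w. \<lambda>i\<in>{..<m}. X i w)) G = (\<integral>w. G (\<lambda>i\<in>{..<m}. X i w) \<partial>M)"
      by (rule integral_distr[OF measurable_restrict G]) (use rv in auto)
    moreover have "G (\<lambda>i\<in>{..<m}. X i w) = F (\<lambda>k. X k w)" for w
      unfolding G_def by (rule F(2)) simp
    ultimately show ?thesis by simp
  qed
  have "PiM {..<m} (\<lambda>k. distr M borel (X k)) = PiM {..<m} (\<lambda>k. distr M' borel (Y k))"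
    by (rule PiM_cong) (use eq in auto)
  then show ?thesis using key[OF assms(1) X] key[OF assms(2) Y] by simp
qed

lemma indep_vars_PiM_coordinates:
  assumes "\<And>k. k \<in> I \<Longrightarrow> prob_space (\<Omega> k)" "I \<noteq> {}" "\<And>k. k \<in> I \<Longrightarrow> f k \<in> measurable (\<Omega> k) N"
  shows "prob_space.indep_vars (PiM I \<Omega>) (\<lambda>_. N) (\<lambda>k w. f k (w k)) I"
proof -
  interpret P: prob_space "PiM I \<Omega>" by (rule prob_space_PiM) (use assms in auto)
  have "P.indep_vars \<Omega> (\<lambda>k w. w k) I"
  proof (subst P.indep_vars_iff_distr_eq_PiM')
    have "distr (PiM I \<Omega>) (PiM I \<Omega>) (\<lambda>x. \<lambda>i\<in>I. x i) = distr (PiM I \<Omega>) (PiM I \<Omega>) (\<lambda>x. x)"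
      by (rule distr_cong) (auto simp: space_PiM)
    also have "... = PiM I (\<lambda>i. distr (PiM I \<Omega>) (\<Omega> i) (\<lambda>w. w i))"
      using assms by (auto intro!: PiM_cong simp: distr_PiM_component)
    finally show "distr (PiM I \<Omega>) (PiM I \<Omega>) (\<lambda>x. \<lambda>i\<in>I. x i) = PiM I (\<lambda>i. distr (PiM I \<Omega>) (\<Omega> i) (\<lambda>w. w i))" .
  qed (use assms in auto)
  from P.indep_vars_compose2[OF this, of f "\<lambda>_. N"] show ?thesis using assms(3) by simp
qed

text \<open>Each of the two floors loses less than 1 and the losses have the same sign.\<close>

lemma block_length_bounds:
  assumes "m \<ge> 1"
  shows "\<bar>real (n * Suc k div m - n * k div m) - real n / real m\<bar> \<le> 1"
proof -
  have *: "real (a div m) \<le> real a / real m" "real a / real m < real (a div m) + 1" for a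
  proof -
    have "real (a div m) = of_int \<lfloor>real a / real m\<rfloor>" by (simp add: floor_divide_of_nat_eq)
    then show "real (a div m) \<le> real a / real m" "real a / real m < real (a div m) + 1" by linarith+
  qed
  have "real (n * Suc k) / real m = real (n * k) / real m + real n / real m"
    by (simp add: add_divide_distrib)
  then show ?thesis
    using *[of "n * Suc k"] *[of "n * k"] block_bounds[of n k m] by (simp add: of_nat_diff)
qed

lemma block_length_asymp:
  assumes "m \<ge> 1"
  shows "(\<lambda>n. real (n * Suc k div m - n * k div m) / real n) \<longlonglongrightarrow> 1 / real m"
    and "filterlim (\<lambda>n. n * Suc k div m - n * k div m) sequentially sequentially"
proof -
  let ?L = "\<lambda>n. n * Suc k div m - n * k div m"
  have "(\<lambda>n. 1 / real n) \<longlonglongrightarrow> 0" by (rule lim_const_over_n)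
  then have "(\<lambda>n. real (?L n) / real n - 1 / real m) \<longlonglongrightarrow> 0"
  proof (rule Lim_null_comparison[rotated], intro eventually_mono[OF eventually_gt_at_top[of 0]])
    fix n :: nat assume n: "0 < n"
    have "real (?L n) / real n - 1 / real m = (real (?L n) - real n / real m) / real n"
      using n by (simp add: diff_divide_distrib)
    then show "norm (real (?L n) / real n - 1 / real m) \<le> 1 / real n"
      using divide_right_mono[OF block_length_bounds[OF assms, of n k], of "real n"] n by simp
  qed
  then show "(\<lambda>n. real (?L n) / real n) \<longlonglongrightarrow> 1 / real m" by (simp add: LIM_zero_iff)
  show "filterlim ?L sequentially sequentially"
    unfolding filterlim_at_top
  proof
    fix Z
    have "\<forall>\<^sub>F n in sequentially. n \<ge> m * (Z + 1)" by (rule eventually_ge_at_top)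
    then show "\<forall>\<^sub>F n in sequentially. Z \<le> ?L n"
    proof eventually_elim
      case (elim n)
      have "real (m * (Z + 1)) \<le> real n" using elim by (simp only: of_nat_le_iff)
      then have "real Z + 1 \<le> real n / real m" using assms by (simp add: field_simps)
      then have "real Z \<le> real (?L n)" using block_length_bounds[OF assms, of n k] by linarith
      then show ?case by simp
    qed
  qed
qed

section \<open>Increments of the Wiener process on a grid\<close>

definition wiener_incr :: "(real \<Rightarrow> 'b \<Rightarrow> real) \<Rightarrow> nat \<Rightarrow> nat \<Rightarrow> 'b \<Rightarrow> real" where
  "wiener_incr W m k w = W (real (Suc k) / real m) w - W (real k / real m) w"

lemma wiener_incr_indep:
  assumes "wiener_process_01 N W" "m \<ge> 1"
  shows "prob_space.indep_vars N (\<lambda>_. borel) (wiener_incr W m) {..<m}"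
proof -
  have "unit_partition m (\<lambda>i. real i / real m)"
    using assms(2) by (auto simp: unit_partition_def field_simps)
  then show ?thesis
    using assms(1) unfolding wiener_process_01_def wiener_incr_def[abs_def] by blast
qed

lemma wiener_incr_distributed:
  assumes "wiener_process_01 N W" "m \<ge> 1" "k < m"
  shows "distributed N lborel (wiener_incr W m k) (normal_density 0 (sqrt (1 / real m)))"
proof -
  have "0 \<le> real k / real m" "real k / real m < real (Suc k) / real m" "real (Suc k) / real m \<le> 1"
    using assms by (auto simp: field_simps)
  then have "distributed N lborel (\<lambda>w. W (real (Suc k) / real m) w - W (real k / real m) w)
     (normal_density 0 (sqrt (real (Suc k) / real m - real k / real m)))"
    using assms(1) unfolding wiener_process_01_def by blast
  moreover have "real (Suc k) / real m - real k / real m = 1 / real m"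
    by (simp add: diff_divide_distrib[symmetric])
  ultimately show ?thesis by (simp add: wiener_incr_def[abs_def])
qed

lemma wiener_incr_measurable:
  assumes "wiener_process_01 N W" "m \<ge> 1" "k < m"
  shows "wiener_incr W m k \<in> borel_measurable N"
  using distributed_measurable[OF wiener_incr_distributed[OF assms]] by simp

text \<open>Expressed through the standard normal law, because the coupling of the block sums
  delivers its limit in that form.\<close>

lemma wiener_incr_distr:
  assumes "wiener_process_01 N W" "m \<ge> 1" "k < m"
  shows "distr N borel (\<lambda>w. c * wiener_incr W m k w) = distr std_normal_distribution borel (\<lambda>y. c / sqrt (real m) * y)"
proof -
  interpret N: prob_space N using assms by (simp add: wiener_process_01_def)
  note meas[measurable] = wiener_incr_measurable[OF assms]
  let ?Z = "\<lambda>w. (wiener_incr W m k w - 0) / sqrt (1 / real m)"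
  have "distributed N lborel ?Z std_normal_density"
    using wiener_incr_distributed[OF assms] assms(2)
    by (subst N.normal_standard_normal_convert[symmetric]) auto
  then have "distr N lborel ?Z = std_normal_distribution"
    by (rule distributed_distr_eq_density)
  then have eq: "distr N borel ?Z = std_normal_distribution"
    by (subst distr_cong[OF refl sets_lborel[symmetric] refl]) simp
  have "distr std_normal_distribution borel (\<lambda>y. c / sqrt (real m) * y)
      = distr N borel ((\<lambda>y. c / sqrt (real m) * y) \<circ> ?Z)"
    unfolding eq[symmetric] by (subst distr_distr) auto
  also have "(\<lambda>y. c / sqrt (real m) * y) \<circ> ?Z = (\<lambda>w. c * wiener_incr W m k w)"
    using assms(2) by (auto simp: fun_eq_iff real_sqrt_divide)
  finally show ?thesis ..
qed

section \<open>Gaussian limit of the block sums\<close>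

context iid_noise
begin

text \<open>The characteristic function of the sum is a power of a common one, with the cardinality
  as exponent. Hence a block has the law of an initial segment, to which the central limit theorem
  applies.\<close>

lemma distr_sum_eq:
  assumes "card I = card J"
  shows "distr M borel (\<lambda>w. \<Sum>i\<in>I. \<eta> i w) = distr M borel (\<lambda>w. \<Sum>i\<in>J. \<eta> i w)"
proof (rule Levy_uniqueness)
  show "real_distribution (distr M borel (\<lambda>w. \<Sum>i\<in>I. \<eta> i w))"
    "real_distribution (distr M borel (\<lambda>w. \<Sum>i\<in>J. \<eta> i w))"
    by (intro real_distribution_distr; measurable)+
  have "char (distr M borel (\<lambda>w. \<Sum>i\<in>I. \<eta> i w)) t = char (distr M borel (\<eta> 1)) t ^ card I" for t I
  proof -
    have "char (distr M borel (\<lambda>w. \<Sum>i\<in>I. \<eta> i w)) t = (\<Prod>i\<in>I. char (distr M borel (\<eta> i)) t)"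
      by (rule char_distr_sum[OF indep_vars_subset[OF indep]]) simp
    also have "... = (\<Prod>i\<in>I. char (distr M borel (\<eta> 1)) t)"
      by (intro prod.cong refl arg_cong[where f="\<lambda>D. char D t"] ident)
    finally show ?thesis by simp
  qed
  then show "char (distr M borel (\<lambda>w. \<Sum>i\<in>I. \<eta> i w)) = char (distr M borel (\<lambda>w. \<Sum>i\<in>J. \<eta> i w))"
    using assms by (simp add: fun_eq_iff)
qed

text \<open>With convergence at every point instead of in law, continuous functions of several
  independent copies can be treated by dominated convergence, and no multivariate limit theorem is
  called for.\<close>

lemma clt_coupling:
  obtains \<Omega> :: "real measure" and Y :: "nat \<Rightarrow> real \<Rightarrow> real" and Y0 :: "real \<Rightarrow> real"
  where "prob_space \<Omega>" "\<And>n. Y n \<in> borel_measurable \<Omega>" "Y0 \<in> borel_measurable \<Omega>"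
    "\<And>n. distr \<Omega> borel (Y n) = distr M borel (\<lambda>w. (\<Sum>i<n. \<eta> (int i + 1) w) / sqrt (real n * \<sigma>\<^sup>2))"
    "distr \<Omega> borel Y0 = std_normal_distribution"
    "\<And>x. x \<in> space \<Omega> \<Longrightarrow> (\<lambda>n. Y n x) \<longlonglongrightarrow> Y0 x"
proof -
  let ?\<mu> = "\<lambda>n. distr M borel (\<lambda>w. (\<Sum>i<n. \<eta> (int i + 1) w) / sqrt (real n * \<sigma>\<^sup>2))"
  have clt: "weak_conv_m ?\<mu> std_normal_distribution"
  proof (rule central_limit_theorem_zero_mean[OF _ _ sigma_pos, where \<mu>="distr M borel (\<eta> 1)"])
    show "distr M borel (\<eta> (int n + 1)) = distr M borel (\<eta> 1)" for n by (rule ident)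
    show "indep_vars (\<lambda>i. borel) (\<lambda>i. \<eta> (int i + 1)) UNIV"
      by (rule indep_vars_reindex_inj[OF indep]) (auto simp: inj_on_def)
  qed simp_all
  have rd: "real_distribution (?\<mu> n)" for n
    by (rule real_distribution_distr) measurable
  have sd: "real_distribution std_normal_distribution" by (rule real_dist_normal_dist)
  from Skorohod[OF rd sd clt] obtain \<Omega> :: "real measure" and Y Y0 where *: "prob_space \<Omega>" "\<forall>n. Y n \<in> measurable \<Omega> borel"
    "\<forall>n. distr \<Omega> borel (Y n) = ?\<mu> n" "Y0 \<in> measurable \<Omega> lborel" "distr \<Omega> borel Y0 = std_normal_distribution"
    "\<forall>x\<in>space \<Omega>. (\<lambda>n. Y n x) \<longlonglongrightarrow> Y0 x"
    by blast
  show thesis by (rule that[of \<Omega> Y Y0]) (use * in auto)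
qed

text \<open>The index \<open>int i + 1\<close> matches increments counted from 0 with innovations
  counted from 1.\<close>

definition noise :: "nat \<Rightarrow> nat \<Rightarrow> 'a \<Rightarrow> real" where
  "noise n i w = real n powr (-1/2) * \<eta> (int i + 1) w"

definition noise_block :: "nat \<Rightarrow> nat \<Rightarrow> nat \<Rightarrow> 'a \<Rightarrow> real" where
  "noise_block n m k w = block_sums m n (\<lambda>i. noise n i w) k"

lemma noise_measurable [measurable]: "noise n i \<in> borel_measurable M"
  unfolding noise_def by measurable

lemma noise_block_measurable [measurable]: "noise_block n m k \<in> borel_measurable M"
  unfolding noise_block_def block_sums_def by measurable

abbreviation shifted_block :: "nat \<Rightarrow> nat \<Rightarrow> nat \<Rightarrow> int set" where
  "shifted_block n m k \<equiv> (\<lambda>i. int i + 1) ` {n * k div m..<n * Suc k div m}"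

lemma noise_block_eq: "noise_block n m k w = real n powr (-1/2) * (\<Sum>j\<in>shifted_block n m k. \<eta> j w)"
  by (subst sum.reindex) (auto simp: inj_on_def noise_block_def block_sums_def noise_def sum_distrib_left)

lemma indep_noise_block: "indep_vars (\<lambda>_. borel) (noise_block n m) {..<m}"
proof -
  have disj: "disjoint_family_on (shifted_block n m) {..<m}"
  proof -
    have "shifted_block n m k \<inter> shifted_block n m l = {}" if "k < l" for k l
    proof -
      have "n * Suc k div m \<le> n * l div m" using that by (intro div_le_mono mult_le_mono) auto
      then show ?thesis by auto
    qed
    then show ?thesis unfolding disjoint_family_on_def by (metis Int_commute nat_neq_iff)
  qed
  have "indep_vars (\<lambda>k. PiM (shifted_block n m k) (\<lambda>_. borel)) (\<lambda>k w. restrict (\<lambda>j. \<eta> j w) (shifted_block n m k)) {..<m}"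
    using disj by (intro indep_vars_restrict[OF indep]) auto
  from indep_vars_compose2[OF this, of "\<lambda>k x. real n powr (-1/2) * (\<Sum>j\<in>shifted_block n m k. x j)" "\<lambda>_. borel"]
  have "indep_vars (\<lambda>_. borel) (\<lambda>k w. real n powr (-1/2) * (\<Sum>j\<in>shifted_block n m k. restrict (\<lambda>j. \<eta> j w) (shifted_block n m k) j)) {..<m}"
    by (simp del: restrict_apply)
  also have "(\<lambda>k w. real n powr (-1/2) * (\<Sum>j\<in>shifted_block n m k. restrict (\<lambda>j. \<eta> j w) (shifted_block n m k) j)) = noise_block n m"
    by (intro ext) (simp only: noise_block_eq restrict_apply, intro arg_cong2[where f=times] sum.cong refl, simp)
  finally show ?thesis .
qed

lemma powr_minus_half: "n > 0 \<Longrightarrow> real n powr (-1/2) = 1 / sqrt (real n)"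
  by (simp add: powr_half_sqrt[symmetric] powr_minus_divide)

text \<open>A block is a standardised sum of its own length \<open>L\<close> times a deterministic
  factor, and that factor converges as \<open>n\<close> grows. An empty block is 0 on both
  sides.\<close>

lemma distr_noise_block:
  fixes k n m :: nat
  defines "L \<equiv> n * Suc k div m - n * k div m"
  assumes "n > 0"
  shows "distr M borel (noise_block n m k) = distr (distr M borel (\<lambda>w. (\<Sum>i<L. \<eta> (int i + 1) w) / sqrt (real L * \<sigma>\<^sup>2))) borel
    (\<lambda>y. \<sigma> * sqrt (real L / real n) * y)"
proof -
  have card: "card (shifted_block n m k) = card ((\<lambda>i. int i + 1) ` {..<L})"
    by (subst (1 2) card_image) (auto simp: inj_on_def L_def)
  have "distr M borel (noise_block n m k) = distr (distr M borel (\<lambda>w. \<Sum>j\<in>shifted_block n m k. \<eta> j w)) borel (\<lambda>y. real n powr (-1/2) * y)"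
    by (subst distr_distr) (auto simp: comp_def noise_block_eq[abs_def])
  also have "... = distr (distr M borel (\<lambda>w. \<Sum>j\<in>(\<lambda>i. int i + 1) ` {..<L}. \<eta> j w)) borel (\<lambda>y. real n powr (-1/2) * y)"
    unfolding distr_sum_eq[OF card] ..
  also have "... = distr M borel (\<lambda>w. real n powr (-1/2) * (\<Sum>j\<in>(\<lambda>i. int i + 1) ` {..<L}. \<eta> j w))"
    by (subst distr_distr) (auto simp: comp_def)
  also have "... = distr M borel (\<lambda>w. \<sigma> * sqrt (real L / real n) * ((\<Sum>i<L. \<eta> (int i + 1) w) / sqrt (real L * \<sigma>\<^sup>2)))"
  proof -
    have "real n powr (-1/2) * (\<Sum>j\<in>(\<lambda>i. int i + 1) ` {..<L}. \<eta> j w)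
       = \<sigma> * sqrt (real L / real n) * ((\<Sum>i<L. \<eta> (int i + 1) w) / sqrt (real L * \<sigma>\<^sup>2))" for w
    proof -
      have S: "(\<Sum>j\<in>(\<lambda>i. int i + 1) ` {..<L}. \<eta> j w) = (\<Sum>i<L. \<eta> (int i + 1) w)"
        by (subst sum.reindex) (auto simp: inj_on_def)
      show ?thesis
      proof (cases "L = 0")
        case False
        then show ?thesis
          unfolding S powr_minus_half[OF assms(2)] using sigma_pos by (simp add: real_sqrt_divide real_sqrt_mult)
      qed simp
    qed
    then show ?thesis by simp
  qed
  also have "... = distr (distr M borel (\<lambda>w. (\<Sum>i<L. \<eta> (int i + 1) w) / sqrt (real L * \<sigma>\<^sup>2))) borel
    (\<lambda>y. \<sigma> * sqrt (real L / real n) * y)"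
    by (subst distr_distr) (auto simp: comp_def)
  finally show ?thesis .
qed

text \<open>On the product of \<open>m\<close> copies of the coupling space, coordinate
  \<open>k\<close> represents block \<open>k\<close> through the variable belonging to its length.
  The laws agree for every positive \<open>n\<close>, and the representatives converge
  pointwise.\<close>

lemma finite_dim_convergence:
  fixes F :: "(nat \<Rightarrow> real) \<Rightarrow> real" and N :: "'b measure"
  assumes W: "wiener_process_01 N W" and m: "m \<ge> 1"
    and F: "continuous_on UNIV F" "\<And>x y. (\<And>i. i < m \<Longrightarrow> x i = y i) \<Longrightarrow> F x = F y" "\<And>x. \<bar>F x\<bar> \<le> B"
  shows "(\<lambda>n. expectation (\<lambda>w. F (\<lambda>k. noise_block n m k w))) \<longlonglongrightarrow> (\<integral>w. F (\<lambda>k. \<sigma> * wiener_incr W m k w) \<partial>N)"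
proof -
  interpret N: prob_space N using W by (simp add: wiener_process_01_def)
  obtain \<Omega> :: "real measure" and Y :: "nat \<Rightarrow> real \<Rightarrow> real" and Y0 :: "real \<Rightarrow> real"
    where \<Omega>: "prob_space \<Omega>" and [measurable]: "\<And>n. Y n \<in> borel_measurable \<Omega>" "Y0 \<in> borel_measurable \<Omega>"
    and Yd: "\<And>n. distr \<Omega> borel (Y n) = distr M borel (\<lambda>w. (\<Sum>i<n. \<eta> (int i + 1) w) / sqrt (real n * \<sigma>\<^sup>2))"
    and Y0d: "distr \<Omega> borel Y0 = std_normal_distribution"
    and Ylim: "\<And>x. x \<in> space \<Omega> \<Longrightarrow> (\<lambda>n. Y n x) \<longlonglongrightarrow> Y0 x"
    using clt_coupling by blast
  let ?P = "PiM {..<m} (\<lambda>_. \<Omega>)"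
  interpret P: prob_space ?P by (rule prob_space_PiM) (rule \<Omega>)
  have "0 \<in> {..<m}" using m by simp
  then have ne: "{..<m} \<noteq> {}" by blast
  have marg: "distr ?P borel (\<lambda>w. f (w k)) = distr \<Omega> borel f" if "k < m" "f \<in> borel_measurable \<Omega>" for f :: "real \<Rightarrow> real" and k
  proof -
    have "distr ?P borel (\<lambda>w. f (w k)) = distr (distr ?P \<Omega> (\<lambda>w. w k)) borel f"
      using that by (subst distr_distr) (auto simp: comp_def)
    also have "distr ?P \<Omega> (\<lambda>w. w k) = \<Omega>"
      using \<Omega> that by (intro distr_PiM_component) auto
    finally show ?thesis .
  qed
  define L where "L n k = n * Suc k div m - n * k div m" for n k
  define c where "c n k = \<sigma> * sqrt (real (L n k) / real n)" for n k
  \<comment> \<open>Coordinates from \<open>m\<close> on are set to 0, so that the whole sequence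
    converges in the product topology; \<open>F\<close> does not see them.\<close>
  define u where "u n w k = (if k < m then c n k * Y (L n k) (w k) else 0)" for n k and w :: "nat \<Rightarrow> real"
  define v where "v w k = (if k < m then \<sigma> / sqrt (real m) * Y0 (w k) else 0)" for k and w :: "nat \<Rightarrow> real"
  have u_meas: "(\<lambda>w. u n w k) \<in> borel_measurable ?P" for n k
    unfolding u_def by (cases "k < m") auto
  have v_meas: "(\<lambda>w. v w k) \<in> borel_measurable ?P" for k
    unfolding v_def by (cases "k < m") auto
  have E1: "expectation (\<lambda>w. F (\<lambda>k. noise_block n m k w)) = (\<integral>w. F (u n w) \<partial>?P)" if "n > 0" for n
  proof -
    have "expectation (\<lambda>w. F (\<lambda>k. noise_block n m k w)) = (\<integral>w. F (\<lambda>k. c n k * Y (L n k) (w k)) \<partial>?P)"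
    proof (rule expectation_eq_of_indep[OF prob_space_axioms P.prob_space_axioms m indep_noise_block _ _ F(1,2)])
      show "P.indep_vars (\<lambda>_. borel) (\<lambda>k w. c n k * Y (L n k) (w k)) {..<m}"
        by (rule indep_vars_PiM_coordinates[where f="\<lambda>k y. c n k * Y (L n k) y", OF _ ne]) (auto intro: \<Omega>)
      fix k assume k: "k < m"
      have "distr ?P borel (\<lambda>w. c n k * Y (L n k) (w k)) = distr \<Omega> borel (\<lambda>y. c n k * Y (L n k) y)"
        by (rule marg[OF k]) measurable
      also have "... = distr (distr \<Omega> borel (Y (L n k))) borel (\<lambda>y. c n k * y)"
        by (subst distr_distr) (auto simp: comp_def)
      also have "... = distr M borel (noise_block n m k)"
        unfolding Yd using distr_noise_block[OF that, of m k] by (simp add: L_def c_def)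
      finally show "distr M borel (noise_block n m k) = distr ?P borel (\<lambda>w. c n k * Y (L n k) (w k))" ..
    qed auto
    also have "... = (\<integral>w. F (u n w) \<partial>?P)"
      by (intro Bochner_Integration.integral_cong refl F(2)) (simp add: u_def)
    finally show ?thesis .
  qed
  have E2: "(\<integral>w. F (\<lambda>k. \<sigma> * wiener_incr W m k w) \<partial>N) = (\<integral>w. F (v w) \<partial>?P)"
  proof -
    have "(\<integral>w. F (\<lambda>k. \<sigma> * wiener_incr W m k w) \<partial>N) = (\<integral>w. F (\<lambda>k. \<sigma> / sqrt (real m) * Y0 (w k)) \<partial>?P)"
    proof (rule expectation_eq_of_indep[OF N.prob_space_axioms P.prob_space_axioms m _ _ _ F(1,2)])
      show "N.indep_vars (\<lambda>_. borel) (\<lambda>k w. \<sigma> * wiener_incr W m k w) {..<m}"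
        by (rule N.indep_vars_compose2[OF wiener_incr_indep[OF W m]]) auto
      show "P.indep_vars (\<lambda>_. borel) (\<lambda>k w. \<sigma> / sqrt (real m) * Y0 (w k)) {..<m}"
        by (rule indep_vars_PiM_coordinates[where f="\<lambda>k y. \<sigma> / sqrt (real m) * Y0 y", OF _ ne]) (auto intro: \<Omega>)
      fix k assume k: "k < m"
      have "distr ?P borel (\<lambda>w. \<sigma> / sqrt (real m) * Y0 (w k)) = distr \<Omega> borel (\<lambda>y. \<sigma> / sqrt (real m) * Y0 y)"
        by (rule marg[OF k]) measurable
      also have "... = distr (distr \<Omega> borel Y0) borel (\<lambda>y. \<sigma> / sqrt (real m) * y)"
        by (subst distr_distr) (auto simp: comp_def)
      finally show "distr N borel (\<lambda>w. \<sigma> * wiener_incr W m k w) = distr ?P borel (\<lambda>w. \<sigma> / sqrt (real m) * Y0 (w k))"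
        unfolding Y0d wiener_incr_distr[OF W m k] ..
    qed auto
    also have "... = (\<integral>w. F (v w) \<partial>?P)"
      by (intro Bochner_Integration.integral_cong refl F(2)) (simp add: v_def)
    finally show ?thesis .
  qed
  have "(\<lambda>n. \<integral>w. F (u n w) \<partial>?P) \<longlonglongrightarrow> (\<integral>w. F (v w) \<partial>?P)"
  proof (rule integral_dominated_convergence[where w="\<lambda>_. B"])
    show "(\<lambda>w. F (v w)) \<in> borel_measurable ?P"
      by (rule measurable_continuous_coordinates[OF F(1), of "\<lambda>k w. v w k"]) (rule v_meas)
    show "(\<lambda>w. F (u n w)) \<in> borel_measurable ?P" for n
      by (rule measurable_continuous_coordinates[OF F(1), of "\<lambda>k w. u n w k"]) (rule u_meas)
    show "AE w in ?P. (\<lambda>n. F (u n w)) \<longlonglongrightarrow> F (v w)"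
    proof (intro AE_I2 tendsto_continuous_coordinates[OF F(1)])
      fix w k assume w: "w \<in> space ?P"
      show "(\<lambda>n. u n w k) \<longlonglongrightarrow> v w k"
      proof (cases "k < m")
        case True
        then have "w k \<in> space \<Omega>" using w by (auto simp: space_PiM)
        then have 1: "(\<lambda>n. Y (L n k) (w k)) \<longlonglongrightarrow> Y0 (w k)"
          unfolding L_def by (intro filterlim_compose[OF Ylim block_length_asymp(2)[OF m]])
        have "(\<lambda>n. c n k) \<longlonglongrightarrow> \<sigma> * sqrt (1 / real m)"
          unfolding c_def L_def by (intro tendsto_mult tendsto_const tendsto_real_sqrt block_length_asymp(1)[OF m])
        then have "(\<lambda>n. c n k) \<longlonglongrightarrow> \<sigma> / sqrt (real m)" by (simp add: real_sqrt_divide)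
        from tendsto_mult[OF this 1] show ?thesis using True by (simp add: u_def v_def)
      qed (simp add: u_def v_def)
    qed
    show "AE w in ?P. norm (F (u n w)) \<le> B" for n using F(3) by simp
  qed auto
  then show ?thesis
    unfolding E2 by (rule Lim_transform_eventually) (use E1 in \<open>auto intro!: eventually_mono[OF eventually_gt_at_top[of 0]]\<close>)
qed

text \<open>The innovations have only second moments, so the fourth-power bound is taken from the
  Gaussian limit. The factor \<open>m^2\<close> in the denominator is what survives a union over
  \<open>m\<close> blocks.\<close>

lemma noise_block_tail:
  assumes W: "wiener_process_01 N W" and m: "m \<ge> 1" and k: "k < m" and x: "x > 0"
  shows "\<forall>\<^sub>F n in sequentially. prob {w\<in>space M. x < \<bar>noise_block n m k w\<bar>} \<le> 4 * \<sigma> ^ 4 / (real m ^ 2 * x ^ 4)"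
proof -
  interpret N: prob_space N using W by (simp add: wiener_process_01_def)
  \<comment> \<open>The cap at 1 makes \<open>F\<close> bounded, as convergence in law requires, and
    still leaves it above the indicator of \<open>x < \<bar>y k\<bar>\<close>.\<close>
  define F where "F y = min 1 ((y k / x) ^ 4)" for y :: "nat \<Rightarrow> real"
  have F: "continuous_on UNIV F" unfolding F_def
    using x by (intro continuous_on_min continuous_on_const continuous_on_power continuous_on_divide) auto
  have F01: "0 \<le> F y" "F y \<le> 1" for y by (auto simp: F_def)
  have lim: "(\<lambda>n. expectation (\<lambda>w. F (\<lambda>k. noise_block n m k w))) \<longlonglongrightarrow> (\<integral>w. F (\<lambda>k. \<sigma> * wiener_incr W m k w) \<partial>N)"
    by (rule finite_dim_convergence[OF W m F, of 1]) (use k F01 in \<open>auto simp: F_def\<close>)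
  note wm[measurable] = wiener_incr_measurable[OF W m k]
  note D = wiener_incr_distributed[OF W m k]
  have mom: "has_bochner_integral lborel (\<lambda>y. normal_density 0 (sqrt (1 / real m)) y * y ^ 4) (3 / real m ^ 2)"
    using normal_moment_even[of "sqrt (1 / real m)" 0 2] m
    by (simp add: fact_numeral power2_eq_square field_simps)
  have int4: "integrable N (\<lambda>w. wiener_incr W m k w ^ 4)"
    using mom distributed_integrable[OF D, of "\<lambda>y. y ^ 4"] by (auto simp: has_bochner_integral_iff)
  have exp4: "(\<integral>w. wiener_incr W m k w ^ 4 \<partial>N) = 3 / real m ^ 2"
    using mom distributed_integral[OF D, of "\<lambda>y. y ^ 4"] by (auto simp: has_bochner_integral_iff)
  have "(\<integral>w. F (\<lambda>k. \<sigma> * wiener_incr W m k w) \<partial>N) \<le> (\<integral>w. (\<sigma> / x) ^ 4 * wiener_incr W m k w ^ 4 \<partial>N)"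
  proof (rule integral_mono)
    show "integrable N (\<lambda>w. F (\<lambda>k. \<sigma> * wiener_incr W m k w))"
      by (rule N.integrable_const_bound[of _ 1]) (use F01 in \<open>auto simp: F_def\<close>)
    show "integrable N (\<lambda>w. (\<sigma> / x) ^ 4 * wiener_incr W m k w ^ 4)" using int4 by simp
    show "F (\<lambda>k. \<sigma> * wiener_incr W m k w) \<le> (\<sigma> / x) ^ 4 * wiener_incr W m k w ^ 4" for w
      by (simp add: F_def power_mult_distrib power_divide)
  qed
  also have "... = 3 * \<sigma> ^ 4 / (real m ^ 2 * x ^ 4)" by (simp add: exp4 power_divide)
  \<comment> \<open>The Gaussian fourth moment has the constant 3; 4 leaves the strict room needed
    for the bound to hold for all large \<open>n\<close>.\<close>
  also have "... < 4 * \<sigma> ^ 4 / (real m ^ 2 * x ^ 4)"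
    using m x sigma_pos by (intro divide_strict_right_mono mult_strict_right_mono) auto
  finally have "\<forall>\<^sub>F n in sequentially. expectation (\<lambda>w. F (\<lambda>k. noise_block n m k w)) < 4 * \<sigma> ^ 4 / (real m ^ 2 * x ^ 4)"
    by (rule order_tendstoD(2)[OF lim])
  then show ?thesis
  proof eventually_elim
    case (elim n)
    have "prob {w\<in>space M. x < \<bar>noise_block n m k w\<bar>} = expectation (indicator {w\<in>space M. x < \<bar>noise_block n m k w\<bar>})"
      by simp
    also have "... \<le> expectation (\<lambda>w. F (\<lambda>k. noise_block n m k w))"
    proof (rule integral_mono)
      show "integrable M (indicator {w\<in>space M. x < \<bar>noise_block n m k w\<bar>} :: 'a \<Rightarrow> real)"
        by (rule integrable_const_bound[of _ 1]) auto
      show "integrable M (\<lambda>w. F (\<lambda>k. noise_block n m k w))"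
        by (rule integrable_const_bound[of _ 1]) (use F01 in \<open>auto simp: F_def\<close>)
      fix w
      show "indicator {w\<in>space M. x < \<bar>noise_block n m k w\<bar>} w \<le> F (\<lambda>k. noise_block n m k w)"
      proof (cases "x < \<bar>noise_block n m k w\<bar>")
        case True
        then have "1 \<le> \<bar>noise_block n m k w / x\<bar> ^ 4" using x by (intro one_le_power) auto
        then have "1 \<le> (noise_block n m k w / x) ^ 4" by (simp only: power_even_abs even_numeral)
        then show ?thesis by (auto simp: F_def split: split_indicator)
      qed (auto simp: F01)
    qed
    finally show ?case using elim by simp
  qed
qed

section \<open>Oscillations of the noise inside the blocks\<close>

definition noise_osc :: "nat \<Rightarrow> nat \<Rightarrow> real \<Rightarrow> 'a set" where
  "noise_osc n m x = (\<Union>k\<in>{..<m}. \<Union>j\<in>{n * k div m..n * Suc k div m}.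
     {w\<in>space M. 2 * x < \<bar>\<Sum>i=n * k div m..<j. noise n i w\<bar>})"

lemma noise_osc_sets [measurable]: "noise_osc n m x \<in> sets M"
  unfolding noise_osc_def by (intro sets.finite_UN) auto

text \<open>Ottaviani's inequality needs a bound for all tails of a block at once, hence one that is
  uniform in the length. The exponent 3 is an arbitrary choice above 2.\<close>

lemma noise_sum_markov:
  assumes "x > 0" "inj_on f {..<l}"
  shows "prob {w\<in>space M. x < \<bar>\<Sum>i<l. \<eta> (f i) w\<bar>} \<le> lepingle_const 3 * \<sigma> * sqrt (real l) / x"
proof -
  let ?X = "\<lambda>w. step_norm 3 l (\<lambda>i. \<eta> (f i) w)"
  have int: "integrable M ?X" by (intro integrable_Wp_norm_step_path) auto
  have [measurable]: "?X \<in> borel_measurable M" using int by simp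
  have le: "\<bar>\<Sum>i<l. \<eta> (f i) w\<bar> \<le> ?X w" for w
    using abs_le_Wp_norm[OF step_path_fin[of 3], of 1 l "\<lambda>i. \<eta> (f i) w"] by (simp add: step_path_def)
  have "prob {w\<in>space M. x < \<bar>\<Sum>i<l. \<eta> (f i) w\<bar>} \<le> prob {w\<in>space M. x \<le> ?X w}"
    by (rule finite_measure_mono) (use le in \<open>auto intro: order_trans less_imp_le\<close>)
  also have "... \<le> expectation ?X / x"
    using integral_Markov_inequality_measure[OF int, of "space M" x] assms(1) by (auto simp: Wp_norm_nonneg)
  also have "... \<le> lepingle_const 3 * \<sigma> * sqrt (real l) / x"
    using expectation_Wp_norm_noise_le[of 3 f l] assms by (intro divide_right_mono) auto
  finally show ?thesis .
qed

text \<open>Ottaviani's inequality reduces the oscillation inside a block to the tail of the block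
  sum; its hypothesis holds as soon as the blocks are short, that is, for large
  \<open>m\<close>.\<close>

lemma prob_noise_osc_le:
  assumes W: "wiener_process_01 N W" and x: "x > 0"
  shows "\<exists>m0\<ge>1. \<forall>m\<ge>m0. \<forall>\<^sub>F n in sequentially. prob (noise_osc n m x) \<le> 8 * \<sigma> ^ 4 / (real m * x ^ 4)"
proof -
  define C where "C = lepingle_const 3 * \<sigma>"
  have C: "C > 0" using lepingle_const_pos[of 3] sigma_pos by (simp add: C_def)
  \<comment> \<open>The bound 1/2 in Ottaviani's inequality follows from
    \<open>Q * (L / n) \<le> 1\<close>, where \<open>L\<close> is the block length; since
    \<open>L / n \<le> 2 / m\<close>, it suffices that \<open>2 * Q \<le> m\<close>.\<close>
  define Q where "Q = (2 * C / x)\<^sup>2"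
  define m0 where "m0 = nat \<lceil>2 * Q\<rceil> + 1"
  have "\<forall>\<^sub>F n in sequentially. prob (noise_osc n m x) \<le> 8 * \<sigma> ^ 4 / (real m * x ^ 4)" if m: "m \<ge> m0" for m
  proof -
    have m1: "m \<ge> 1" using m by (simp add: m0_def)
    have "2 * Q \<le> real m0" unfolding m0_def by linarith
    also have "... \<le> real m" using m by simp
    finally have m2: "(2 * C / x)\<^sup>2 * (2 / real m) \<le> 1" using m1 unfolding Q_def[symmetric] by simp
    have "\<forall>\<^sub>F n in sequentially. \<forall>k\<in>{..<m}. prob {w\<in>space M. x < \<bar>noise_block n m k w\<bar>} \<le> 4 * \<sigma> ^ 4 / (real m ^ 2 * x ^ 4)"
      using noise_block_tail[OF W m1 _ x] by (intro eventually_ball_finite) auto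
    then show ?thesis using eventually_ge_at_top[of m]
    proof eventually_elim
      case (elim n)
      have n: "n > 0" using elim m1 by simp
      have block: "prob (\<Union>j\<in>{n * k div m..n * Suc k div m}. {w\<in>space M. 2 * x < \<bar>\<Sum>i=n * k div m..<j. noise n i w\<bar>})
        \<le> 8 * \<sigma> ^ 4 / (real m ^ 2 * x ^ 4)" if k: "k < m" for k
      proof -
        define a where "a = n * k div m"
        define L where "L = n * Suc k div m - a"
        have b: "n * Suc k div m = a + L" using block_bounds[of n k m] by (simp add: a_def L_def)
        have L_le: "real L / real n \<le> 2 / real m"
        proof -
          have "real L \<le> real n / real m + 1" using block_length_bounds[OF m1, of n k] by (simp add: L_def a_def)
          \<comment> \<open>For \<open>n \<ge> m\<close> the rounding error 1 is at most
            \<open>n / m\<close>.\<close>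
          also have "... \<le> 2 * real n / real m" using elim(2) m1 by (simp add: field_simps)
          finally show ?thesis using n m1 by (simp add: field_simps)
        qed
        define \<xi> where "\<xi> i = noise n (a + i)" for i
        have shift: "(\<Sum>i=a + l..<a + l'. noise n i w) = (\<Sum>i=l..<l'. \<xi> i w)" for l l' w
          unfolding \<xi>_def using sum.shift_bounds_nat_ivl[of "\<lambda>i. noise n i w" l a l'] by (simp add: add.commute)
        have \<xi>_eq: "\<xi> i w = real n powr (-1/2) * \<eta> (int (a + i) + 1) w" for i w by (simp add: \<xi>_def noise_def)
        have ind: "indep_vars (\<lambda>_. borel) \<xi> {..<L}"
        proof -
          have "indep_vars (\<lambda>_. borel) (\<lambda>i. \<eta> (int (a + i) + 1)) {..<L}"
            by (rule indep_vars_reindex_inj[OF indep]) (auto simp: inj_on_def)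
          from indep_vars_compose2[OF this, of "\<lambda>_ y. real n powr (-1/2) * y" "\<lambda>_. borel"]
          show ?thesis unfolding \<xi>_eq[abs_def] by simp
        qed
        have small: "prob {w\<in>space M. x < \<bar>\<Sum>i=j..<L. \<xi> i w\<bar>} \<le> 1 / 2" if "j \<le> L" for j
        proof -
          have eq: "(\<Sum>i=j..<L. \<xi> i w) = 1 / sqrt (real n) * (\<Sum>i<L - j. \<eta> (int (a + j + i) + 1) w)" for w
            unfolding \<xi>_eq powr_minus_half[OF n] sum_distrib_left[symmetric]
            using sum.shift_bounds_nat_ivl[of "\<lambda>i. \<eta> (int (a + i) + 1) w" 0 j "L - j"] that
            by (simp add: atLeast0LessThan ac_simps)
          have "prob {w\<in>space M. x < \<bar>\<Sum>i=j..<L. \<xi> i w\<bar>}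
              = prob {w\<in>space M. x * sqrt (real n) < \<bar>\<Sum>i<L - j. \<eta> (int (a + j + i) + 1) w\<bar>}"
            unfolding eq abs_mult using n by (simp add: field_simps)
          also have "... \<le> C * sqrt (real (L - j)) / (x * sqrt (real n))"
            unfolding C_def using x n by (intro noise_sum_markov) (auto simp: inj_on_def)
          also have "... \<le> C * sqrt (real L) / (x * sqrt (real n))"
            using x C by (intro divide_right_mono mult_left_mono) auto
          also have "... = (1 / 2) * sqrt ((2 * C / x)\<^sup>2 * (real L / real n))"
            using x C by (simp add: real_sqrt_mult real_sqrt_divide)
          also have "... \<le> (1 / 2) * sqrt ((2 * C / x)\<^sup>2 * (2 / real m))"
            using L_le by (intro mult_left_mono real_sqrt_le_mono) auto
          also have "... \<le> (1 / 2) * 1" using m2 by (intro mult_left_mono) auto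
          finally show ?thesis by simp
        qed
        have "prob (\<Union>j\<in>{a..a + L}. {w\<in>space M. 2 * x < \<bar>\<Sum>i=a..<j. noise n i w\<bar>})
            = prob {w\<in>space M. \<exists>j\<le>L. 2 * x < \<bar>\<Sum>i<j. \<xi> i w\<bar>}"
        proof (intro arg_cong[where f=prob] set_eqI iffI)
          fix w assume "w \<in> (\<Union>j\<in>{a..a + L}. {w\<in>space M. 2 * x < \<bar>\<Sum>i=a..<j. noise n i w\<bar>})"
          then obtain j where j: "a \<le> j" "j \<le> a + L" "w \<in> space M" "2 * x < \<bar>\<Sum>i=a..<j. noise n i w\<bar>" by auto
          then show "w \<in> {w\<in>space M. \<exists>j\<le>L. 2 * x < \<bar>\<Sum>i<j. \<xi> i w\<bar>}"
            using shift[of w 0 "j - a"] by (auto intro!: exI[of _ "j - a"] simp: atLeast0LessThan)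
        next
          fix w assume "w \<in> {w\<in>space M. \<exists>j\<le>L. 2 * x < \<bar>\<Sum>i<j. \<xi> i w\<bar>}"
          then obtain j where j: "j \<le> L" "w \<in> space M" "2 * x < \<bar>\<Sum>i<j. \<xi> i w\<bar>" by auto
          then show "w \<in> (\<Union>j\<in>{a..a + L}. {w\<in>space M. 2 * x < \<bar>\<Sum>i=a..<j. noise n i w\<bar>})"
            using shift[of w 0 j] by (auto intro!: bexI[of _ "a + j"] simp: atLeast0LessThan)
        qed
        also have "... \<le> 2 * prob {w\<in>space M. x < \<bar>\<Sum>i<L. \<xi> i w\<bar>}"
          by (rule ottaviani[OF ind small])
        also have "{w\<in>space M. x < \<bar>\<Sum>i<L. \<xi> i w\<bar>} = {w\<in>space M. x < \<bar>noise_block n m k w\<bar>}"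
        proof -
          have "noise_block n m k w = (\<Sum>i<L. \<xi> i w)" for w
            using shift[of w 0 L] unfolding noise_block_def block_sums_def b
            by (simp add: a_def[symmetric] atLeast0LessThan)
          then show ?thesis by simp
        qed
        also have "2 * prob ... \<le> 2 * (4 * \<sigma> ^ 4 / (real m ^ 2 * x ^ 4))"
          using elim(1) k by (intro mult_left_mono) auto
        finally show ?thesis unfolding b a_def[symmetric] by simp
      qed
      have "prob (noise_osc n m x) \<le> (\<Sum>k\<in>{..<m}. prob (\<Union>j\<in>{n * k div m..n * Suc k div m}.
          {w\<in>space M. 2 * x < \<bar>\<Sum>i=n * k div m..<j. noise n i w\<bar>}))"
        unfolding noise_osc_def by (intro finite_measure_subadditive_finite) (auto intro!: sets.finite_UN)
      also have "... \<le> (\<Sum>k\<in>{..<m}. 8 * \<sigma> ^ 4 / (real m ^ 2 * x ^ 4))"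
        by (intro sum_mono block) auto
      also have "... = 8 * \<sigma> ^ 4 / (real m * x ^ 4)" using m1 by (simp add: power2_eq_square)
      finally show ?case .
    qed
  qed
  then show ?thesis by (intro exI[of _ m0]) (simp add: m0_def)
qed

end

section \<open>Step approximation of the Wiener process\<close>

lemma Wp_norm_diff_le:
  assumes "p \<ge> 1" "p_variation p f < \<infinity>" "p_variation p g < \<infinity>"
  shows "Wp_norm p (\<lambda>t. f t - g t) \<le> Wp_norm p f + Wp_norm p g"
proof -
  have "p_variation p (\<lambda>t. (-1) * g t) < \<infinity>" using assms by (simp add: p_variation_uminus)
  from Wp_norm_triangle[OF assms(1,2) this] Wp_norm_scale[OF assms(1), of "-1" g] show ?thesis by simp
qed

lemma floor_grid_bounds:
  assumes "m \<ge> 1" "t \<in> {0..1}"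
  shows "grid_point m t \<in> {0..1}" "\<bar>grid_point m t - t\<bar> \<le> 1 / real m"
proof -
  have m: "real m > 0" using assms(1) by simp
  show "grid_point m t \<in> {0..1}"
    using nat_floor_le[OF assms(2), of m] m by simp
  have "real (nat \<lfloor>real m * t\<rfloor>) = of_int \<lfloor>real m * t\<rfloor>" using assms by simp
  then have "\<bar>real (nat \<lfloor>real m * t\<rfloor>) - real m * t\<bar> \<le> 1" by linarith
  moreover have "grid_point m t - t = (real (nat \<lfloor>real m * t\<rfloor>) - real m * t) / real m"
    using m by (simp add: field_simps)
  ultimately show "\<bar>grid_point m t - t\<bar> \<le> 1 / real m"
    using m by (simp add: divide_right_mono)
qed

lemma grid_to_point:
  assumes "t \<in> {0..1}"
  shows "(\<lambda>m. grid_point m t) \<longlonglongrightarrow> t"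
proof -
  have "(\<lambda>m. grid_point m t - t) \<longlonglongrightarrow> 0"
  proof (rule Lim_null_comparison)
    show "(\<lambda>m. 1 / real m) \<longlonglongrightarrow> 0" by (rule lim_const_over_n)
    show "\<forall>\<^sub>F m in sequentially. norm (grid_point m t - t) \<le> 1 / real m"
      using eventually_ge_at_top[of 1] by eventually_elim (use floor_grid_bounds(2)[OF _ assms] in simp)
  qed
  then show ?thesis by (simp add: LIM_zero_iff)
qed

text \<open>Uniform continuity makes the difference small in sup norm, while its
  \<open>q\<close>-norm stays below twice that of \<open>g\<close>, because sampling does not
  increase it. Interpolation gives smallness at the larger exponent.\<close>

lemma Wp_norm_grid_tendsto:
  assumes q: "1 \<le> q" "q < p" and g: "continuous_on {0..1} g" "p_variation q g < \<infinity>"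
  shows "(\<lambda>m. Wp_norm p (\<lambda>t. g (grid_point m t) - g t)) \<longlonglongrightarrow> 0"
proof (rule LIMSEQ_I)
  fix e :: real assume e: "e > 0"
  define V where "V = Wp_norm q g"
  have V: "V \<ge> 0" by (simp add: V_def Wp_norm_nonneg)
  \<comment> \<open>With these values the \<open>q\<close>-norm part is at most \<open>e / 2\<close>
    and the sup part at most \<open>e / 4\<close>.\<close>
  define K where "K = 4 * (V + 1) / e"
  have K: "K > 0" using V e by (simp add: K_def)
  from Wp_norm_interpolate[OF q K] obtain L where L: "L \<ge> 0"
    "\<And>g s. (\<forall>t\<in>{0..1}. \<bar>g t\<bar> \<le> s) \<Longrightarrow> p_variation q g < \<infinity> \<Longrightarrow> Wp_norm p g \<le> L * s + Wp_norm q g / K"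
    by blast
  define s where "s = e / (4 * (L + 1))"
  have s: "s > 0" using e L by (simp add: s_def)
  have Ls: "L * s \<le> e / 4" using e L by (simp add: s_def field_simps)
  have "uniformly_continuous_on {0..1} g" by (rule compact_uniformly_continuous[OF g(1)]) simp
  then obtain d where d: "d > 0" "\<And>u v. u \<in> {0..1} \<Longrightarrow> v \<in> {0..1} \<Longrightarrow> dist u v < d \<Longrightarrow> dist (g u) (g v) < s"
    using s unfolding uniformly_continuous_on_def by metis
  have "\<forall>\<^sub>F m in sequentially. 1 / real m < d"
    using order_tendstoD(2)[OF lim_const_over_n[of 1] d(1)] .
  then have "\<forall>\<^sub>F m in sequentially. norm (Wp_norm p (\<lambda>t. g (grid_point m t) - g t) - 0) < e"
    using eventually_ge_at_top[of 1]
  proof eventually_elim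
    case (elim m)
    let ?g = "\<lambda>t. g (grid_point m t)"
    have sup: "\<forall>t\<in>{0..1}. \<bar>?g t - g t\<bar> \<le> s"
    proof
      fix t :: real assume t: "t \<in> {0..1}"
      have "dist (grid_point m t) t < d"
        using floor_grid_bounds(2)[OF elim(2) t] elim(1) by (simp add: dist_real_def)
      from d(2)[OF floor_grid_bounds(1)[OF elim(2) t] t this] show "\<bar>?g t - g t\<bar> \<le> s"
        by (simp add: dist_real_def)
    qed
    have gfin: "p_variation q ?g < \<infinity>"
      using p_variation_subsample[OF elim(2), of q g] g(2) by (rule order_le_less_trans)
    have "Wp_norm p (\<lambda>t. ?g t - g t) \<le> L * s + Wp_norm q (\<lambda>t. ?g t - g t) / K"
      by (rule L(2)[OF sup p_variation_diff_finite[OF q(1) gfin g(2)]])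
    also have "Wp_norm q (\<lambda>t. ?g t - g t) \<le> V + V"
      using Wp_norm_diff_le[OF q(1) gfin g(2)] Wp_norm_subsample[OF elim(2) q(1) g(2)] by (simp add: V_def)
    also have "(V + V) / K \<le> e / 2"
      using V e by (simp add: K_def field_simps)
    finally have "Wp_norm p (\<lambda>t. ?g t - g t) < e" using Ls K e by (simp add: divide_right_mono)
    then show ?case by (simp add: Wp_norm_nonneg)
  qed
  then show "\<exists>no. \<forall>m\<ge>no. norm (Wp_norm p (\<lambda>t. g (grid_point m t) - g t) - 0) < e"
    by (simp add: eventually_sequentially)
qed

lemma step_path_wiener_incr:
  assumes "t \<in> {0..1}"
  shows "step_path m (\<lambda>k. wiener_incr W m k w) t = W (grid_point m t) w - W 0 w"
proof -
  have "(\<Sum>k<j. wiener_incr W m k w) = W (real j / real m) w - W 0 w" for j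
    using sum_lessThan_telescope[of "\<lambda>k. W (real k / real m) w" j] by (simp add: wiener_incr_def)
  then show ?thesis using assms by (simp add: step_path_def)
qed

text \<open>Grid increments have variance \<open>1 / m\<close>, so Lepingle's bound is the same for
  every grid. By Fatou's lemma the lower limit of the norms is finite almost surely, and lower
  semicontinuity passes it on to the continuous path.\<close>

lemma wiener_finite_variation:
  assumes W: "wiener_process_01 N W" and q: "q > 2"
  shows "AE w in N. p_variation q (\<lambda>t. W t w) < \<infinity>"
proof -
  interpret prob_space N using W by (simp add: wiener_process_01_def)
  define V where "V m w = step_norm q m (\<lambda>k. wiener_incr W m k w)" for m w
  \<comment> \<open>Grids are indexed by \<open>Suc m\<close> because the facts about increments
    require at least one block.\<close>
  have V_meas: "(\<lambda>w. ennreal (V (Suc m) w)) \<in> borel_measurable N" for m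
    unfolding V_def using q
    by (intro measurable_compose[OF _ measurable_ennreal] measurable_Wp_norm_step_path wiener_incr_measurable[OF W]) auto
  have V_bound: "(\<integral>\<^sup>+ w. ennreal (V (Suc m) w) \<partial>N) \<le> ennreal (lepingle_const q)" for m
  proof -
    let ?m = "Suc m"
    have D: "distributed N lborel (wiener_incr W ?m k) (normal_density 0 (sqrt (1 / real ?m)))" if "k < ?m" for k
      using that by (intro wiener_incr_distributed[OF W]) auto
    have "(\<integral>\<^sup>+ w. ennreal (V ?m w) \<partial>N) \<le> ennreal (lepingle_const q * sqrt (real ?m * (1 / real ?m)))"
      unfolding V_def
    proof (rule nn_integral_Wp_norm_step_path_le)
      show "indep_vars (\<lambda>_. borel) (wiener_incr W ?m) {..<?m}"
        by (rule wiener_incr_indep[OF W]) simp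
      have val: "fact (2 * 1) / ((2 / (sqrt (1 / real ?m))\<^sup>2) ^ 1 * fact 1) = (1 / real ?m :: real)"
        by (simp add: field_simps)
      have mom: "has_bochner_integral lborel (\<lambda>y. normal_density 0 (sqrt (1 / real ?m)) y * y\<^sup>2) (1 / real ?m)"
        using normal_moment_even[of "sqrt (1 / real ?m)" 0 1] unfolding val by simp
      fix k assume k: "k < ?m"
      show "expectation (wiener_incr W ?m k) = 0"
        by (rule normal_distributed_expectation[OF _ D[OF k]]) simp
      show "integrable N (\<lambda>w. (wiener_incr W ?m k w)\<^sup>2)"
        using mom distributed_integrable[OF D[OF k], of "\<lambda>y. y\<^sup>2"] by (auto simp: has_bochner_integral_iff)
      show "expectation (\<lambda>w. (wiener_incr W ?m k w)\<^sup>2) \<le> 1 / real ?m"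
        using mom distributed_integral[OF D[OF k], of "\<lambda>y. y\<^sup>2"] by (auto simp: has_bochner_integral_iff)
    qed (use q in auto)
    then show ?thesis by simp
  qed
  have "(\<integral>\<^sup>+ w. liminf (\<lambda>m. ennreal (V (Suc m) w)) \<partial>N) \<le> liminf (\<lambda>m. \<integral>\<^sup>+ w. ennreal (V (Suc m) w) \<partial>N)"
    by (rule nn_integral_liminf) (rule V_meas)
  also have "... \<le> ennreal (lepingle_const q)"
    using V_bound by (intro Liminf_le) (auto intro!: always_eventually)
  finally have fin: "(\<integral>\<^sup>+ w. liminf (\<lambda>m. ennreal (V (Suc m) w)) \<partial>N) \<noteq> \<infinity>"
    by (auto simp: top_unique)
  have "AE w in N. liminf (\<lambda>m. ennreal (V (Suc m) w)) \<noteq> \<infinity>"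
    by (rule nn_integral_PInf_AE[OF _ fin]) (use V_meas in measurable)
  moreover have "AE w in N. continuous_on {0..1} (\<lambda>t. W t w)" "AE w in N. W 0 w = 0"
    using W by (auto simp: wiener_process_01_def)
  ultimately show ?thesis
  proof eventually_elim
    case (elim w)
    then obtain K where K: "liminf (\<lambda>m. ennreal (V (Suc m) w)) = ennreal K" "K \<ge> 0"
      by (cases "liminf (\<lambda>m. ennreal (V (Suc m) w))") auto
    have freq: "\<exists>\<^sub>F m in sequentially. V (Suc m) w \<le> K + 1"
    proof (rule ccontr)
      assume "\<not> (\<exists>\<^sub>F m in sequentially. V (Suc m) w \<le> K + 1)"
      then have "\<forall>\<^sub>F m in sequentially. ennreal (K + 1) \<le> ennreal (V (Suc m) w)"
        unfolding not_frequently by (rule eventually_mono) (auto intro!: ennreal_leI)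
      then have "ennreal (K + 1) \<le> ennreal K" unfolding K(1)[symmetric] by (rule Liminf_bounded)
      then show False using K(2) by (simp add: ennreal_le_iff)
    qed
    have "p_variation q (\<lambda>t. W t w) \<le> ennreal ((K + 1) powr q)"
    proof (rule p_variation_lsc)
      fix t :: real assume t: "t \<in> {0..1}"
      have "(\<lambda>m. W (grid_point m t) w) \<longlonglongrightarrow> W t w"
        using floor_grid_bounds(1)[OF _ t]
        by (intro continuous_on_tendsto_compose[OF elim(2) grid_to_point[OF t] t]
            eventually_mono[OF eventually_ge_at_top[of 1]]) auto
      then have "(\<lambda>m. W (real (nat \<lfloor>real (Suc m) * t\<rfloor>) / real (Suc m)) w - W 0 w) \<longlonglongrightarrow> W t w - 0"
        unfolding elim(3) by (intro tendsto_diff tendsto_const LIMSEQ_Suc)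
      then show "(\<lambda>m. step_path (Suc m) (\<lambda>k. wiener_incr W (Suc m) k w) t) \<longlonglongrightarrow> W t w"
        unfolding step_path_wiener_incr[OF t] by simp
    next
      show "\<exists>\<^sub>F m in sequentially. p_variation q (step_path (Suc m) (\<lambda>k. wiener_incr W (Suc m) k w)) \<le> ennreal ((K + 1) powr q)"
      proof (rule frequently_elim1[OF freq])
        fix m assume "V (Suc m) w \<le> K + 1"
        then have "V (Suc m) w powr q \<le> (K + 1) powr q"
          using q by (intro powr_mono2) (auto simp: V_def Wp_norm_nonneg)
        then show "p_variation q (step_path (Suc m) (\<lambda>k. wiener_incr W (Suc m) k w)) \<le> ennreal ((K + 1) powr q)"
          using p_variation_le_Wp_norm[OF step_path_fin, of q "Suc m" "\<lambda>k. wiener_incr W (Suc m) k w"] q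
          unfolding V_def by (auto intro: order_trans ennreal_leI)
      qed
    qed (use q in auto)
    then show ?case by (rule order_le_less_trans) simp
  qed
qed

text \<open>A pathwise statement. An exponent strictly between 2 and \<open>p\<close> leaves room
  for interpolation, and \<open>W 0 = 0\<close> almost surely identifies the step path with the
  sampled path.\<close>

lemma wiener_step_approx:
  assumes W: "wiener_process_01 N W" and p: "p > 2"
  shows "AE w in N. (\<lambda>m. Wp_dist p (step_path m (\<lambda>k. c * wiener_incr W m k w)) (\<lambda>t\<in>{0..1}. c * W t w)) \<longlonglongrightarrow> 0"
proof -
  define q where "q = (2 + p) / 2"
  have q: "q > 2" "q < p" "q \<ge> 1" using p by (auto simp: q_def)
  have "AE w in N. continuous_on {0..1} (\<lambda>t. W t w)" "AE w in N. W 0 w = 0"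
    using W by (auto simp: wiener_process_01_def)
  with wiener_finite_variation[OF W q(1)] show ?thesis
  proof eventually_elim
    case (elim w)
    have "Wp_dist p (step_path m (\<lambda>k. c * wiener_incr W m k w)) (\<lambda>t\<in>{0..1}. c * W t w)
        = Wp_norm p (\<lambda>t. c * (W (grid_point m t) w - W t w))" for m
      unfolding Wp_dist_def
    proof (rule Wp_norm_cong)
      fix t :: real assume t: "t \<in> {0..1}"
      show "step_path m (\<lambda>k. c * wiener_incr W m k w) t - (\<lambda>t\<in>{0..1}. c * W t w) t
        = c * (W (grid_point m t) w - W t w)"
        unfolding step_path_scale[OF t, symmetric] step_path_wiener_incr[OF t]
        using t elim(3) by (simp add: right_diff_distrib)
    qed
    then have "Wp_dist p (step_path m (\<lambda>k. c * wiener_incr W m k w)) (\<lambda>t\<in>{0..1}. c * W t w)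
        = \<bar>c\<bar> * Wp_norm p (\<lambda>t. W (grid_point m t) w - W t w)" for m
      using p Wp_norm_scale[of p c] by simp
    moreover have "(\<lambda>m. \<bar>c\<bar> * Wp_norm p (\<lambda>t. W (grid_point m t) w - W t w)) \<longlonglongrightarrow> \<bar>c\<bar> * 0"
      by (intro tendsto_mult tendsto_const Wp_norm_grid_tendsto[OF q(3,2) elim(2,1)])
    ultimately show ?case by simp
  qed
qed

section \<open>Reduction to Lipschitz functionals\<close>

text \<open>A bounded measurable function is its own least measurable majorant, so the infimum is
  attained at it.\<close>

lemma outer_expectation_measurable:
  assumes "prob_space P" and g: "g \<in> borel_measurable P" "\<And>w. w \<in> space P \<Longrightarrow> \<bar>g w\<bar> \<le> B"
  shows "outer_expectation P (\<lambda>w. ereal (g w)) = ereal (\<integral>w. g w \<partial>P)"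
proof -
  interpret prob_space P by fact
  have int: "integrable P g" by (rule integrable_const_bound[of _ B]) (use g in auto)
  have e2: "e2ennreal (ereal x) = ennreal x" for x by (simp add: ennreal.rep_eq e2ennreal_def ennreal_def)
  have ext: "ext_expectation P (\<lambda>w. ereal (g w)) = ereal (\<integral>w. g w \<partial>P)"
  proof -
    obtain r where r: "(\<integral>\<^sup>+w. ennreal (g w) \<partial>P) = ennreal r" "0 \<le> r"
      using int by (cases "\<integral>\<^sup>+w. ennreal (g w) \<partial>P") (auto simp: real_integrable_def)
    obtain q where q: "(\<integral>\<^sup>+w. ennreal (- g w) \<partial>P) = ennreal q" "0 \<le> q"
      using int by (cases "\<integral>\<^sup>+w. ennreal (- g w) \<partial>P") (auto simp: real_integrable_def)
    have "integral\<^sup>L P g = r - q"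
      unfolding real_lebesgue_integral_def[OF int] r(1) q(1) using r(2) q(2) by simp
    then show ?thesis unfolding ext_expectation_def uminus_ereal.simps e2 r(1) q(1) using r(2) q(2) by simp
  qed
  show ?thesis
    unfolding outer_expectation_def
  proof (rule antisym)
    have ex: "expectation_exists P (\<lambda>w. ereal (g w))"
      unfolding expectation_exists_def uminus_ereal.simps e2
      using g(1) int by (auto simp: real_integrable_def less_top)
    show "Inf {ext_expectation P U |U. expectation_exists P U \<and> (\<forall>w\<in>space P. ereal (g w) \<le> U w)} \<le> ereal (\<integral>w. g w \<partial>P)"
      unfolding ext[symmetric] by (rule Inf_lower) (use ex in auto)
    show "ereal (\<integral>w. g w \<partial>P) \<le> Inf {ext_expectation P U |U. expectation_exists P U \<and> (\<forall>w\<in>space P. ereal (g w) \<le> U w)}"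
    proof (rule Inf_greatest, clarify)
      fix U assume "\<forall>w\<in>space P. ereal (g w) \<le> U w"
      then show "ereal (\<integral>w. g w \<partial>P) \<le> ext_expectation P U"
        unfolding ext[symmetric] ext_expectation_def
        by (intro ereal_minus_mono less_eq_ennreal.rep_eq[THEN iffD1] nn_integral_mono e2ennreal_mono) (auto simp flip: uminus_ereal.simps(1))
    qed
  qed
qed

section \<open>Inf-convolution on a metric space\<close>

context Metric_space
begin

lemma continuous_map_real_iff:
  "continuous_map mtopology euclideanreal h \<longleftrightarrow>
    (\<forall>a\<in>M. \<forall>e>0. \<exists>\<delta>>0. \<forall>x\<in>M. d a x < \<delta> \<longrightarrow> \<bar>h a - h x\<bar> < e)"
  using metric_continuous_map[OF Met_TC.Metric_space_axioms, of h]
  by (simp add: dist_real_def Ball_def imp_conjL)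

lemma Lipschitz_imp_continuous_map_real:
  assumes "r \<ge> 0" "\<And>x y. x \<in> M \<Longrightarrow> y \<in> M \<Longrightarrow> \<bar>f x - f y\<bar> \<le> r * d x y"
  shows "continuous_map mtopology euclideanreal f"
  unfolding continuous_map_real_iff
proof (intro ballI allI impI)
  fix a and e :: real assume a: "a \<in> M" and e: "e > 0"
  show "\<exists>\<delta>>0. \<forall>x\<in>M. d a x < \<delta> \<longrightarrow> \<bar>f a - f x\<bar> < e"
  proof (intro exI conjI ballI impI)
    show "e / (r + 1) > 0" using e assms(1) by simp
    fix x assume x: "x \<in> M" "d a x < e / (r + 1)"
    have "\<bar>f a - f x\<bar> \<le> r * d a x" using assms(2) a x by simp
    also have "... \<le> (r + 1) * d a x" by (simp add: distrib_right)
    also have "... < e" using x(2) assms(1) by (simp add: field_simps)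
    finally show "\<bar>f a - f x\<bar> < e" .
  qed
qed

text \<open>The inf-convolution of \<open>h\<close> with \<open>r * d\<close>, or Pasch-Hausdorff
  envelope: for bounded \<open>h\<close> and \<open>r \<ge> 0\<close>, the largest
  \<open>r\<close>-Lipschitz function below \<open>h\<close>.\<close>

definition lip_minorant :: "('a \<Rightarrow> real) \<Rightarrow> real \<Rightarrow> 'a \<Rightarrow> real" where
  "lip_minorant h r x = (INF y\<in>M. h y + r * d x y)"

lemma lip_minorant_bdd:
  assumes "\<And>y. y \<in> M \<Longrightarrow> \<bar>h y\<bar> \<le> B" "r \<ge> 0"
  shows "bdd_below ((\<lambda>y. h y + r * d x y) ` M)"
proof (rule bdd_belowI2)
  show "- B \<le> h y + r * d x y" if "y \<in> M" for y
  proof -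
    have "0 \<le> r * d x y" using assms(2) by simp
    then show ?thesis using assms(1)[OF that] by linarith
  qed
qed

lemma lip_minorant_le:
  assumes "\<And>y. y \<in> M \<Longrightarrow> \<bar>h y\<bar> \<le> B" "r \<ge> 0" "x \<in> M"
  shows "lip_minorant h r x \<le> h x"
  using cINF_lower[OF lip_minorant_bdd[OF assms(1,2), where x=x] assms(3)] assms(3) by (simp add: lip_minorant_def)

lemma lip_minorant_ge:
  assumes "\<And>y. y \<in> M \<Longrightarrow> b \<le> h y + r * d x y" "x \<in> M"
  shows "b \<le> lip_minorant h r x"
  unfolding lip_minorant_def using assms by (intro cINF_greatest) auto

lemma lip_minorant_abs_le:
  assumes "\<And>y. y \<in> M \<Longrightarrow> \<bar>h y\<bar> \<le> B" "r \<ge> 0" "x \<in> M"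
  shows "\<bar>lip_minorant h r x\<bar> \<le> B"
proof -
  have "- B \<le> lip_minorant h r x"
  proof (rule lip_minorant_ge[OF _ assms(3)])
    fix y assume "y \<in> M"
    moreover have "0 \<le> r * d x y" using assms(2) by simp
    ultimately show "- B \<le> h y + r * d x y" using assms(1)[of y] by linarith
  qed
  moreover have "lip_minorant h r x \<le> h x" by (rule lip_minorant_le[OF assms])
  ultimately show ?thesis using assms(1)[OF assms(3)] by linarith
qed

lemma lip_minorant_Lipschitz:
  assumes "\<And>y. y \<in> M \<Longrightarrow> \<bar>h y\<bar> \<le> B" "r \<ge> 0" "x \<in> M" "x' \<in> M"
  shows "\<bar>lip_minorant h r x - lip_minorant h r x'\<bar> \<le> r * d x x'"
proof -
  have "lip_minorant h r x - r * d x x' \<le> lip_minorant h r x'" if "x \<in> M" "x' \<in> M" for x x'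
  proof (rule lip_minorant_ge[OF _ that(2)])
    fix y assume y: "y \<in> M"
    have "lip_minorant h r x \<le> h y + r * d x y"
      unfolding lip_minorant_def by (rule cINF_lower[OF lip_minorant_bdd[OF assms(1,2)] y])
    also have "r * d x y \<le> r * (d x x' + d x' y)" using assms(2) triangle[OF that y] by (intro mult_left_mono)
    finally show "lip_minorant h r x - r * d x x' \<le> h y + r * d x' y" by (simp add: distrib_left)
  qed
  from this[OF assms(3,4)] this[OF assms(4,3)] show ?thesis by (simp add: commute abs_le_iff)
qed

text \<open>A competitor \<open>y\<close> at distance at least \<open>\<delta>\<close> pays at least
  \<open>r * \<delta> \<ge> 2 * B\<close>, which \<open>h\<close> cannot make up for; nearer ones
  are held by continuity at \<open>x\<close>. Convergence is only pointwise, enough for dominated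
  convergence.\<close>

lemma lip_minorant_tendsto:
  assumes "\<And>y. y \<in> M \<Longrightarrow> \<bar>h y\<bar> \<le> B" "continuous_map mtopology euclideanreal h" "x \<in> M"
  shows "(\<lambda>r. lip_minorant h (real r) x) \<longlonglongrightarrow> h x"
proof (rule LIMSEQ_I)
  fix e :: real assume e: "e > 0"
  have B: "B \<ge> 0" using assms(1)[OF assms(3)] by linarith
  obtain \<delta> where \<delta>: "\<delta> > 0" "\<And>y. y \<in> M \<Longrightarrow> d x y < \<delta> \<Longrightarrow> \<bar>h x - h y\<bar> < e / 2"
    using assms(2,3) e unfolding continuous_map_real_iff by (meson half_gt_zero)
  have "norm (lip_minorant h (real r) x - h x) < e" if r: "r \<ge> nat \<lceil>2 * B / \<delta>\<rceil>" for r
  proof -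
    have "2 * B / \<delta> \<le> real r" using r by linarith
    then have rB: "2 * B \<le> real r * \<delta>" using \<delta>(1) by (simp add: field_simps)
    have "h x - e / 2 \<le> lip_minorant h (real r) x"
    proof (rule lip_minorant_ge[OF _ assms(3)])
      fix y assume y: "y \<in> M"
      show "h x - e / 2 \<le> h y + real r * d x y"
      proof (cases "d x y < \<delta>")
        case True
        have "0 \<le> real r * d x y" by simp
        then show ?thesis using \<delta>(2)[OF y True] by linarith
      next
        case False
        then have "real r * \<delta> \<le> real r * d x y" by (intro mult_left_mono) auto
        then show ?thesis using rB assms(1)[OF y] assms(1)[OF assms(3)] e by linarith
      qed
    qed
    moreover have "lip_minorant h (real r) x \<le> h x" by (rule lip_minorant_le[OF assms(1) _ assms(3)]) auto
    ultimately show ?thesis using e by simp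
  qed
  then show "\<exists>no. \<forall>r\<ge>no. norm (lip_minorant h (real r) x - h x) < e" by blast
qed

text \<open>Minorants approximate from below and thus give one side only; the other side comes from
  \<open>- h\<close>. The limit in \<open>r\<close> is taken under the fixed variable
  \<open>Z0\<close>, so no uniformity in \<open>n\<close> is required.\<close>

lemma Lipschitz_convergence_lower:
  assumes P: "\<And>n. prob_space (P n)" "prob_space P0"
    and Z: "\<And>n w. w \<in> space (P n) \<Longrightarrow> Z n w \<in> M" "\<And>w. w \<in> space P0 \<Longrightarrow> Z0 w \<in> M"
    and meas: "\<And>f n. continuous_map mtopology euclideanreal f \<Longrightarrow> (\<lambda>w. f (Z n w)) \<in> borel_measurable (P n)"
      "\<And>f. continuous_map mtopology euclideanreal f \<Longrightarrow> (\<lambda>w. f (Z0 w)) \<in> borel_measurable P0"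
    and conv: "\<And>f r B. r \<ge> 0 \<Longrightarrow> (\<And>x y. x \<in> M \<Longrightarrow> y \<in> M \<Longrightarrow> \<bar>f x - f y\<bar> \<le> r * d x y) \<Longrightarrow> (\<And>x. x \<in> M \<Longrightarrow> \<bar>f x\<bar> \<le> B)
      \<Longrightarrow> (\<lambda>n. \<integral>w. f (Z n w) \<partial>P n) \<longlonglongrightarrow> (\<integral>w. f (Z0 w) \<partial>P0)"
    and h: "continuous_map mtopology euclideanreal h" "\<And>x. x \<in> M \<Longrightarrow> \<bar>h x\<bar> \<le> B" and e: "e > 0"
  shows "\<forall>\<^sub>F n in sequentially. (\<integral>w. h (Z0 w) \<partial>P0) - e < (\<integral>w. h (Z n w) \<partial>P n)"
proof -
  interpret P0: prob_space P0 by fact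
  have cont: "continuous_map mtopology euclideanreal (lip_minorant h (real r))" for r
    by (rule Lipschitz_imp_continuous_map_real[of "real r"]) (auto intro: lip_minorant_Lipschitz[OF h(2)])
  have "(\<lambda>r. \<integral>w. lip_minorant h (real r) (Z0 w) \<partial>P0) \<longlonglongrightarrow> (\<integral>w. h (Z0 w) \<partial>P0)"
  proof (rule integral_dominated_convergence[where w="\<lambda>_. B"])
    show "AE w in P0. (\<lambda>r. lip_minorant h (real r) (Z0 w)) \<longlonglongrightarrow> h (Z0 w)"
      using lip_minorant_tendsto[OF h(2,1)] Z(2) by (intro AE_I2) auto
    show "AE w in P0. norm (lip_minorant h (real r) (Z0 w)) \<le> B" for r
      using lip_minorant_abs_le[OF h(2), where r="real r"] Z(2) by (intro AE_I2) auto
  qed (use meas(2) cont h in auto)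
  from order_tendstoD(1)[OF this, of "(\<integral>w. h (Z0 w) \<partial>P0) - e / 2"] e
  obtain r where r: "(\<integral>w. h (Z0 w) \<partial>P0) - e / 2 < (\<integral>w. lip_minorant h (real r) (Z0 w) \<partial>P0)"
    unfolding eventually_sequentially by auto
  have "(\<lambda>n. \<integral>w. lip_minorant h (real r) (Z n w) \<partial>P n) \<longlonglongrightarrow> (\<integral>w. lip_minorant h (real r) (Z0 w) \<partial>P0)"
    by (rule conv[of "real r" _ B]) (auto intro: lip_minorant_Lipschitz[OF h(2)] lip_minorant_abs_le[OF h(2)])
  then have "\<forall>\<^sub>F n in sequentially. (\<integral>w. h (Z0 w) \<partial>P0) - e < (\<integral>w. lip_minorant h (real r) (Z n w) \<partial>P n)"
    by (rule order_tendstoD(1)) (use r e in auto)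
  then show ?thesis
  proof (rule eventually_mono)
    fix n assume *: "(\<integral>w. h (Z0 w) \<partial>P0) - e < (\<integral>w. lip_minorant h (real r) (Z n w) \<partial>P n)"
    interpret Pn: prob_space "P n" by (rule P)
    have "(\<integral>w. lip_minorant h (real r) (Z n w) \<partial>P n) \<le> (\<integral>w. h (Z n w) \<partial>P n)"
    proof (rule integral_mono)
      show "integrable (P n) (\<lambda>w. lip_minorant h (real r) (Z n w))"
        using lip_minorant_abs_le[OF h(2), where r="real r"] Z(1)
        by (intro Pn.integrable_const_bound[of _ B] meas cont AE_I2) auto
      show "integrable (P n) (\<lambda>w. h (Z n w))"
        using h(2) Z(1) by (intro Pn.integrable_const_bound[of _ B] meas h AE_I2) auto
      show "lip_minorant h (real r) (Z n w) \<le> h (Z n w)" if "w \<in> space (P n)" for w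
        by (rule lip_minorant_le[OF h(2)]) (use Z(1)[OF that] in auto)
    qed
    with * show "(\<integral>w. h (Z0 w) \<partial>P0) - e < (\<integral>w. h (Z n w) \<partial>P n)" by linarith
  qed
qed

text \<open>The sigma-algebra in \<open>separable_borel\<close> lives on the range of
  \<open>Z\<close>, so an open set of the whole space is first cut down to its trace there.\<close>

lemma separable_borel_measurable:
  assumes Z: "separable_borel N Z" and h: "continuous_map mtopology X h" and U: "openin X U"
  shows "{w\<in>space N. h (Z w) \<in> U} \<in> sets N"
proof -
  define R where "R = Z ` space N"
  have RM: "R \<subseteq> M" and Zm: "Z \<in> measurable N (sigma R {U. openin (subtopology mtopology R) U})"
    using Z by (auto simp: separable_borel_def R_def)
  define V where "V = {x \<in> M. h x \<in> U}"
  have "openin mtopology V" unfolding V_def using openin_continuous_map_preimage[OF h U] by simp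
  then have "openin (subtopology mtopology R) (R \<inter> V)" by (rule openin_subtopology_Int2)
  then have "R \<inter> V \<in> sets (sigma R {U. openin (subtopology mtopology R) U})"
    using RM by (subst sets_measure_of) (auto simp: openin_subtopology)
  from measurable_sets[OF Zm this] have "Z -` (R \<inter> V) \<inter> space N \<in> sets N" .
  also have "Z -` (R \<inter> V) \<inter> space N = {w\<in>space N. h (Z w) \<in> U}"
    using RM by (auto simp: R_def V_def)
  finally show ?thesis .
qed

lemma separable_borel_borel_measurable:
  assumes "separable_borel N Z" "continuous_map mtopology euclideanreal h"
  shows "(\<lambda>w. h (Z w)) \<in> borel_measurable N"
proof (rule borel_measurableI)
  fix S :: "real set" assume "open S"
  then have "{w\<in>space N. h (Z w) \<in> S} \<in> sets N"
    by (intro separable_borel_measurable[OF assms]) simp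
  then show "(\<lambda>w. h (Z w)) -` S \<inter> space N \<in> sets N"
    by (simp add: vimage_def Int_def conj_commute)
qed

text \<open>The hypothesis of the theorem concerns \<open>W\<close>, whereas the limit is a multiple
  of it. A continuous self-map keeps a separable set around the range, and measurability passes
  through preimages of open sets.\<close>

lemma separable_borel_image:
  assumes Z: "separable_borel N Z" and T: "continuous_map mtopology mtopology T"
  shows "separable_borel N (\<lambda>w. T (Z w))"
proof -
  obtain S where S: "S \<subseteq> M" "separable_space (subtopology mtopology S)" "Z ` space N \<subseteq> S"
    using Z by (auto simp: separable_borel_def)
  have TM: "T ` M \<subseteq> M" using continuous_map_image_subset_topspace[OF T] by simp
  have "continuous_map (subtopology mtopology S) (subtopology mtopology (T ` S)) T"
    using S(1) by (intro continuous_map_into_subtopology continuous_map_from_subtopology[OF T]) auto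
  then have "separable_space (subtopology mtopology (T ` S))"
    by (rule separable_space_continuous_map_image[OF S(2)]) (use S(1) TM in auto)
  moreover have "(\<lambda>w. T (Z w)) \<in> measurable N (sigma ((\<lambda>w. T (Z w)) ` space N)
      {U. openin (subtopology mtopology ((\<lambda>w. T (Z w)) ` space N)) U})"
  proof (rule measurable_measure_of)
    let ?R = "(\<lambda>w. T (Z w)) ` space N"
    show "{U. openin (subtopology mtopology ?R) U} \<subseteq> Pow ?R"
      by (auto simp: openin_subtopology)
    fix U assume "U \<in> {U. openin (subtopology mtopology ?R) U}"
    then obtain V where V: "openin mtopology V" "U = V \<inter> ?R" by (auto simp: openin_subtopology)
    have "(\<lambda>w. T (Z w)) -` U \<inter> space N = {w\<in>space N. T (Z w) \<in> V}" using V(2) by auto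
    then show "(\<lambda>w. T (Z w)) -` U \<inter> space N \<in> sets N"
      using separable_borel_measurable[OF Z T V(1)] by simp
  qed auto
  moreover have "T ` S \<subseteq> M" using TM S(1) by blast
  ultimately show ?thesis
    unfolding separable_borel_def using S(3) by (intro conjI exI[of _ "T ` S"]) auto
qed

end

section \<open>The invariance principle\<close>

text \<open>The crude total variation bound makes \<open>step_path n\<close> continuous from the
  coordinates into \<open>Wp p\<close>. Functionals are thus handled without asking whether the path
  itself is Borel measurable in the non-separable space.\<close>

lemma continuous_on_Wp_functional:
  assumes p: "p \<ge> 1" and h: "continuous_map (Metric_space.mtopology (Wp p) (Wp_dist p)) euclideanreal h"
  shows "continuous_on UNIV (\<lambda>x. h (step_path n x))"
proof (rule continuous_on_finite_coordinates)
  interpret Metric_space "Wp p" "Wp_dist p" by (rule Metric_space_Wp[OF p])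
  fix x :: "nat \<Rightarrow> real" and e :: real assume "e > 0"
  then obtain \<delta> where \<delta>: "\<delta> > 0" "\<And>g. g \<in> Wp p \<Longrightarrow> Wp_dist p (step_path n x) g < \<delta> \<Longrightarrow> \<bar>h (step_path n x) - h g\<bar> < e"
    using h step_path_in_Wp[OF p, of n x] unfolding continuous_map_real_iff by meson
  show "\<exists>d>0. \<forall>y. (\<Sum>i<n. \<bar>x i - y i\<bar>) < d \<longrightarrow> \<bar>h (step_path n x) - h (step_path n y)\<bar> < e"
  proof (intro exI conjI allI impI)
    show "\<delta> / 2 > 0" using \<delta>(1) by simp
    fix y assume "(\<Sum>i<n. \<bar>x i - y i\<bar>) < \<delta> / 2"
    then have "Wp_dist p (step_path n x) (step_path n y) < \<delta>"
      using Wp_norm_step_path_le[OF p, of n "\<lambda>i. x i - y i"] unfolding Wp_dist_step_path by linarith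
    then show "\<bar>h (step_path n x) - h (step_path n y)\<bar> < e" by (intro \<delta>(2) step_path_in_Wp[OF p])
  qed
qed

lemma measurable_Wp_functional:
  assumes "p \<ge> 1" "continuous_map (Metric_space.mtopology (Wp p) (Wp_dist p)) euclideanreal h"
    "\<And>i. i < n \<Longrightarrow> \<xi> i \<in> borel_measurable M"
  shows "(\<lambda>w. h (step_path n (\<lambda>i. \<xi> i w))) \<in> borel_measurable M"
  by (rule measurable_step_path_functional[OF continuous_on_Wp_functional[OF assms(1,2)]]) (use assms(3) in auto)

lemma partial_sum_process_step_path:
  "(\<lambda>t\<in>{0..1}. c * partial_sum_process X n t w) = step_path n (\<lambda>i. c * X (int i + 1) w)"
  unfolding step_path_def
proof (rule restrict_ext)
  fix t :: real assume "t \<in> {0..1}"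
  have "(\<Sum>i=1..k. X i w) = (\<Sum>i<nat k. X (int i + 1) w)" for k :: int
    by (rule sum.reindex_bij_witness[of _ "\<lambda>i. int i + 1" "\<lambda>i. nat (i - 1)"]) auto
  then show "c * partial_sum_process X n t w = (\<Sum>i<nat \<lfloor>real n * t\<rfloor>. c * X (int i + 1) w)"
    by (simp add: partial_sum_process_def sum_distrib_left)
qed

text \<open>On the event \<open>noise_osc\<close> the trivial bound \<open>2 * B\<close> is paid;
  off it the paths are within \<open>2 * x\<close> of each other, and interpolation with the mean
  \<open>q\<close>-norm does the rest. The threshold for \<open>n\<close> depends on
  \<open>m\<close>, as the oscillation bound holds only eventually for each
  \<open>m\<close>.\<close>

lemma (in iid_noise) block_approximation:
  assumes W: "wiener_process_01 N W" and p: "p > 2" and r: "r \<ge> 0" and e: "e > 0"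
    and lip: "\<And>x y. x \<in> Wp p \<Longrightarrow> y \<in> Wp p \<Longrightarrow> \<bar>f x - f y\<bar> \<le> r * Wp_dist p x y"
    and bd: "\<And>x. x \<in> Wp p \<Longrightarrow> \<bar>f x\<bar> \<le> B"
  shows "\<exists>m0\<ge>1. \<forall>m\<ge>m0. \<forall>\<^sub>F n in sequentially.
    \<bar>expectation (\<lambda>w. f (step_path n (\<lambda>i. A * noise n i w)))
      - expectation (\<lambda>w. f (step_path m (\<lambda>k. A * noise_block n m k w)))\<bar> \<le> e"
proof -
  have p1: "p \<ge> 1" using p by simp
  interpret Metric_space "Wp p" "Wp_dist p" by (rule Metric_space_Wp[OF p1])
  have cont: "continuous_map mtopology euclideanreal f"
    by (rule Lipschitz_imp_continuous_map_real[OF r lip])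
  have B: "B \<ge> 0" using bd[OF step_path_in_Wp[OF p1, of 0 "\<lambda>_. 0"]] by linarith
  define q where "q = (2 + p) / 2"
  have q: "q > 2" "q < p" "q \<ge> 1" using p by (auto simp: q_def)
  define C where "C = lepingle_const q * \<sigma>"
  have C: "C > 0" using lepingle_const_pos[OF q(1)] sigma_pos by (simp add: C_def)
  define R where "R = r * \<bar>A\<bar>"
  have R: "R \<ge> 0" using r by (simp add: R_def)
  \<comment> \<open>\<open>K\<close>, \<open>x\<close> and \<open>m0\<close> hold the
    \<open>q\<close>-norm term, the uniform term and the exceptional event to \<open>e / 4\<close>
    each. The added 1 in \<open>K\<close> and in \<open>D\<close> keeps both positive when
    \<open>R\<close> or \<open>R * L\<close> is 0.\<close>
  define K where "K = (R + 1) * (8 * C / e)"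
  have K: "K > 0" using R C e by (simp add: K_def)
  have RK: "R * (2 / K) * C \<le> e / 4"
  proof -
    have eq: "2 * C / (8 * C / e) = e / 4" using C e by (simp add: field_simps)
    have "R * (2 / K) * C = R / (R + 1) * (2 * C / (8 * C / e))" by (simp add: K_def)
    also have "... = R / (R + 1) * (e / 4)" unfolding eq ..
    also have "... \<le> 1 * (e / 4)" using R e by (intro mult_right_mono) auto
    finally show ?thesis by simp
  qed
  from Wp_norm_interpolate[OF q(3,2) K] obtain L where L: "L \<ge> 0"
    "\<And>g s. (\<forall>t\<in>{0..1}. \<bar>g t\<bar> \<le> s) \<Longrightarrow> p_variation q g < \<infinity> \<Longrightarrow> Wp_norm p g \<le> L * s + Wp_norm q g / K"
    by blast
  define D where "D = R * L + 1"
  have D: "D > 0" "R * L \<le> D" using R L by (auto simp: D_def add_nonneg_pos)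
  define x where "x = e / (8 * D)"
  have x: "x > 0" using e D by (simp add: x_def)
  have Rx: "R * (L * (2 * x)) \<le> e / 4"
  proof -
    have "R * (L * (2 * x)) = (R * L) / D * (e / 4)" by (simp add: x_def)
    also have "... \<le> 1 * (e / 4)"
      using e D by (intro mult_right_mono) auto
    finally show ?thesis by simp
  qed
  obtain m1 where m1: "m1 \<ge> 1" "\<And>m. m \<ge> m1 \<Longrightarrow> \<forall>\<^sub>F n in sequentially. prob (noise_osc n m x) \<le> 8 * \<sigma> ^ 4 / (real m * x ^ 4)"
    using prob_noise_osc_le[OF W x] by blast
  define Q where "Q = 8 * \<sigma> ^ 4 / x ^ 4"
  define m0 where "m0 = max m1 (nat \<lceil>8 * B * Q / e\<rceil>)"
  have "\<forall>\<^sub>F n in sequentially. \<bar>expectation (\<lambda>w. f (step_path n (\<lambda>i. A * noise n i w)))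
      - expectation (\<lambda>w. f (step_path m (\<lambda>k. A * noise_block n m k w)))\<bar> \<le> e" if m: "m \<ge> m0" for m
  proof -
    have m': "m \<ge> m1" "m \<ge> 1" using m m1 by (auto simp: m0_def)
    have "8 * B * Q / e \<le> real m" using m unfolding m0_def by linarith
    then have BQ: "2 * B * (Q / real m) \<le> e / 4" using e m' by (simp add: field_simps)
    show ?thesis using m1(2)[OF m'(1)] eventually_gt_at_top[of 0]
    proof eventually_elim
      case (elim n)
      define Z where "Z w = step_path n (\<lambda>i. A * noise n i w)" for w
      define Y where "Y w = step_path m (\<lambda>k. A * noise_block n m k w)" for w
      define V where "V w = step_norm q n (\<lambda>i. noise n i w)" for w
      have V_int: "integrable M V" unfolding V_def
        by (intro integrable_Wp_norm_step_path q) (simp add: noise_def[abs_def])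
      have V_exp: "expectation V \<le> C"
      proof -
        have "expectation V = 1 / sqrt (real n) * expectation (\<lambda>w. step_norm q n (\<lambda>i. \<eta> (int i + 1) w))"
          unfolding V_def noise_def Wp_norm_step_path_scale[OF q(3)] powr_minus_half[OF elim(2)] by simp
        also have "... \<le> 1 / sqrt (real n) * (C * sqrt (real n))"
          unfolding C_def by (intro mult_left_mono expectation_Wp_norm_noise_le q) (auto simp: inj_on_def)
        finally show ?thesis using elim(2) by simp
      qed
      have in_Wp: "Z w \<in> Wp p" "Y w \<in> Wp p" for w by (auto simp: Z_def Y_def step_path_in_Wp p1)
      have meas: "(\<lambda>w. f (Z w)) \<in> borel_measurable M" "(\<lambda>w. f (Y w)) \<in> borel_measurable M"
        unfolding Z_def Y_def by (intro measurable_Wp_functional[OF p1 cont]; measurable)+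
      have int: "integrable M (\<lambda>w. f (Z w))" "integrable M (\<lambda>w. f (Y w))"
        using meas bd in_Wp by (auto intro!: integrable_const_bound[of _ B])
      have pt: "\<bar>f (Z w) - f (Y w)\<bar> \<le> 2 * B * indicator (noise_osc n m x) w + (R * (L * (2 * x)) + R * (2 / K) * V w)"
        if w: "w \<in> space M" for w
      proof (cases "w \<in> noise_osc n m x")
        case True
        have "0 \<le> R * (L * (2 * x)) + R * (2 / K) * V w"
          using R L x K by (simp add: V_def Wp_norm_nonneg)
        moreover have "\<bar>f (Z w) - f (Y w)\<bar> \<le> 2 * B"
          using bd[OF in_Wp(1)[of w]] bd[OF in_Wp(2)[of w]] by linarith
        ultimately show ?thesis using True by simp
      next
        case False
        let ?z = "step_path n (\<lambda>i. noise n i w)" and ?y = "step_path m (\<lambda>k. noise_block n m k w)"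
        have sup: "\<forall>t\<in>{0..1}. \<bar>?z t - ?y t\<bar> \<le> 2 * x"
        proof
          fix t :: real assume t: "t \<in> {0..1}"
          show "\<bar>?z t - ?y t\<bar> \<le> 2 * x"
            unfolding noise_block_def
          proof (rule abs_step_path_minus_block_sums_le[OF m'(2) _ t])
            fix k j assume "k < m" "n * k div m \<le> j" "j \<le> n * Suc k div m"
            then show "\<bar>\<Sum>i = n * k div m..<j. noise n i w\<bar> \<le> 2 * x"
              using False w unfolding noise_osc_def by force
          qed (use x in simp)
        qed
        have "Wp_norm q ?y \<le> V w"
          unfolding noise_block_def V_def by (rule Wp_norm_block_sums_le[OF m'(2) q(3)])
        then have dq: "Wp_norm q (\<lambda>t. ?z t - ?y t) \<le> 2 * V w"
          using Wp_norm_diff_le[OF q(3) step_path_fin[OF q(3)] step_path_fin[OF q(3)], of n "\<lambda>i. noise n i w" m "\<lambda>k. noise_block n m k w"]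
          by (simp add: V_def)
        have "Wp_norm p (\<lambda>t. ?z t - ?y t) \<le> L * (2 * x) + Wp_norm q (\<lambda>t. ?z t - ?y t) / K"
          by (rule L(2)[OF sup p_variation_diff_finite[OF q(3) step_path_fin[OF q(3)] step_path_fin[OF q(3)]]])
        also have "... \<le> L * (2 * x) + 2 * V w / K"
          using dq K by (intro add_left_mono divide_right_mono) auto
        finally have dp: "Wp_norm p (\<lambda>t. ?z t - ?y t) \<le> L * (2 * x) + 2 * V w / K" .
        have "Wp_dist p (Z w) (Y w) = Wp_norm p (\<lambda>t. A * (?z t - ?y t))"
          unfolding Wp_dist_def Z_def Y_def
          by (rule Wp_norm_cong) (simp only: step_path_scale[symmetric] right_diff_distrib)
        then have "r * Wp_dist p (Z w) (Y w) = R * Wp_norm p (\<lambda>t. ?z t - ?y t)"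
          unfolding Wp_norm_scale[OF p1] R_def by simp
        also have "... \<le> R * (L * (2 * x) + 2 * V w / K)" using dp R by (intro mult_left_mono)
        also have "... = R * (L * (2 * x)) + R * (2 / K) * V w" by (simp add: distrib_left)
        finally show ?thesis using lip[OF in_Wp[of w]] False by simp
      qed
      have "\<bar>expectation (\<lambda>w. f (Z w)) - expectation (\<lambda>w. f (Y w))\<bar> = \<bar>expectation (\<lambda>w. f (Z w) - f (Y w))\<bar>"
        using int by simp
      also have "... \<le> expectation (\<lambda>w. \<bar>f (Z w) - f (Y w)\<bar>)" by (rule integral_abs_bound)
      also have "... \<le> expectation (\<lambda>w. 2 * B * indicator (noise_osc n m x) w + (R * (L * (2 * x)) + R * (2 / K) * V w))"
      proof (rule integral_mono[OF _ _ pt])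
        show "integrable M (\<lambda>w. \<bar>f (Z w) - f (Y w)\<bar>)" using int by simp
        show "integrable M (\<lambda>w. 2 * B * indicator (noise_osc n m x) w + (R * (L * (2 * x)) + R * (2 / K) * V w))"
          using V_int by (intro Bochner_Integration.integrable_add integrable_mult_right integrable_real_indicator integrable_const) (auto simp: less_top[symmetric])
      qed
      also have "... = 2 * B * prob (noise_osc n m x) + (R * (L * (2 * x)) + R * (2 / K) * expectation V)"
      proof -
        have "integrable M (\<lambda>w. indicator (noise_osc n m x) w :: real)"
          by (intro integrable_real_indicator) (auto simp: less_top[symmetric])
        then show ?thesis using V_int by (simp add: prob_space)
      qed
      also have "... \<le> 2 * B * (Q / real m) + (R * (L * (2 * x)) + R * (2 / K) * C)"
        using elim(1) B R K V_exp unfolding Q_def by (intro add_mono mult_left_mono order_refl) (auto simp: ac_simps)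
      also have "... \<le> e" using BQ Rx RK e by simp
      finally show ?case unfolding Z_def Y_def .
    qed
  qed
  then show ?thesis using m1(1) by (intro exI[of _ m0]) (auto simp: m0_def)
qed

text \<open>Four errors, \<open>e / 4\<close> each: linear process to innovations (\<open>a\<close>
  to \<open>b\<close>), innovations to blocks (\<open>b\<close> to \<open>c\<close>), blocks to
  Gaussian increments (\<open>c\<close> to \<open>g\<close>), grid to path of \<open>W\<close>
  (\<open>g\<close> to \<open>l\<close>). The grid size \<open>m\<close> is chosen first, for the
  second and the last, then \<open>n\<close>.\<close>

lemma (in iid_noise) Lipschitz_functional_convergence:
  assumes W: "wiener_process_01 N W" and p: "p > 2" and r: "r \<ge> 0"
    and sep: "Metric_space.separable_borel (Wp p) (Wp_dist p) N (\<lambda>w. \<lambda>t\<in>{0..1}. \<sigma> * (\<Sum>j. \<psi> j) * W t w)"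
    and Wp_W: "\<And>w. w \<in> space N \<Longrightarrow> (\<lambda>t\<in>{0..1}. \<sigma> * (\<Sum>j. \<psi> j) * W t w) \<in> Wp p"
    and summ: "summable (\<lambda>j. \<bar>\<psi> j\<bar>)"
    and lip: "\<And>x y. x \<in> Wp p \<Longrightarrow> y \<in> Wp p \<Longrightarrow> \<bar>f x - f y\<bar> \<le> r * Wp_dist p x y"
    and bd: "\<And>x. x \<in> Wp p \<Longrightarrow> \<bar>f x\<bar> \<le> B"
  shows "(\<lambda>n. expectation (\<lambda>w. f (step_path n (\<lambda>i. real n powr (-1/2) * linear_process \<psi> \<eta> (int i + 1) w))))
    \<longlonglongrightarrow> (\<integral>w. f (\<lambda>t\<in>{0..1}. \<sigma> * (\<Sum>j. \<psi> j) * W t w) \<partial>N)"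
proof (rule LIMSEQ_I)
  fix e :: real assume e: "e > 0"
  have p1: "p \<ge> 1" using p by simp
  interpret Metric_space "Wp p" "Wp_dist p" by (rule Metric_space_Wp[OF p1])
  interpret N: prob_space N using W by (simp add: wiener_process_01_def)
  have cont: "continuous_map mtopology euclideanreal f"
    by (rule Lipschitz_imp_continuous_map_real[OF r lip])
  define A where "A = (\<Sum>j. \<psi> j)"
  define a where "a n = expectation (\<lambda>w. f (step_path n (\<lambda>i. real n powr (-1/2) * linear_process \<psi> \<eta> (int i + 1) w)))" for n
  define b where "b n = expectation (\<lambda>w. f (step_path n (\<lambda>i. A * noise n i w)))" for n
  define c where "c m n = expectation (\<lambda>w. f (step_path m (\<lambda>k. A * noise_block n m k w)))" for m n
  define g where "g m = (\<integral>w. f (step_path m (\<lambda>k. \<sigma> * A * wiener_incr W m k w)) \<partial>N)" for m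
  define l where "l = (\<integral>w. f (\<lambda>t\<in>{0..1}. \<sigma> * A * W t w) \<partial>N)"
  have gl: "(\<lambda>m. g (Suc m)) \<longlonglongrightarrow> l"
    unfolding g_def l_def
  proof (rule integral_dominated_convergence[where w="\<lambda>_. B"])
    show "(\<lambda>w. f (\<lambda>t\<in>{0..1}. \<sigma> * A * W t w)) \<in> borel_measurable N"
      unfolding A_def by (rule separable_borel_borel_measurable[OF sep cont])
    show "(\<lambda>w. f (step_path (Suc m) (\<lambda>k. \<sigma> * A * wiener_incr W (Suc m) k w))) \<in> borel_measurable N" for m
      by (intro measurable_Wp_functional[OF p1 cont] borel_measurable_times borel_measurable_const
          wiener_incr_measurable[OF W]) auto
    show "AE w in N. norm (f (step_path (Suc m) (\<lambda>k. \<sigma> * A * wiener_incr W (Suc m) k w))) \<le> B" for m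
      using bd step_path_in_Wp[OF p1] by simp
    show "AE w in N. (\<lambda>m. f (step_path (Suc m) (\<lambda>k. \<sigma> * A * wiener_incr W (Suc m) k w)))
        \<longlonglongrightarrow> f (\<lambda>t\<in>{0..1}. \<sigma> * A * W t w)"
      using wiener_step_approx[OF W p, of "\<sigma> * A"] AE_space
    proof eventually_elim
      case (elim w)
      let ?w = "\<lambda>t\<in>{0..1}. \<sigma> * A * W t w" and ?s = "\<lambda>m. step_path m (\<lambda>k. \<sigma> * A * wiener_incr W m k w)"
      have "(\<lambda>m. f (?s (Suc m)) - f ?w) \<longlonglongrightarrow> 0"
      proof (rule Lim_null_comparison)
        show "\<forall>\<^sub>F m in sequentially. norm (f (?s (Suc m)) - f ?w) \<le> r * Wp_dist p (?s (Suc m)) ?w"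
          using lip[OF step_path_in_Wp[OF p1] Wp_W[OF elim(2), folded A_def]] by (intro always_eventually) simp
        have "(\<lambda>m. r * Wp_dist p (?s (Suc m)) ?w) \<longlonglongrightarrow> r * 0"
          by (intro tendsto_mult tendsto_const LIMSEQ_Suc elim(1))
        then show "(\<lambda>m. r * Wp_dist p (?s (Suc m)) ?w) \<longlonglongrightarrow> 0" by simp
      qed
      then show ?case by (simp add: LIM_zero_iff)
    qed
  qed auto
  have cg: "(\<lambda>n. c m n) \<longlonglongrightarrow> g m" if m: "m \<ge> 1" for m
  proof -
    define F where "F x = f (step_path m (\<lambda>k. A * x k))" for x
    have F_cont: "continuous_on UNIV F"
    proof -
      have "continuous_on UNIV (\<lambda>x :: nat \<Rightarrow> real. \<lambda>k. A * x k)"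
        by (intro continuous_on_coordinatewise_then_product continuous_intros) auto
      from continuous_on_compose[OF this continuous_on_subset[OF continuous_on_Wp_functional[OF p1 cont, of m]]]
      show ?thesis unfolding F_def by (simp add: comp_def)
    qed
    have "(\<lambda>n. expectation (\<lambda>w. F (\<lambda>k. noise_block n m k w))) \<longlonglongrightarrow> (\<integral>w. F (\<lambda>k. \<sigma> * wiener_incr W m k w) \<partial>N)"
    proof (rule finite_dim_convergence[OF W m F_cont])
      show "F x = F y" if "\<And>i. i < m \<Longrightarrow> x i = y i" for x y
        unfolding F_def by (intro arg_cong[where f=f] step_path_cong) (simp add: that)
      show "\<bar>F x\<bar> \<le> B" for x unfolding F_def by (intro bd step_path_in_Wp[OF p1])
    qed
    then show ?thesis unfolding F_def c_def g_def by (simp add: ac_simps)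
  qed
  obtain m0 where m0: "m0 \<ge> 1" "\<And>m. m \<ge> m0 \<Longrightarrow> \<forall>\<^sub>F n in sequentially. \<bar>b n - c m n\<bar> \<le> e / 4"
    using block_approximation[OF W p r _ lip bd, of "e / 4" A] e unfolding b_def c_def by auto
  have "\<forall>\<^sub>F m in sequentially. \<bar>g (Suc m) - l\<bar> < e / 4"
    using tendstoD[OF gl, of "e / 4"] e by (simp add: dist_real_def)
  then obtain m where m: "m \<ge> m0" "\<bar>g m - l\<bar> < e / 4" "m \<ge> 1"
    using eventually_happens'[OF sequentially_bot eventually_conj[OF _ eventually_ge_at_top[of m0]], of "\<lambda>m. \<bar>g (Suc m) - l\<bar> < e / 4"]
    by (metis One_nat_def Suc_le_mono le0 le_SucI)
  obtain \<beta> where \<beta>: "\<beta> \<longlonglongrightarrow> 0" "\<And>n. n > 0 \<Longrightarrow> (\<integral>\<^sup>+ w. ennreal (step_norm p n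
    (\<lambda>i. real n powr (-1/2) * (linear_process \<psi> \<eta> (int i + 1) w - A * \<eta> (int i + 1) w))) \<partial>M) \<le> ennreal (\<beta> n)"
    using linear_process_approx[OF summ p] unfolding A_def by blast
  \<comment> \<open>The maximum with 0 is there because nothing is known about the sign of
    \<open>\<beta> n\<close>.\<close>
  have ab: "\<bar>a n - b n\<bar> \<le> r * max 0 (\<beta> n)" if n: "n > 0" for n
  proof -
    define U where "U w = step_path n (\<lambda>i. real n powr (-1/2) * linear_process \<psi> \<eta> (int i + 1) w)" for w
    define Z where "Z w = step_path n (\<lambda>i. A * noise n i w)" for w
    define D where "D w = step_norm p n (\<lambda>i. real n powr (-1/2) * (linear_process \<psi> \<eta> (int i + 1) w - A * \<eta> (int i + 1) w))" for w
    have [measurable]: "D \<in> borel_measurable M"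
      unfolding D_def by (intro measurable_Wp_norm_step_path[OF p1]) measurable
    have fin: "(\<integral>\<^sup>+ w. ennreal (D w) \<partial>M) \<le> ennreal (max 0 (\<beta> n))"
      using \<beta>(2)[OF n] unfolding D_def by (auto intro: order_trans ennreal_leI)
    have D0: "D w \<ge> 0" for w by (simp add: D_def Wp_norm_nonneg)
    have D_int: "integrable M D"
      by (rule integrableI_nonneg) (use D0 fin in \<open>auto intro: order_le_less_trans\<close>)
    have D_exp: "expectation D \<le> max 0 (\<beta> n)"
    proof -
      have "ennreal (expectation D) \<le> ennreal (max 0 (\<beta> n))"
        using fin nn_integral_eq_integral[OF D_int] D0 by simp
      then show ?thesis by (rule ennreal_le_iff[THEN iffD1, rotated]) simp
    qed
    have in_Wp: "U w \<in> Wp p" "Z w \<in> Wp p" for w by (auto simp: U_def Z_def step_path_in_Wp p1)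
    have meas: "(\<lambda>w. f (U w)) \<in> borel_measurable M" "(\<lambda>w. f (Z w)) \<in> borel_measurable M"
      unfolding U_def Z_def by (intro measurable_Wp_functional[OF p1 cont]; measurable)+
    have int: "integrable M (\<lambda>w. f (U w))" "integrable M (\<lambda>w. f (Z w))"
      using meas bd in_Wp by (auto intro!: integrable_const_bound[of _ B])
    have pt: "\<bar>f (U w) - f (Z w)\<bar> \<le> r * D w" for w
    proof -
      have "Wp_dist p (U w) (Z w) = D w"
        unfolding U_def Z_def D_def Wp_dist_step_path noise_def by (simp add: right_diff_distrib ac_simps)
      then show ?thesis using lip[OF in_Wp[of w]] by simp
    qed
    have "\<bar>a n - b n\<bar> = \<bar>expectation (\<lambda>w. f (U w) - f (Z w))\<bar>"
      unfolding a_def b_def U_def[symmetric] Z_def[symmetric] using int by simp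
    also have "... \<le> expectation (\<lambda>w. \<bar>f (U w) - f (Z w)\<bar>)" by (rule integral_abs_bound)
    also have "... \<le> expectation (\<lambda>w. r * D w)"
      using int D_int by (intro integral_mono pt) auto
    also have "... \<le> r * max 0 (\<beta> n)" using D_exp r by (simp add: mult_left_mono)
    finally show ?thesis .
  qed
  have "(\<lambda>n. r * max 0 (\<beta> n)) \<longlonglongrightarrow> r * max 0 0"
    by (intro tendsto_intros \<beta>(1))
  then have "\<forall>\<^sub>F n in sequentially. r * max 0 (\<beta> n) < e / 4"
    by (rule order_tendstoD(2)) (use e in simp)
  moreover have "\<forall>\<^sub>F n in sequentially. \<bar>c m n - g m\<bar> < e / 4"
    using tendstoD[OF cg[OF m(3)], of "e / 4"] e by (simp add: dist_real_def)
  moreover note m0(2)[OF m(1)] eventually_gt_at_top[of 0]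
  ultimately have "\<forall>\<^sub>F n in sequentially. norm (a n - l) < e"
  proof eventually_elim
    case (elim n)
    then have "\<bar>a n - b n\<bar> < e / 4" using ab[of n] by simp
    with elim(2,3) m(2) have "\<bar>a n - l\<bar> < e" by linarith
    then show ?case by simp
  qed
  then show "\<exists>no. \<forall>n\<ge>no. norm (expectation (\<lambda>w. f (step_path n (\<lambda>i. real n powr (-1/2) * linear_process \<psi> \<eta> (int i + 1) w)))
     - (\<integral>w. f (\<lambda>t\<in>{0..1}. \<sigma> * (\<Sum>j. \<psi> j) * W t w) \<partial>N)) < e"
    unfolding a_def l_def A_def eventually_sequentially .
qed

theorem theorem4:
  fixes M :: "'a measure" and N :: "'b measure"
    and \<eta> :: "int \<Rightarrow> 'a \<Rightarrow> real" and \<psi> :: "nat \<Rightarrow> real"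
    and X :: "int \<Rightarrow> 'a \<Rightarrow> real" and W :: "real \<Rightarrow> 'b \<Rightarrow> real"
    and \<sigma> p :: real
  assumes "prob_space M"
    and "prob_space.indep_vars M (\<lambda>_. borel) \<eta> UNIV"
    and "\<forall>j. distr M borel (\<eta> j) = distr M borel (\<eta> 1)"
    and "has_bochner_integral M (\<eta> 1) 0"
    and "has_bochner_integral M (\<lambda>\<omega>. (\<eta> 1 \<omega>)\<^sup>2) (\<sigma>\<^sup>2)"
    and "\<sigma> > 0"
    and "summable (\<lambda>j. \<bar>\<psi> j\<bar>)"
    and "(\<Sum>j. \<psi> j) \<noteq> 0"
    and "X = linear_process \<psi> \<eta>"
    and "p > 2"
    and "wiener_process_01 N W"
    and "Metric_space.separable_borel (Wp p) (Wp_dist p) N (\<lambda>\<omega>. \<lambda>t\<in>{0..1}. W t \<omega>)"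
  shows "Metric_space.converges_outer_distr (Wp p) (Wp_dist p)
           (\<lambda>n. M) (\<lambda>n \<omega>. \<lambda>t\<in>{0..1}. real n powr (-1/2) * partial_sum_process X n t \<omega>)
           N (\<lambda>\<omega>. \<lambda>t\<in>{0..1}. \<sigma> * (\<Sum>j. \<psi> j) * W t \<omega>)"
proof -
  interpret iid_noise M \<eta> \<sigma>
    using assms(1-6) by (simp add: iid_noise_def iid_noise_axioms_def)
  interpret N: prob_space N using assms(11) by (simp add: wiener_process_01_def)
  have p1: "p \<ge> 1" using assms(10) by simp
  interpret Metric_space "Wp p" "Wp_dist p" by (rule Metric_space_Wp[OF p1])
  define c where "c = \<sigma> * (\<Sum>j. \<psi> j)"
  define Z where "Z n w = step_path n (\<lambda>i. real n powr (-1/2) * linear_process \<psi> \<eta> (int i + 1) w)" for n w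
  define Z0 where "Z0 w = (\<lambda>t\<in>{0..1}. c * W t w)" for w
  have Z0_eq: "Z0 = (\<lambda>w. \<lambda>t\<in>{0..1}. \<sigma> * (\<Sum>j. \<psi> j) * W t w)"
    by (intro ext) (simp only: Z0_def c_def)
  define T where "T g = (\<lambda>t\<in>{0..1}. c * g t)" for g :: "real \<Rightarrow> real"
  have T_in: "T g \<in> Wp p" if "g \<in> Wp p" for g
  proof -
    have "p_variation p (T g) = p_variation p (\<lambda>t. c * g t)"
      unfolding T_def by (rule p_variation_cong) simp
    then show ?thesis
      using that p1 by (auto simp: Wp_def T_def p_variation_scale ennreal_mult_less_top)
  qed
  have T_cont: "continuous_map mtopology mtopology T"
    unfolding metric_continuous_map[OF Metric_space_axioms]
  proof (intro conjI ballI allI impI)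
    show "T ` Wp p \<subseteq> Wp p" using T_in by blast
    fix g and e :: real assume g: "g \<in> Wp p" and e: "e > 0"
    have dist: "Wp_dist p (T g) (T g') = \<bar>c\<bar> * Wp_dist p g g'" for g'
    proof -
      have "Wp_dist p (T g) (T g') = Wp_norm p (\<lambda>t. c * (g t - g' t))"
        unfolding Wp_dist_def by (rule Wp_norm_cong) (simp add: T_def right_diff_distrib)
      then show ?thesis unfolding Wp_norm_scale[OF p1] Wp_dist_def .
    qed
    show "\<exists>\<delta>>0. \<forall>x. x \<in> Wp p \<and> Wp_dist p g x < \<delta> \<longrightarrow> Wp_dist p (T g) (T x) < e"
    proof (intro exI conjI allI impI)
      show "e / (\<bar>c\<bar> + 1) > 0" using e by simp
      fix x assume "x \<in> Wp p \<and> Wp_dist p g x < e / (\<bar>c\<bar> + 1)"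
      then have "(\<bar>c\<bar> + 1) * Wp_dist p g x < e" by (simp add: field_simps)
      moreover have "\<bar>c\<bar> * Wp_dist p g x \<le> (\<bar>c\<bar> + 1) * Wp_dist p g x" by (simp add: distrib_right)
      ultimately show "Wp_dist p (T g) (T x) < e" unfolding dist by linarith
    qed
  qed
  have T_W: "T (\<lambda>t\<in>{0..1}. W t w) = Z0 w" for w
    unfolding T_def Z0_def by (rule restrict_ext) simp
  have sep: "separable_borel N Z0"
    using separable_borel_image[OF assms(12) T_cont] unfolding T_W .
  \<comment> \<open>Membership holds at every outcome because the range condition says so; the
    regularity of \<open>W\<close> alone gives it only almost surely.\<close>
  then have Z0_in: "Z0 w \<in> Wp p" if "w \<in> space N" for w
    using that unfolding separable_borel_def by blast
  have Z_in: "Z n w \<in> Wp p" for n w unfolding Z_def by (rule step_path_in_Wp[OF p1])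
  have Z_meas: "(\<lambda>w. f (Z n w)) \<in> borel_measurable M" if "continuous_map mtopology euclideanreal f" for f n
    unfolding Z_def by (rule measurable_Wp_functional[OF p1 that]) measurable
  have conv: "(\<lambda>n. expectation (\<lambda>w. f (Z n w))) \<longlonglongrightarrow> (\<integral>w. f (Z0 w) \<partial>N)"
    if "r \<ge> 0" "\<And>x y. x \<in> Wp p \<Longrightarrow> y \<in> Wp p \<Longrightarrow> \<bar>f x - f y\<bar> \<le> r * Wp_dist p x y" "\<And>x. x \<in> Wp p \<Longrightarrow> \<bar>f x\<bar> \<le> B" for f r B
    unfolding Z_def Z0_def c_def
    by (rule Lipschitz_functional_convergence[OF assms(11,10) that(1) sep[unfolded Z0_eq] Z0_in[unfolded Z0_eq] assms(7) that(2,3)])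
  have main: "(\<lambda>n. expectation (\<lambda>w. h (Z n w))) \<longlonglongrightarrow> (\<integral>w. h (Z0 w) \<partial>N)"
    if h: "continuous_map mtopology euclideanreal h" and B: "\<And>x. x \<in> Wp p \<Longrightarrow> \<bar>h x\<bar> \<le> B" for h B
  proof -
    have lower: "\<forall>\<^sub>F n in sequentially. (\<integral>w. h (Z0 w) \<partial>N) - e < expectation (\<lambda>w. h (Z n w))"
      if "continuous_map mtopology euclideanreal h" "\<And>x. x \<in> Wp p \<Longrightarrow> \<bar>h x\<bar> \<le> B" "e > 0" for h e
      by (rule Lipschitz_convergence_lower[OF prob_space_axioms N.prob_space_axioms Z_in Z0_in Z_meas
            separable_borel_borel_measurable[OF sep] conv that])
    show ?thesis
    proof (rule LIMSEQ_I)
      fix e :: real assume e: "e > 0"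
      \<comment> \<open>The lower bound for \<open>- h\<close> is the missing upper bound for
        \<open>h\<close>.\<close>
      have "continuous_map mtopology euclideanreal (\<lambda>x. - h x)" using h by (rule continuous_map_minus)
      then have "\<forall>\<^sub>F n in sequentially. (\<integral>w. - h (Z0 w) \<partial>N) - e < expectation (\<lambda>w. - h (Z n w))"
        by (rule lower) (use B e in auto)
      moreover have "\<forall>\<^sub>F n in sequentially. (\<integral>w. h (Z0 w) \<partial>N) - e < expectation (\<lambda>w. h (Z n w))"
        by (rule lower[OF h _ e]) (rule B)
      ultimately have "\<forall>\<^sub>F n in sequentially. norm (expectation (\<lambda>w. h (Z n w)) - (\<integral>w. h (Z0 w) \<partial>N)) < e"
        by eventually_elim (simp add: abs_less_iff)
      then show "\<exists>no. \<forall>n\<ge>no. norm (expectation (\<lambda>w. h (Z n w)) - (\<integral>w. h (Z0 w) \<partial>N)) < e"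
        by (simp add: eventually_sequentially)
    qed
  qed
  have outer: "(\<lambda>n. outer_expectation M (\<lambda>w. ereal (h (Z n w)))) \<longlonglongrightarrow> ereal (\<integral>w. h (Z0 w) \<partial>N)"
    if h: "continuous_map mtopology euclideanreal h" "bounded (h ` Wp p)" for h
  proof -
    from h(2) obtain B where B: "\<And>x. x \<in> Wp p \<Longrightarrow> \<bar>h x\<bar> \<le> B" unfolding bounded_iff by auto
    have "outer_expectation M (\<lambda>w. ereal (h (Z n w))) = ereal (expectation (\<lambda>w. h (Z n w)))" for n
      by (rule outer_expectation_measurable[OF prob_space_axioms Z_meas[OF h(1)], where B=B]) (use B Z_in in auto)
    then show ?thesis using main[OF h(1) B] by simp
  qed
  have Z_eq: "(\<lambda>t\<in>{0..1}. real n powr (-1/2) * partial_sum_process X n t w) = Z n w" for n w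
    unfolding Z_def assms(9) by (rule partial_sum_process_step_path)
  show ?thesis
    unfolding converges_outer_distr_def Z_eq c_def[symmetric] Z0_def[symmetric]
    using sep Z_in outer prob_space_axioms N.prob_space_axioms by auto
qed

end
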